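(* Let $A$ be a finite commutative local ring with maximal ideal $\mathfrak{m}_A$. If $\mathrm{char}(A/\mathfrak{m}_A)>2$, then there is an exact sequence of $\mathcal{G}_A$-modules $$\mathcal{RP}_1(A)\longrightarrow H_2(\mathrm{B}(A),\mathbb{Z})\longrightarrow H_2(\mathrm{SL}_2(A),\mathbb{Z})\longrightarrow 0 .$$
   Context: $A^\times$ is the group of units of $A$ and $\mathcal{G}_A:=A^\times/(A^\times)^2$ is the square class group; $\langle a\rangle\in\mathcal{G}_A$ is the class of $a\in A^\times$. $\mathrm{B}(A)$ is the subgroup of upper triangular matrices in $\mathrm{SL}_2(A)$. $H_i(G,\mathbb{Z})$ is integral group homology. Action of $\mathcal{G}_A$: conjugation by $\mathrm{diag}(a,1)$, $a\in A^\times$, on $\mathrm{B}(A)$ and $\mathrm{SL}_2(A)$ induces an action of $A^\times$ on their homology, which factors through $\mathcal{G}_A$. Definition of $\mathcal{RP}_1(A)$: a column vector $\pmb{u}\in A^2$ is unimodular if it is the first column of some matrix in $\mathrm{GL}_2(A)$; $\langle\pmb{v}\rangle=\{\pmb{v}a: a\in A\}$ is the line spanned by $\pmb{v}$. For $n\ge 0$ let $X_n(A^2)$ be the free abelian group on the $(n+1)$-tuples $(\langle\pmb{v}_0\rangle,\dots,\langle\pmb{v}_n\rangle)$ with every $\pmb{v}_i\in A^2$ unimodular and $(\pmb{v}_i,\pmb{v}_j)\in\mathrm{GL}_2(A)$ for $i\ne j$. $\mathrm{GL}_2(A)$ acts by $g(\langle\pmb{v}_0\rangle,\dots,\langle\pmb{v}_n\rangle)=(\langle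 g\pmb{v}_0\rangle,\dots,\langle g\pmb{v}_n\rangle)$. Let $\partial_n:X_n(A^2)\to X_{n-1}(A^2)$ ($n\ge 1$) be the alternating sum of the face maps omitting the $i$-th entry, and $Z_n(A^2)=\ker\partial_n$. With $M_{\mathrm{SL}_2(A)}$ denoting coinvariants, put $\mathcal{RP}(A):=Z_2(A^2)_{\mathrm{SL}_2(A)}$. Write $\pmb{\infty}=\langle\pmb{e}_1\rangle$, $\pmb{0}=\langle\pmb{e}_2\rangle$, $\pmb{a}=\langle\pmb{e}_1+a\pmb{e}_2\rangle$ for $a\in A^\times$, where $\pmb{e}_1,\pmb{e}_2$ is the standard basis. The classes of $(\pmb{\infty},\pmb{0},\pmb{a})$, $\langle a\rangle\in\mathcal{G}_A$, identify $X_2(A^2)_{\mathrm{SL}_2(A)}$ with $\mathbb{Z}[\mathcal{G}_A]$. The inclusion $Z_2(A^2)\subseteq X_2(A^2)$ induces $\lambda:\mathcal{RP}(A)\to\mathbb{Z}[\mathcal{G}_A]$, and $\mathcal{RP}_1(A):=\ker\lambda$ (the refined scissors congruence group). The $\mathcal{G}_A$-module structure on $\mathcal{RP}(A)$ and $\mathcal{RP}_1(A)$ is induced by the $\mathrm{GL}_2(A)$-action on $Z_2(A^2)$ via $\mathrm{GL}_2(A)/\mathrm{SL}_2(A)\simeq A^\times$ (squares act trivially since scalar matrices act trivially). *)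

theory Defs
  imports "HOL-Analysis.Analysis" "HOL-Algebra.Algebra" "HOL-Algebra.Algebraic_Closure_Type"
begin

section \<open>Integral group homology (inhomogeneous bar complex)\<close>

definition bar_group :: "nat \<Rightarrow> ('g, 'b) monoid_scheme \<Rightarrow> ('g list \<Rightarrow>\<^sub>0 int) monoid" where
  "bar_group n G = free_Abelian_group {gs. length gs = n \<and> set gs \<subseteq> carrier G}"

definition bar_face :: "('g, 'b) monoid_scheme \<Rightarrow> nat \<Rightarrow> nat \<Rightarrow> 'g list \<Rightarrow> 'g list" where
  "bar_face G n i gs =
     (if i = 0 then tl gs
      else if i = n then butlast gs
      else take (i - 1) gs @ [gs ! (i - 1) \<otimes>\<^bsub>G\<^esub> gs ! i] @ drop (i + 1) gs)"

definition bar_boundary ::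
    "('g, 'b) monoid_scheme \<Rightarrow> nat \<Rightarrow> ('g list \<Rightarrow>\<^sub>0 int) \<Rightarrow> ('g list \<Rightarrow>\<^sub>0 int)" where
  "bar_boundary G n c =
     (if n = 0 then 0
      else frag_extend (\<lambda>gs. \<Sum>i\<le>n. frag_cmul ((-1) ^ i) (frag_of (bar_face G n i gs))) c)"

definition bar_cycles :: "nat \<Rightarrow> ('g, 'b) monoid_scheme \<Rightarrow> ('g list \<Rightarrow>\<^sub>0 int) monoid" where
  "bar_cycles n G = subgroup_generated (bar_group n G)
     (kernel (bar_group n G) (bar_group (n - 1) G) (bar_boundary G n))"

definition bar_boundaries :: "nat \<Rightarrow> ('g, 'b) monoid_scheme \<Rightarrow> ('g list \<Rightarrow>\<^sub>0 int) set" where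
  "bar_boundaries n G = bar_boundary G (Suc n) ` carrier (bar_group (Suc n) G)"

definition group_homology :: "nat \<Rightarrow> ('g, 'b) monoid_scheme \<Rightarrow> ('g list \<Rightarrow>\<^sub>0 int) set monoid" where
  "group_homology n G = bar_cycles n G Mod bar_boundaries n G"

text \<open>
  If a homomorphism \<open>h\<close> from \<open>M\<close> to \<open>M'\<close> maps the subgroup \<open>N\<close> into \<open>N'\<close>, then
  \<open>quotient_map M' N' h\<close> is the induced map from \<open>M Mod N\<close> to \<open>M' Mod N'\<close>: for a coset
  \<open>C\<close> of \<open>N\<close>, the set of all products of elements of \<open>N'\<close> and \<open>h ` C\<close> is a single coset.
\<close>

definition quotient_map :: "('m, 'b) monoid_scheme \<Rightarrow> 'm set \<Rightarrow> ('l \<Rightarrow> 'm) \<Rightarrow> 'l set \<Rightarrow> 'm set" where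
  "quotient_map M' N' h C = N' <#>\<^bsub>M'\<^esub> (h ` C)"

definition homology_map ::
    "nat \<Rightarrow> ('h, 'b) monoid_scheme \<Rightarrow> ('g \<Rightarrow> 'h) \<Rightarrow> ('g list \<Rightarrow>\<^sub>0 int) set \<Rightarrow> ('h list \<Rightarrow>\<^sub>0 int) set" where
  "homology_map n H \<phi> =
     quotient_map (bar_cycles n H) (bar_boundaries n H) (frag_extend (frag_of \<circ> map \<phi>))"


section \<open>Coinvariants\<close>

definition coinvariant_relations ::
    "('g, 'b) monoid_scheme \<Rightarrow> ('g \<Rightarrow> 'm \<Rightarrow> 'm) \<Rightarrow> ('m, 'c) monoid_scheme \<Rightarrow> 'm set" where
  "coinvariant_relations G \<alpha> M =
     generate M {\<alpha> g x \<otimes>\<^bsub>M\<^esub> inv\<^bsub>M\<^esub> x | g x. g \<in> carrier G \<and> x \<in> carrier M}"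

definition coinvariants ::
    "('g, 'b) monoid_scheme \<Rightarrow> ('g \<Rightarrow> 'm \<Rightarrow> 'm) \<Rightarrow> ('m, 'c) monoid_scheme \<Rightarrow> 'm set monoid" where
  "coinvariants G \<alpha> M = M Mod coinvariant_relations G \<alpha> M"


section \<open>Units, square classes and two-by-two matrices\<close>

abbreviation type_ring :: "'a::comm_ring_1 itself \<Rightarrow> 'a ring" where
  "type_ring _ \<equiv> ring_of_type_algebra"

definition square_class_group :: "'a::comm_ring_1 itself \<Rightarrow> 'a set monoid" where
  "square_class_group T =
     units_of (type_ring T) Mod ((\<lambda>a. a * a) ` Units (type_ring T))"

definition SL2 :: "'a::comm_ring_1 itself \<Rightarrow> ('a^2^2) monoid" where
  "SL2 _ = \<lparr>carrier = {M. det M = 1}, mult = (**), one = mat 1\<rparr>"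

definition B2 :: "'a::comm_ring_1 itself \<Rightarrow> ('a^2^2) monoid" where
  "B2 T = (SL2 T)\<lparr>carrier := {M. det M = 1 \<and> M $ 2 $ 1 = 0}\<rparr>"

definition diag1 :: "'a::comm_ring_1 \<Rightarrow> 'a^2^2" where
  "diag1 a = vector [vector [a, 0], vector [0, 1]]"

definition diag1_conj :: "'a::comm_ring_1 \<Rightarrow> 'a^2^2 \<Rightarrow> 'a^2^2" where
  "diag1_conj a M = diag1 a ** M ** matrix_inv (diag1 a)"

definition H2_SL2 :: "'a::comm_ring_1 itself \<Rightarrow> (('a^2^2) list \<Rightarrow>\<^sub>0 int) set monoid" where
  "H2_SL2 T = group_homology 2 (SL2 T)"

definition H2_B2 :: "'a::comm_ring_1 itself \<Rightarrow> (('a^2^2) list \<Rightarrow>\<^sub>0 int) set monoid" where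
  "H2_B2 T = group_homology 2 (B2 T)"

definition H2_SL2_act ::
    "'a::comm_ring_1 \<Rightarrow> (('a^2^2) list \<Rightarrow>\<^sub>0 int) set \<Rightarrow> (('a^2^2) list \<Rightarrow>\<^sub>0 int) set" where
  "H2_SL2_act a = homology_map 2 (SL2 TYPE('a)) (diag1_conj a)"

definition H2_B2_act ::
    "'a::comm_ring_1 \<Rightarrow> (('a^2^2) list \<Rightarrow>\<^sub>0 int) set \<Rightarrow> (('a^2^2) list \<Rightarrow>\<^sub>0 int) set" where
  "H2_B2_act a = homology_map 2 (B2 TYPE('a)) (diag1_conj a)"

definition H2_inclusion ::
    "(('a::comm_ring_1^2^2) list \<Rightarrow>\<^sub>0 int) set \<Rightarrow> (('a^2^2) list \<Rightarrow>\<^sub>0 int) set" where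
  "H2_inclusion = homology_map 2 (SL2 TYPE('a)) (\<lambda>M. M)"


section \<open>The refined scissors congruence group\<close>

definition unimodular :: "'a::comm_ring_1^2 \<Rightarrow> bool" where
  "unimodular u \<longleftrightarrow> (\<exists>M::'a^2^2. invertible M \<and> column 1 M = u)"

definition line :: "'a::comm_ring_1^2 \<Rightarrow> ('a^2) set" where
  "line v = range (\<lambda>a. a *s v)"

definition config_tuples :: "nat \<Rightarrow> ('a::comm_ring_1^2) set list set" where
  "config_tuples n = {map line vs | vs. length vs = Suc n \<and> (\<forall>v\<in>set vs. unimodular v) \<and>
     (\<forall>i<Suc n. \<forall>j<Suc n. i \<noteq> j \<longrightarrow> invertible (transpose (vector [vs ! i, vs ! j]) :: 'a^2^2))}"

definition config_group :: "'a::comm_ring_1 itself \<Rightarrow> nat \<Rightarrow> (('a^2) set list \<Rightarrow>\<^sub>0 int) monoid" where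
  "config_group _ n = free_Abelian_group (config_tuples n)"

definition config_boundary ::
    "nat \<Rightarrow> (('a::comm_ring_1^2) set list \<Rightarrow>\<^sub>0 int) \<Rightarrow> (('a^2) set list \<Rightarrow>\<^sub>0 int)" where
  "config_boundary n = frag_extend
     (\<lambda>t. \<Sum>i\<le>n. frag_cmul ((-1) ^ i) (frag_of (take i t @ drop (Suc i) t)))"

definition config_cycles :: "'a::comm_ring_1 itself \<Rightarrow> nat \<Rightarrow> (('a^2) set list \<Rightarrow>\<^sub>0 int) monoid" where
  "config_cycles T n = subgroup_generated (config_group T n)
     (kernel (config_group T n) (config_group T (n - 1)) (config_boundary n))"

definition tuple_act :: "'a::comm_ring_1^2^2 \<Rightarrow> ('a^2) set list \<Rightarrow> ('a^2) set list" where
  "tuple_act M = map ((`) ((*v) M))"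

definition config_act ::
    "'a::comm_ring_1^2^2 \<Rightarrow> (('a^2) set list \<Rightarrow>\<^sub>0 int) \<Rightarrow> (('a^2) set list \<Rightarrow>\<^sub>0 int)" where
  "config_act M = frag_extend (frag_of \<circ> tuple_act M)"

definition RP :: "'a::comm_ring_1 itself \<Rightarrow> (('a^2) set list \<Rightarrow>\<^sub>0 int) set monoid" where
  "RP T = coinvariants (SL2 T) config_act (config_cycles T 2)"

text \<open>The triple \<open>(\<infinity>, 0, a)\<close>.\<close>

definition std_triple :: "'a::comm_ring_1 \<Rightarrow> ('a^2) set list" where
  "std_triple a = [line (axis 1 1), line (axis 2 1), line (axis 1 1 + a *s axis 2 1)]"

text \<open>
  The \<open>SL2\<close>-orbit of a triple \<open>t\<close> contains \<open>(\<infinity>, 0, a)\<close> precisely for the units \<open>a\<close> of one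
  square class, which determines the orbit (see the lemmas below). Sending \<open>t\<close> to this class is
  therefore the identification of the coinvariants of \<open>config_group T 2\<close> with the group ring
  \<open>\<int>[square_class_group T]\<close> under which \<open>(\<infinity>, 0, a)\<close> corresponds to the class of \<open>a\<close>.
\<close>

definition triple_class :: "('a::comm_ring_1^2) set list \<Rightarrow> 'a set" where
  "triple_class t = {a \<in> Units (type_ring TYPE('a)).
     \<exists>M\<in>carrier (SL2 TYPE('a)). t = tuple_act M (std_triple a)}"

lemma Units_type_ring_iff: "a \<in> Units (type_ring TYPE('a::comm_ring_1)) \<longleftrightarrow> (\<exists>b. a * b = 1)"
  by (auto simp: Units_def ring_of_type_algebra_def mult.commute)

lemma type_ring_mult: "a \<otimes>\<^bsub>type_ring T\<^esub> b = a * b"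
  by (simp add: ring_of_type_algebra_def)

lemma mem_line_iff: "w \<in> line v \<longleftrightarrow> (\<exists>c. w = c *s v)"
  by (auto simp: line_def)

lemma matrix_vector_mult_smult: "M *v (c *s v) = c *s (M *v v)" for M :: "'a::comm_ring_1^2^2"
  by (simp add: vec_eq_iff forall_2 matrix_vector_mult_def sum_2 algebra_simps)

lemma image_line: "(*v) M ` line v = line (M *v v)"
  by (simp add: line_def image_image matrix_vector_mult_smult)

lemma line_smult: "a * b = 1 \<Longrightarrow> line (a *s v) = line v"
proof -
  assume ab: "a * b = 1"
  have "c *s v = (c * b) *s (a *s v)" for c
    using ab by (metis mult.assoc mult.commute mult_1 vector_smult_assoc)
  then show ?thesis
    by (auto simp: line_def vector_smult_assoc)
qed

lemma tuple_act_std_triple: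
  "tuple_act M (std_triple a) =
     [line (M *v axis 1 1), line (M *v axis 2 1), line (M *v (axis 1 1 + a *s axis 2 1))]"
  by (simp add: tuple_act_def std_triple_def image_line)

lemma tuple_act_mult: "tuple_act (M ** N) t = tuple_act M (tuple_act N t)"
  by (simp add: tuple_act_def image_image matrix_vector_mul_assoc)

lemma tuple_act_id: "tuple_act (mat 1) t = t"
  by (simp add: tuple_act_def map_idI)

lemma SL2_inverse:
  assumes "M \<in> carrier (SL2 TYPE('a::comm_ring_1))"
  obtains N where "N \<in> carrier (SL2 TYPE('a))" "N ** M = mat 1"
proof
  let ?N = "vector [vector [M$2$2, - M$1$2], vector [- M$2$1, M$1$1]] :: 'a^2^2"
  show "?N \<in> carrier (SL2 TYPE('a))"
    using assms by (simp add: SL2_def det_2 algebra_simps)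
  show "?N ** M = mat 1"
    using assms
    by (simp add: SL2_def det_2 vec_eq_iff forall_2 matrix_matrix_mult_def sum_2 mat_def algebra_simps)
qed

lemma SL2_mult:
  "M \<in> carrier (SL2 T) \<Longrightarrow> N \<in> carrier (SL2 T) \<Longrightarrow> M ** N \<in> carrier (SL2 T)"
  by (simp add: SL2_def det_mul)

lemma SL2_one: "mat 1 \<in> carrier (SL2 T)"
  by (simp add: SL2_def)

lemma std_triple_orbit_iff:
  assumes b: "b \<in> Units (type_ring TYPE('a::comm_ring_1))"
  shows "(\<exists>M\<in>carrier (SL2 TYPE('a)). std_triple a = tuple_act M (std_triple b)) \<longleftrightarrow>
     (\<exists>c\<in>Units (type_ring TYPE('a)). b = c * c * a)"
proof
  assume "\<exists>M\<in>carrier (SL2 TYPE('a)). std_triple a = tuple_act M (std_triple b)"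
  then obtain M :: "'a^2^2" where M: "det M = 1" and
    eq: "std_triple a = tuple_act M (std_triple b)"
    by (auto simp: SL2_def)
  have "M *v axis 1 1 \<in> line (axis 1 1)" "M *v axis 2 1 \<in> line (axis 2 1)"
    "M *v (axis 1 1 + b *s axis 2 1) \<in> line (axis 1 1 + a *s axis 2 1)"
    using eq unfolding tuple_act_std_triple by (auto simp: std_triple_def mem_line_iff intro: exI[of _ 1])
  then obtain k where z: "M$2$1 = 0" "M$1$2 = 0" and k: "M$1$1 = k" "M$2$2 * b = k * a"
    by (auto simp: mem_line_iff vec_eq_iff forall_2 matrix_vector_mult_def sum_2 axis_def)
  have u: "k * M$2$2 = 1" using M z k by (simp add: det_2)
  have "b = k * (M$2$2 * b)" using u by (simp add: mult.assoc[symmetric])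
  then have "b = k * k * a" by (simp add: k mult.assoc)
  then show "\<exists>c\<in>Units (type_ring TYPE('a)). b = c * c * a"
    using u Units_type_ring_iff[of k] by blast
next
  assume "\<exists>c\<in>Units (type_ring TYPE('a)). b = c * c * a"
  then obtain c d where cd: "c * d = 1" "b = c * c * a"
    by (auto simp: Units_type_ring_iff)
  let ?M = "vector [vector [c, 0], vector [0, d]] :: 'a^2^2"
  have dd: "d * b = c * a" using cd by (metis mult.assoc mult.commute mult_1)
  have "?M *v axis 1 1 = c *s axis 1 1" "?M *v axis 2 1 = d *s axis 2 1"
    "?M *v (axis 1 1 + b *s axis 2 1) = c *s (axis 1 1 + a *s axis 2 1)"
    using dd by (simp_all add: vec_eq_iff forall_2 matrix_vector_mult_def sum_2 axis_def)
  then have "std_triple a = tuple_act ?M (std_triple b)"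
    unfolding tuple_act_std_triple
    using line_smult[OF cd(1)] line_smult[of d c] cd(1)
    by (simp only: std_triple_def mult.commute)
  moreover have "?M \<in> carrier (SL2 TYPE('a))" using cd by (simp add: SL2_def det_2)
  ultimately show "\<exists>M\<in>carrier (SL2 TYPE('a)). std_triple a = tuple_act M (std_triple b)" by blast
qed

lemma triple_class_tuple_act:
  assumes M: "M \<in> carrier (SL2 TYPE('a::comm_ring_1))"
  shows "triple_class (tuple_act M t) = triple_class t"
proof -
  obtain N where N: "N \<in> carrier (SL2 TYPE('a))" "N ** M = mat 1"
    using SL2_inverse[OF M] .
  have "t = tuple_act N (tuple_act M t)" by (simp add: tuple_act_mult[symmetric] N tuple_act_id)
  then show ?thesis
    unfolding triple_class_def by (metis (no_types, lifting) M N(1) SL2_mult tuple_act_mult)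
qed

lemma triple_class_std_triple:
  assumes a: "a \<in> Units (type_ring TYPE('a::comm_ring_1))"
  shows "triple_class (std_triple a) =
    ((\<lambda>b. b * b) ` Units (type_ring TYPE('a))) #>\<^bsub>units_of (type_ring TYPE('a))\<^esub> a"
proof -
  have "b \<in> Units (type_ring TYPE('a))"
    if "c \<in> Units (type_ring TYPE('a))" "b = c * c * a" for b c
  proof -
    from a that(1) obtain x y where "a * x = 1" "c * y = 1" by (auto simp: Units_type_ring_iff)
    then have "b * (y * y * x) = 1" unfolding that(2) by (metis mult.assoc mult.commute mult_1)
    then show ?thesis by (auto simp: Units_type_ring_iff)
  qed
  then have "triple_class (std_triple a) = {b. \<exists>c\<in>Units (type_ring TYPE('a)). b = c * c * a}"
    unfolding triple_class_def using std_triple_orbit_iff by blast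
  then show ?thesis
    by (auto simp: r_coset_def units_of_mult type_ring_mult)
qed

lemma config_tuple_orbit:
  assumes "t \<in> config_tuples 2"
  obtains a M where "a \<in> Units (type_ring TYPE('a::comm_ring_1))"
    "M \<in> carrier (SL2 TYPE('a))" "t = tuple_act M (std_triple a)"
proof -
  from assms obtain vs where vs: "t = map line vs" "length vs = 3"
    and inv: "\<And>i j. i < 3 \<Longrightarrow> j < 3 \<Longrightarrow> i \<noteq> j \<Longrightarrow>
      invertible (transpose (vector [vs ! i, vs ! j]) :: 'a^2^2)"
    by (auto simp: config_tuples_def numeral_eq_Suc)
  define u v w where "u = vs ! 0" and "v = vs ! 1" and "w = vs ! 2"
  have t: "t = [line u, line v, line w]"
    using vs by (auto simp: u_def v_def w_def numeral_eq_Suc length_Suc_conv)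
  have unit: "\<exists>e. det A * e = 1" if "invertible A" for A :: "'a^2^2"
    using that unfolding invertible_def by (metis det_I det_mul)
  have det: "det (transpose (vector [x, y]) :: 'a^2^2) = x$1 * y$2 - y$1 * x$2" for x y
    by (simp add: det_2 transpose_def)
  obtain d where d: "(u$1 * v$2 - v$1 * u$2) * d = 1"
    using unit[OF inv[of 0 1]] unfolding det u_def v_def by auto
  obtain e where e: "(u$1 * w$2 - w$1 * u$2) * e = 1"
    using unit[OF inv[of 0 2]] unfolding det u_def w_def by auto
  obtain f where f: "(w$1 * v$2 - v$1 * w$2) * f = 1"
    using unit[OF inv[of 2 1]] unfolding det v_def w_def by auto
  define D E F where DEF: "D = u$1 * v$2 - v$1 * u$2" "E = u$1 * w$2 - w$1 * u$2" "F = w$1 * v$2 - v$1 * w$2"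
  note d = d[folded DEF] and e = e[folded DEF] and f = f[folded DEF]
  let ?a = "D * E * f"
  let ?M = "transpose (vector [u, d *s v]) :: 'a^2^2"
  have "?a * (d * e * F) = (D * d) * (E * e) * (F * f)" by (simp add: ac_simps)
  then have "?a * (d * e * F) = 1" by (simp add: d e f)
  then have a: "?a \<in> Units (type_ring TYPE('a))" unfolding Units_type_ring_iff by blast
  have "u$1 * (d * v$2) - (d * v$1) * u$2 = D * d" by (simp add: DEF algebra_simps)
  then have M: "?M \<in> carrier (SL2 TYPE('a))" unfolding SL2_def using det[of u "d *s v"] d by simp
  have M1: "?M *v axis 1 1 = u" and M2: "?M *v axis 2 1 = d *s v"
    by (simp_all add: vec_eq_iff forall_2 matrix_vector_mult_def sum_2 axis_def transpose_def)
  have "D *s w = F *s u + E *s v"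
    by (simp add: vec_eq_iff forall_2 DEF algebra_simps)
  then have "f *s (D *s w) = (f * F) *s u + (f * E) *s v"
    by (simp add: vector_add_ldistrib vector_smult_assoc)
  then have "(f * D) *s w = u + (f * E) *s v" by (simp add: vector_smult_assoc f mult.commute[of f F])
  moreover have "?a * d = f * E" using d by (metis mult.assoc mult.commute mult_1)
  ultimately have "?M *v (axis 1 1 + ?a *s axis 2 1) = (f * D) *s w"
    unfolding matrix_vector_right_distrib matrix_vector_mult_smult M1 M2
    by (simp add: vector_smult_assoc)
  moreover have "(f * D) * (F * d) = 1" using d f by (metis mult.assoc mult.commute mult_1)
  ultimately have "t = tuple_act ?M (std_triple ?a)"
    unfolding tuple_act_std_triple t M1 M2 using line_smult[of d D v] line_smult[of "f * D" "F * d" w] d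
    by (simp only: mult.commute)
  then show ?thesis using that[OF a M] by blast
qed

lemma triple_class_in_square_class_group:
  assumes "t \<in> config_tuples 2"
  shows "triple_class t \<in> carrier (square_class_group TYPE('a::comm_ring_1))"
proof -
  obtain a M where *: "a \<in> Units (type_ring TYPE('a))"
    "M \<in> carrier (SL2 TYPE('a))" "t = tuple_act M (std_triple a)"
    using config_tuple_orbit[OF assms] .
  then show ?thesis
    by (auto simp: triple_class_tuple_act triple_class_std_triple square_class_group_def
        FactGroup_def RCOSETS_def units_of_def)
qed

lemma triple_class_eq_iff:
  assumes t: "t \<in> config_tuples 2" and t': "t' \<in> config_tuples 2"
  shows "triple_class t = triple_class t' \<longleftrightarrow>
    (\<exists>M\<in>carrier (SL2 TYPE('a::comm_ring_1)). t' = tuple_act M t)"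
proof
  assume eq: "triple_class t = triple_class t'"
  obtain a M where *: "a \<in> Units (type_ring TYPE('a))"
    "M \<in> carrier (SL2 TYPE('a))" "t = tuple_act M (std_triple a)"
    using config_tuple_orbit[OF t] .
  then have "a \<in> triple_class t'" unfolding eq[symmetric] by (auto simp: triple_class_def)
  then obtain N where N: "N \<in> carrier (SL2 TYPE('a))" "t' = tuple_act N (std_triple a)"
    by (auto simp: triple_class_def)
  obtain L where L: "L \<in> carrier (SL2 TYPE('a))" "L ** M = mat 1" using SL2_inverse[OF *(2)] .
  have "t' = tuple_act (N ** L) t"
    using L(2) by (simp add: tuple_act_mult[symmetric] N *(3) tuple_act_id matrix_mul_assoc[symmetric])
  then show "\<exists>M\<in>carrier (SL2 TYPE('a)). t' = tuple_act M t"
    using SL2_mult[OF N(1) L(1)] by blast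
qed (auto simp: triple_class_tuple_act)


lemma invertible_2:
  assumes "det A * e = 1"
  shows "invertible (A :: 'a::comm_ring_1^2^2)"
  unfolding invertible_def
proof (intro exI conjI)
  let ?B = "vector [vector [e * A$2$2, - (e * A$1$2)], vector [- (e * A$2$1), e * A$1$1]] :: 'a^2^2"
  have *: "A$1$1 * A$2$2 * e - A$1$2 * A$2$1 * e = 1" using assms by (simp add: det_2 algebra_simps)
  show "A ** ?B = mat 1" "?B ** A = mat 1"
    using * by (simp_all add: vec_eq_iff forall_2 matrix_matrix_mult_def sum_2 mat_def algebra_simps)
qed

lemma std_triple_in_config_tuples:
  assumes "a \<in> Units (type_ring TYPE('a::comm_ring_1))"
  shows "std_triple a \<in> config_tuples 2"
proof -
  obtain b where b: "a * b = 1" using assms by (auto simp: Units_type_ring_iff)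
  let ?vs = "[axis 1 1, axis 2 1, axis 1 1 + a *s axis 2 1] :: ('a^2) list"
  have inv: "invertible (transpose (vector [x, y]) :: 'a^2^2)"
    if "(x$1 * y$2 - y$1 * x$2) * e = 1" for x y :: "'a^2" and e :: 'a
    by (rule invertible_2[of _ e]) (use that in \<open>simp add: det_2 transpose_def\<close>)
  have col: "column 1 (transpose (vector [x, y]) :: 'a^2^2) = x" for x y
    by (simp add: column_def transpose_def vec_eq_iff forall_2)
  have uni: "unimodular x" if "(x$1 * y$2 - y$1 * x$2) * e = 1" for x y :: "'a^2" and e
    unfolding unimodular_def using inv[OF that] col by blast
  have "unimodular v" if "v \<in> set ?vs" for v
    using that uni[of "axis 1 1" "axis 2 1" 1] uni[of "axis 2 1" "axis 1 1" "-1"]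
      uni[of "axis 1 1 + a *s axis 2 1" "axis 2 1" 1]
    by (auto simp: axis_def)
  moreover have "invertible (transpose (vector [?vs ! i, ?vs ! j]) :: 'a^2^2)"
    if "i < Suc 2" "j < Suc 2" "i \<noteq> j" for i j
  proof -
    have "i = 0 \<or> i = 1 \<or> i = 2" "j = 0 \<or> j = 1 \<or> j = 2" using that by auto
    then show ?thesis
      using that(3) inv[of "?vs ! i" "?vs ! j" 1] inv[of "?vs ! i" "?vs ! j" "-1"]
        inv[of "?vs ! i" "?vs ! j" b] inv[of "?vs ! i" "?vs ! j" "-b"] b
      by (elim disjE) (simp_all add: axis_def)
  qed
  ultimately show ?thesis
    unfolding config_tuples_def std_triple_def by (intro CollectI exI[of _ ?vs]) auto
qed

definition square_class_ring :: "'a::comm_ring_1 itself \<Rightarrow> ('a set \<Rightarrow>\<^sub>0 int) monoid" where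
  "square_class_ring T = free_Abelian_group (carrier (square_class_group T))"

text \<open>
  The map \<open>frag_extend (frag_of \<circ> triple_class)\<close> is \<open>SL2\<close>-invariant, hence constant on every
  coset in \<open>RP\<close>.
\<close>

definition RP_lambda :: "(('a::comm_ring_1^2) set list \<Rightarrow>\<^sub>0 int) set \<Rightarrow> ('a set \<Rightarrow>\<^sub>0 int)" where
  "RP_lambda C = the_elem (frag_extend (frag_of \<circ> triple_class) ` C)"

definition RP1 :: "'a::comm_ring_1 itself \<Rightarrow> (('a^2) set list \<Rightarrow>\<^sub>0 int) set monoid" where
  "RP1 T = subgroup_generated (RP T) (kernel (RP T) (square_class_ring T) RP_lambda)"

text \<open>
  The unit \<open>a\<close> acts through the matrix \<open>diag(a, 1)\<close>, which corresponds to \<open>a\<close> under the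
  isomorphism of \<open>GL2\<close> modulo \<open>SL2\<close> with the unit group given by the determinant.
\<close>

definition RP_act ::
    "'a::comm_ring_1 \<Rightarrow> (('a^2) set list \<Rightarrow>\<^sub>0 int) set \<Rightarrow> (('a^2) set list \<Rightarrow>\<^sub>0 int) set" where
  "RP_act a = quotient_map (config_cycles TYPE('a) 2)
     (coinvariant_relations (SL2 TYPE('a)) config_act (config_cycles TYPE('a) 2))
     (config_act (diag1 a))"


section \<open>Homomorphisms of modules over the square class group\<close>

text \<open>
  A module over the square class group is given by an action of the units through square
  classes. A homomorphism of such modules is a group homomorphism that commutes with the action
  of every square class, that is, with the action of every representative of it.
\<close>

definition square_class_hom ::
    "('m, 'b) monoid_scheme \<Rightarrow> ('a::comm_ring_1 \<Rightarrow> 'm \<Rightarrow> 'm) \<Rightarrow>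
     ('l, 'c) monoid_scheme \<Rightarrow> ('a \<Rightarrow> 'l \<Rightarrow> 'l) \<Rightarrow> ('m \<Rightarrow> 'l) set" where
  "square_class_hom M \<alpha> L \<beta> = {f \<in> hom M L.
     \<forall>C\<in>carrier (square_class_group TYPE('a)). \<forall>a\<in>C. \<forall>x\<in>carrier M. f (\<alpha> a x) = \<beta> a (f x)}"

end

theory Submission
  imports Defs
begin

(* clashes with the notation for matrix entries *)
no_notation fps_nth (infixl \<open>$\<close> 75)

text \<open>
  Tuples of lines in general position form an acyclic complex of \<open>SL2\<close>-modules in low degrees, so the
  bar complexes with coefficients in \<open>X\<^sub>0\<close>, \<open>X\<^sub>1\<close>, \<open>X\<^sub>2\<close> assemble into a double complex with exact
  rows. Its columns compute the homology of the stabilisers: the Borel subgroup, the diagonal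
  subgroup and \<open>{1, -1}\<close>. The connecting map sends a cycle \<open>z\<close> in the kernel of \<open>\<lambda>\<close> to the class of
  \<open>c\<close> obtained by the zigzag \<open>z = d y\<^sub>1\<close>, \<open>\<partial> y\<^sub>1 = d y\<^sub>2\<close>, \<open>\<partial> y\<^sub>2 \<sim> c\<close>. Two choices of \<open>c\<close> differ by a
  class which becomes, after doubling, the boundary of a class of the diagonal subgroup; this boundary
  vanishes because inversion acts trivially on the second homology of an abelian group, and the
  second homology of the Borel subgroup has no 2-torsion because the diagonal subgroup has odd
  index and an odd multiple of its second homology comes from a cyclic group. Surjectivity
  needs moreover that the image of \<open>\<lambda>\<close> contains twice the augmentation ideal (there are
  nonsquares \<open>x\<close> and \<open>1 - x\<close>), together with a parity invariant built from the quadratic character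
  of determinants.
\<close>

text \<open>Exactness is needed only at tuples of length at most two, and its price is a point
  transversal to any three given ones. Transversality depends only on reductions modulo
  \<open>\<mm>\<close>, so this is a question about the projective line over the residue field. Odd
  characteristic gives at least four points, which is just enough; over the field with three
  elements there are no others, so nothing stronger about general position can be asked for.
  Finiteness controls the units: the residue units are cyclic, generated by the class of
  \<open>\<gamma>\<close>, and \<open>1 + \<mm>\<close> has odd order. Hence there are exactly two
  square classes, the augmentation ideal of the group ring is infinite cyclic, and one integer
  measures the obstruction to surjectivity. For the same reason a square root of 1 is 1 or -1, so
  the stabilisers of triples contribute nothing but a central element of order two. This element is
  the source of the factor 2 that has to be cancelled in the Borel subgroup.\<close>

section \<open>Subgroups and homomorphisms of additively written groups\<close>

definition add_subgroup :: "'m::ab_group_add set \<Rightarrow> bool" where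
  "add_subgroup N \<longleftrightarrow> 0 \<in> N \<and> (\<forall>x\<in>N. \<forall>y\<in>N. x - y \<in> N)"

lemma add_subgroup_zero: "add_subgroup N \<Longrightarrow> 0 \<in> N"
  and add_subgroup_diff: "add_subgroup N \<Longrightarrow> x \<in> N \<Longrightarrow> y \<in> N \<Longrightarrow> x - y \<in> N"
  by (auto simp: add_subgroup_def)

lemma add_subgroup_minus: "add_subgroup N \<Longrightarrow> x \<in> N \<Longrightarrow> - x \<in> N"
  using add_subgroup_diff[of N 0 x] by (simp add: add_subgroup_zero)

lemma add_subgroup_add: "add_subgroup N \<Longrightarrow> x \<in> N \<Longrightarrow> y \<in> N \<Longrightarrow> x + y \<in> N"
  using add_subgroup_diff[of N x "- y"] by (simp add: add_subgroup_minus)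

lemma add_subgroup_cmul:
  assumes "add_subgroup N" "x \<in> N"
  shows "frag_cmul k x \<in> N"
proof -
  have "frag_cmul (int n) x \<in> N" for n
    by (induction n) (simp_all add: assms add_subgroup_zero add_subgroup_add frag_cmul_distrib)
  then show ?thesis
    using add_subgroup_minus[OF assms(1), of "frag_cmul (int n) x" for n]
    by (cases k rule: int_cases2) auto
qed

definition frags :: "'b set \<Rightarrow> ('b \<Rightarrow>\<^sub>0 int) set" where
  "frags K = {c. Poly_Mapping.keys c \<subseteq> K}"

lemma add_subgroup_frags: "add_subgroup (frags K)"
  using keys_diff by (fastforce simp: add_subgroup_def frags_def)

lemma frags_zero [simp]: "0 \<in> frags K"
  and frags_of [simp]: "frag_of x \<in> frags K \<longleftrightarrow> x \<in> K"
  and frags_diff: "a \<in> frags K \<Longrightarrow> b \<in> frags K \<Longrightarrow> a - b \<in> frags K"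
  and frags_add: "a \<in> frags K \<Longrightarrow> b \<in> frags K \<Longrightarrow> a + b \<in> frags K"
  and frags_minus: "a \<in> frags K \<Longrightarrow> - a \<in> frags K"
  and frags_cmul: "a \<in> frags K \<Longrightarrow> frag_cmul k a \<in> frags K"
  using add_subgroup_frags[of K]
  by (auto simp: add_subgroup_zero add_subgroup_diff add_subgroup_add add_subgroup_minus add_subgroup_cmul)
     (auto simp: frags_def)

lemma frags_sum: "(\<And>i. i \<in> I \<Longrightarrow> f i \<in> frags K) \<Longrightarrow> sum f I \<in> frags K"
  by (induction I rule: infinite_finite_induct) (simp_all add: frags_add)

lemma frags_mono: "K \<subseteq> L \<Longrightarrow> c \<in> frags K \<Longrightarrow> c \<in> frags L"
  by (auto simp: frags_def)

definition add_hom :: "('m::ab_group_add \<Rightarrow> 'n::ab_group_add) \<Rightarrow> bool" where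
  "add_hom f \<longleftrightarrow> (\<forall>x y. f (x + y) = f x + f y)"

lemma add_hom_add: "add_hom f \<Longrightarrow> f (x + y) = f x + f y"
  by (simp add: add_hom_def)

lemma add_hom_zero: "add_hom f \<Longrightarrow> f 0 = 0"
  using add_hom_add[of f 0 0] by simp

lemma add_hom_diff: "add_hom f \<Longrightarrow> f (x - y) = f x - f y"
  using add_hom_add[of f "x - y" y] by simp

lemma add_hom_minus: "add_hom f \<Longrightarrow> f (- x) = - f x"
  using add_hom_diff[of f 0 x] by (simp add: add_hom_zero)

lemma add_hom_frag_extend: "add_hom (frag_extend f)"
  by (simp add: add_hom_def frag_extend_add)

lemma add_hom_comp: "add_hom f \<Longrightarrow> add_hom g \<Longrightarrow> add_hom (\<lambda>x. f (g x))"
  and add_hom_plus: "add_hom f' \<Longrightarrow> add_hom g' \<Longrightarrow> add_hom (\<lambda>x. f' x + g' x :: 'c::ab_group_add)"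
  and add_hom_sub: "add_hom f' \<Longrightarrow> add_hom g' \<Longrightarrow> add_hom (\<lambda>x. f' x - g' x)"
  and add_hom_id: "add_hom (\<lambda>x. x)"
  and add_hom_zero_map: "add_hom (\<lambda>x. 0)"
  by (simp_all add: add_hom_def)

text \<open>Verification on basis elements, in the form used throughout: since the property cuts out
  a subgroup, signs and multiplicities need no separate treatment.\<close>

lemma frag_induct_of:
  assumes "c \<in> frags K" "add_subgroup {x. P x}" "\<And>x. x \<in> K \<Longrightarrow> P (frag_of x)"
  shows "P c"
proof -
  from assms(1) have "Poly_Mapping.keys c \<subseteq> K" by (simp add: frags_def)
  then show ?thesis
    using assms(2,3) by (induction c rule: frag_induction) (auto simp: add_subgroup_def)
qed

lemma add_hom_eqI:
  assumes "add_hom f" "add_hom g" "c \<in> frags K" "\<And>x. x \<in> K \<Longrightarrow> f (frag_of x) = g (frag_of x)"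
  shows "f c = g c"
  by (rule frag_induct_of[OF assms(3)])
     (auto simp: add_subgroup_def add_hom_diff[OF assms(1)] add_hom_diff[OF assms(2)]
        add_hom_zero[OF assms(1)] add_hom_zero[OF assms(2)] assms(4))

lemma add_hom_in_subgroup:
  assumes "add_hom f" "add_subgroup N" "c \<in> frags K" "\<And>x. x \<in> K \<Longrightarrow> f (frag_of x) \<in> N"
  shows "f c \<in> N"
  by (rule frag_induct_of[OF assms(3)])
     (auto simp: add_subgroup_def add_hom_diff[OF assms(1)] add_hom_zero[OF assms(1)]
       add_subgroup_zero[OF assms(2)] add_subgroup_diff[OF assms(2)] assms(4))

lemma add_hom_frag_cmul:
  assumes "add_hom (f :: ('b \<Rightarrow>\<^sub>0 int) \<Rightarrow> ('c \<Rightarrow>\<^sub>0 int))"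
  shows "f (frag_cmul k x) = frag_cmul k (f x)"
proof -
  have "f (frag_cmul (int n) x) = frag_cmul (int n) (f x)" for n
    by (induction n) (simp_all add: add_hom_zero[OF assms] add_hom_add[OF assms] frag_cmul_distrib)
  then show ?thesis
    using add_hom_minus[OF assms, of "frag_cmul (int n) x" for n]
    by (cases k rule: int_cases2) auto
qed

lemma add_subgroup_image:
  assumes "add_hom f" "add_subgroup N"
  shows "add_subgroup (f ` N)"
proof -
  have "f x - f y \<in> f ` N" if "x \<in> N" "y \<in> N" for x y
    using add_hom_diff[OF assms(1), of x y] add_subgroup_diff[OF assms(2) that] by (metis imageI)
  moreover have "0 \<in> f ` N"
    using add_hom_zero[OF assms(1)] add_subgroup_zero[OF assms(2)] by (metis imageI)
  ultimately show ?thesis by (auto simp: add_subgroup_def)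
qed

lemma add_subgroup_vimage:
  assumes "add_hom f" "add_subgroup N"
  shows "add_subgroup {x. f x \<in> N}"
  using assms(2) by (auto simp: add_subgroup_def add_hom_diff[OF assms(1)] add_hom_zero[OF assms(1)])

lemma add_subgroup_kernel:
  assumes "add_hom f"
  shows "add_subgroup {x. f x = 0}"
  by (auto simp: add_subgroup_def add_hom_diff[OF assms(1)] add_hom_zero[OF assms(1)])

lemma add_subgroup_Int: "add_subgroup M \<Longrightarrow> add_subgroup N \<Longrightarrow> add_subgroup (M \<inter> N)"
  by (auto simp: add_subgroup_def)

section \<open>The double complex\<close>

text \<open>A pair \<open>(gs, t)\<close> is the bar symbol \<open>gs\<close> with coefficient
  \<open>t\<close>; the vertical degree is the length of \<open>gs\<close>, the horizontal one the
  length of \<open>t\<close>.\<close>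

type_synonym 'a chain = "(('a^2^2) list \<times> ('a^2) set list) \<Rightarrow>\<^sub>0 int"

text \<open>The rightmost letter acts on \<open>t\<close> first, so a symbol is a path in the action
  groupoid starting at \<open>t\<close>. Second homology needs at most three letters; every other
  list gets the value 0.\<close>

fun bar_bd :: "('a::comm_ring_1^2^2) list \<Rightarrow> ('a^2) set list \<Rightarrow> 'a chain" where
  "bar_bd [a] t = frag_of ([], t) - frag_of ([], tuple_act a t)"
| "bar_bd [a, b] t = frag_of ([b], t) - frag_of ([a ** b], t) + frag_of ([a], tuple_act b t)"
| "bar_bd [a, b, c] t = frag_of ([b, c], t) - frag_of ([a ** b, c], t) + frag_of ([a, b ** c], t)
     - frag_of ([a, b], tuple_act c t)"
| "bar_bd _ t = 0"

definition dv :: "'a::comm_ring_1 chain \<Rightarrow> 'a chain" where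
  "dv = frag_extend (\<lambda>(gs, t). bar_bd gs t)"

text \<open>The empty tuple makes the augmentation part of the complex.\<close>

fun face_bd :: "'l \<Rightarrow> 'p list \<Rightarrow> ('l \<times> 'p list) \<Rightarrow>\<^sub>0 int" where
  "face_bd l [p] = frag_of (l, [])"
| "face_bd l [p, q] = frag_of (l, [q]) - frag_of (l, [p])"
| "face_bd l [p, q, r] = frag_of (l, [q, r]) - frag_of (l, [p, r]) + frag_of (l, [p, q])"
| "face_bd l _ = 0"

definition dh :: "(('l \<times> 'p list) \<Rightarrow>\<^sub>0 int) \<Rightarrow> (('l \<times> 'p list) \<Rightarrow>\<^sub>0 int)" where
  "dh = frag_extend (\<lambda>(l, t). face_bd l t)"

lemma add_hom_dv: "add_hom dv" and add_hom_dh: "add_hom dh"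
  by (simp_all add: dv_def dh_def add_hom_frag_extend)

lemmas dv_simps [simp] = add_hom_zero[OF add_hom_dv] add_hom_diff[OF add_hom_dv]
  add_hom_add[OF add_hom_dv] add_hom_minus[OF add_hom_dv] add_hom_frag_cmul[OF add_hom_dv]

lemmas dh_simps [simp] = add_hom_zero[OF add_hom_dh] add_hom_diff[OF add_hom_dh]
  add_hom_add[OF add_hom_dh] add_hom_minus[OF add_hom_dh] add_hom_frag_cmul[OF add_hom_dh]

lemma dv_of [simp]: "dv (frag_of (gs, t)) = bar_bd gs t"
  by (simp add: dv_def)

lemma dh_of [simp]: "dh (frag_of (l, t)) = face_bd l t"
  by (simp add: dh_def)

lemma frags_UNIV [simp]: "c \<in> frags UNIV" by (simp add: frags_def)

lemma dv_dv [simp]: "dv (dv c) = 0"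
proof (rule add_hom_eqI[OF add_hom_comp[OF add_hom_dv add_hom_dv] add_hom_zero_map, of _ UNIV])
  fix x :: "('a^2^2) list \<times> ('a^2) set list"
  obtain gs t where "x = (gs, t)" by fastforce
  then show "dv (dv (frag_of x)) = 0"
    by (cases "(gs, t)" rule: bar_bd.cases)
       (simp_all add: matrix_mul_assoc tuple_act_mult)
qed simp

lemma dh_dh [simp]: "dh (dh c) = 0"
proof (rule add_hom_eqI[OF add_hom_comp[OF add_hom_dh add_hom_dh] add_hom_zero_map, of _ UNIV])
  fix x :: "'a \<times> 'b list"
  obtain l t where "x = (l, t)" by fastforce
  then show "dh (dh (frag_of x)) = 0"
    by (cases "(l, t)" rule: face_bd.cases) simp_all
qed simp

text \<open>The differentials commute rather than anticommute, so zigzags consist of plain equations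
  without signs.\<close>

lemma dv_dh: "dv (dh c) = dh (dv c)"
proof (rule add_hom_eqI[OF add_hom_comp[OF add_hom_dv add_hom_dh] add_hom_comp[OF add_hom_dh add_hom_dv], of _ UNIV])
  fix x :: "('a^2^2) list \<times> ('a^2) set list"
  obtain gs t where "x = (gs, t)" by fastforce
  then show "dv (dh (frag_of x)) = dh (dv (frag_of x))"
    by (cases "(gs, t)" rule: bar_bd.cases; cases "(gs, t)" rule: face_bd.cases)
       (auto simp: tuple_act_def)
qed simp

section \<open>Chains of a group acting on tuples of lines\<close>

definition chains ::
    "('a::comm_ring_1^2^2) set \<Rightarrow> ('a^2) set list set \<Rightarrow> nat \<Rightarrow> 'a chain set" where
  "chains \<Gamma> S n = frags ({gs. length gs = n \<and> set gs \<subseteq> \<Gamma>} \<times> S)"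

lemma add_subgroup_chains: "add_subgroup (chains \<Gamma> S n)"
  by (simp add: chains_def add_subgroup_frags)

lemma chains_of [simp]:
  "frag_of (gs, t) \<in> chains \<Gamma> S n \<longleftrightarrow> length gs = n \<and> set gs \<subseteq> \<Gamma> \<and> t \<in> S"
  by (auto simp: chains_def)

lemma chains_zero [simp]: "0 \<in> chains \<Gamma> S n"
  and chains_diff: "x \<in> chains \<Gamma> S n \<Longrightarrow> y \<in> chains \<Gamma> S n \<Longrightarrow> x - y \<in> chains \<Gamma> S n"
  and chains_add: "x \<in> chains \<Gamma> S n \<Longrightarrow> y \<in> chains \<Gamma> S n \<Longrightarrow> x + y \<in> chains \<Gamma> S n"
  and chains_minus: "x \<in> chains \<Gamma> S n \<Longrightarrow> - x \<in> chains \<Gamma> S n"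
  and chains_cmul: "x \<in> chains \<Gamma> S n \<Longrightarrow> frag_cmul k x \<in> chains \<Gamma> S n"
  by (simp_all add: chains_def frags_diff frags_add frags_minus frags_cmul)

lemmas chains_intros = chains_diff chains_add chains_minus chains_cmul

lemma chains_mono: "\<Gamma> \<subseteq> \<Gamma>' \<Longrightarrow> S \<subseteq> S' \<Longrightarrow> x \<in> chains \<Gamma> S n \<Longrightarrow> x \<in> chains \<Gamma>' S' n"
  unfolding chains_def by (erule frags_mono[rotated]) auto

lemma chains_induct:
  assumes "c \<in> chains \<Gamma> S n" "add_subgroup {x. P x}"
    "\<And>gs t. length gs = n \<Longrightarrow> set gs \<subseteq> \<Gamma> \<Longrightarrow> t \<in> S \<Longrightarrow> P (frag_of (gs, t))"
  shows "P c"
  by (rule frag_induct_of[OF assms(1)[unfolded chains_def] assms(2)]) (use assms(3) in auto)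

lemma chains_eqI:
  assumes "c \<in> chains \<Gamma> S n" "add_hom f" "add_hom g"
    "\<And>gs t. length gs = n \<Longrightarrow> set gs \<subseteq> \<Gamma> \<Longrightarrow> t \<in> S \<Longrightarrow> f (frag_of (gs, t)) = g (frag_of (gs, t))"
  shows "f c = g c"
  by (rule add_hom_eqI[OF assms(2,3) assms(1)[unfolded chains_def]]) (use assms(4) in auto)

lemma chains_in_subgroup:
  assumes "c \<in> chains \<Gamma> S n" "add_hom f" "add_subgroup N"
    "\<And>gs t. length gs = n \<Longrightarrow> set gs \<subseteq> \<Gamma> \<Longrightarrow> t \<in> S \<Longrightarrow> f (frag_of (gs, t)) \<in> N"
  shows "f c \<in> N"
  by (rule add_hom_in_subgroup[OF assms(2,3) assms(1)[unfolded chains_def]]) (use assms(4) in auto)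

lemma length_eq_1_2_3:
  "length xs = Suc 0 \<longleftrightarrow> (\<exists>a. xs = [a])"
  "length xs = 2 \<longleftrightarrow> (\<exists>a b. xs = [a, b])"
  "length xs = 3 \<longleftrightarrow> (\<exists>a b c. xs = [a, b, c])"
  by (auto simp: length_Suc_conv eval_nat_numeral)

text \<open>The inverse on determinant one, given by its entries so that identities can be checked
  entrywise.\<close>

definition adj2 :: "'a::comm_ring_1^2^2 \<Rightarrow> 'a^2^2" where
  "adj2 M = vector [vector [M$2$2, - M$1$2], vector [- M$2$1, M$1$1]]"

lemma adj2_mult:
  assumes "det M = 1"
  shows "adj2 M ** M = mat 1" "M ** adj2 M = mat 1"
  using assms
  by (simp_all add: adj2_def det_2 vec_eq_iff forall_2 matrix_matrix_mult_def sum_2 mat_def algebra_simps)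

lemma det_adj2: "det (adj2 M) = det M"
  by (simp add: adj2_def det_2 algebra_simps)

definition SL2_subgroup :: "('a::comm_ring_1^2^2) set \<Rightarrow> bool" where
  "SL2_subgroup \<Gamma> \<longleftrightarrow> mat 1 \<in> \<Gamma> \<and> (\<forall>M\<in>\<Gamma>. det M = 1 \<and> adj2 M \<in> \<Gamma>) \<and> (\<forall>M\<in>\<Gamma>. \<forall>N\<in>\<Gamma>. M ** N \<in> \<Gamma>)"

lemma SL2_subgroup_one: "SL2_subgroup \<Gamma> \<Longrightarrow> mat 1 \<in> \<Gamma>"
  and SL2_subgroup_det: "SL2_subgroup \<Gamma> \<Longrightarrow> M \<in> \<Gamma> \<Longrightarrow> det M = 1"
  and SL2_subgroup_adj2: "SL2_subgroup \<Gamma> \<Longrightarrow> M \<in> \<Gamma> \<Longrightarrow> adj2 M \<in> \<Gamma>"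
  and SL2_subgroup_mult: "SL2_subgroup \<Gamma> \<Longrightarrow> M \<in> \<Gamma> \<Longrightarrow> N \<in> \<Gamma> \<Longrightarrow> M ** N \<in> \<Gamma>"
  by (auto simp: SL2_subgroup_def)

definition stable_under :: "('a::comm_ring_1^2^2) set \<Rightarrow> ('a^2) set list set \<Rightarrow> bool" where
  "stable_under \<Gamma> S \<longleftrightarrow> (\<forall>M\<in>\<Gamma>. \<forall>t\<in>S. tuple_act M t \<in> S)"

lemma dv_chains:
  assumes "SL2_subgroup \<Gamma>" "stable_under \<Gamma> S" "c \<in> chains \<Gamma> S (Suc n)"
  shows "dv c \<in> chains \<Gamma> S n"
proof (rule chains_in_subgroup[OF assms(3) add_hom_dv add_subgroup_chains])
  fix gs t assume "length gs = Suc n" "set gs \<subseteq> \<Gamma>" "t \<in> S"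
  then show "dv (frag_of (gs, t)) \<in> chains \<Gamma> S n"
    using assms(1,2)
    by (cases "(gs, t)" rule: bar_bd.cases)
       (auto simp: stable_under_def intro!: chains_intros SL2_subgroup_mult)
qed

lemma dv_boundary_subgroup: "add_subgroup (dv ` chains \<Gamma> S n)"
  by (intro add_subgroup_image add_hom_dv add_subgroup_chains)

text \<open>
  A choice of an orbit representative \<open>\<rho> t\<close> of every tuple \<open>t\<close> together with a group element
  \<open>\<sigma> t\<close> moving \<open>\<rho> t\<close> to \<open>t\<close> deforms the action groupoid onto the stabilisers of the
  representatives (Shapiro's lemma); \<open>k\<close> is the prism operator of this deformation.
\<close>

locale orbit_section =
  fixes \<Gamma> :: "('a::comm_ring_1^2^2) set" and S :: "('a^2) set list set"
    and \<rho> :: "('a^2) set list \<Rightarrow> ('a^2) set list" and \<sigma> :: "('a^2) set list \<Rightarrow> 'a^2^2"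
  assumes subgroup: "SL2_subgroup \<Gamma>" and stable: "stable_under \<Gamma> S"
    and rho_in: "t \<in> S \<Longrightarrow> \<rho> t \<in> S" and sigma_in: "t \<in> S \<Longrightarrow> \<sigma> t \<in> \<Gamma>"
    and sigma_act: "t \<in> S \<Longrightarrow> tuple_act (\<sigma> t) (\<rho> t) = t"
    and rho_act: "t \<in> S \<Longrightarrow> M \<in> \<Gamma> \<Longrightarrow> \<rho> (tuple_act M t) = \<rho> t"
begin

text \<open>The arrow from \<open>t\<close> to its translate by \<open>a\<close>, pulled back along
  the chosen paths to a loop at \<open>\<rho> t\<close>. Functoriality is
  \<open>h_mult\<close>.\<close>

definition h :: "'a^2^2 \<Rightarrow> ('a^2) set list \<Rightarrow> 'a^2^2" where
  "h a t = adj2 (\<sigma> (tuple_act a t)) ** a ** \<sigma> t"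

text \<open>The letter \<open>a\<close> acts after those to its right, so its source is
  \<open>t\<close> moved by them.\<close>

fun r_list :: "('a^2^2) list \<Rightarrow> ('a^2) set list \<Rightarrow> ('a^2^2) list" where
  "r_list [] t = []"
| "r_list (a # gs) t = h a (foldr tuple_act gs t) # r_list gs t"

definition r :: "'a chain \<Rightarrow> 'a chain" where
  "r = frag_extend (\<lambda>(gs, t). frag_of (r_list gs t, \<rho> t))"

text \<open>Each summand inserts \<open>\<sigma>\<close> at one position of the word: letters to the
  right of it are already retracted, letters to the left are still the original ones.\<close>

fun k_list :: "('a^2^2) list \<Rightarrow> ('a^2) set list \<Rightarrow> 'a chain" where
  "k_list [] t = frag_of ([\<sigma> t], \<rho> t)"
| "k_list [a] t = frag_of ([\<sigma> (tuple_act a t), h a t], \<rho> t) - frag_of ([a, \<sigma> t], \<rho> t)"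
| "k_list [a, b] t =
     frag_of ([\<sigma> (tuple_act a (tuple_act b t)), h a (tuple_act b t), h b t], \<rho> t)
     - frag_of ([a, \<sigma> (tuple_act b t), h b t], \<rho> t) + frag_of ([a, b, \<sigma> t], \<rho> t)"
| "k_list _ t = 0"

definition k :: "'a chain \<Rightarrow> 'a chain" where
  "k = frag_extend (\<lambda>(gs, t). k_list gs t)"

lemma add_hom_r: "add_hom r" and add_hom_k: "add_hom k"
  by (simp_all add: r_def k_def add_hom_frag_extend)

lemmas rk_simps = add_hom_zero[OF add_hom_r] add_hom_diff[OF add_hom_r]
  add_hom_add[OF add_hom_r] add_hom_minus[OF add_hom_r]
  add_hom_zero[OF add_hom_k] add_hom_diff[OF add_hom_k]
  add_hom_add[OF add_hom_k] add_hom_minus[OF add_hom_k]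

lemma r_of: "r (frag_of (gs, t)) = frag_of (r_list gs t, \<rho> t)"
  and k_of: "k (frag_of (gs, t)) = k_list gs t"
  by (simp_all add: r_def k_def)

lemma act_in: "t \<in> S \<Longrightarrow> M \<in> \<Gamma> \<Longrightarrow> tuple_act M t \<in> S"
  using stable by (auto simp: stable_under_def)

lemma sigma_h: "t \<in> S \<Longrightarrow> a \<in> \<Gamma> \<Longrightarrow> \<sigma> (tuple_act a t) ** h a t = a ** \<sigma> t"
  using adj2_mult(2)[OF SL2_subgroup_det[OF subgroup sigma_in[OF act_in]], of t a]
  by (simp add: h_def matrix_mul_assoc)

lemma h_in: "t \<in> S \<Longrightarrow> a \<in> \<Gamma> \<Longrightarrow> h a t \<in> \<Gamma>"
  unfolding h_def
  by (intro SL2_subgroup_mult[OF subgroup] SL2_subgroup_adj2[OF subgroup] sigma_in act_in)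

lemma adj2_cancel: "M \<in> \<Gamma> \<Longrightarrow> M ** N = M ** L \<Longrightarrow> N = L"
  by (metis SL2_subgroup_det[OF subgroup] adj2_mult(1) matrix_mul_assoc matrix_mul_lid)

lemma h_mult: "t \<in> S \<Longrightarrow> a \<in> \<Gamma> \<Longrightarrow> b \<in> \<Gamma> \<Longrightarrow> h (a ** b) t = h a (tuple_act b t) ** h b t"
  by (rule adj2_cancel[OF sigma_in[of "tuple_act (a ** b) t"]])
     (use sigma_h[of t b] sigma_h[of "tuple_act b t" a] sigma_h[of t "a ** b"] in
       \<open>simp_all add: act_in SL2_subgroup_mult[OF subgroup] tuple_act_mult matrix_mul_assoc,
        metis matrix_mul_assoc\<close>)

lemma h_stab: "t \<in> S \<Longrightarrow> a \<in> \<Gamma> \<Longrightarrow> tuple_act (h a t) (\<rho> t) = \<rho> t"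
proof -
  assume t: "t \<in> S" and a: "a \<in> \<Gamma>"
  let ?s = "\<sigma> (tuple_act a t)"
  have "tuple_act (a ** \<sigma> t) (\<rho> t) = tuple_act ?s (\<rho> t)"
    using sigma_act[OF t] sigma_act[OF act_in[OF t a]] rho_act[OF t a] by (simp add: tuple_act_mult)
  then have "tuple_act (adj2 ?s) (tuple_act (?s ** h a t) (\<rho> t)) = tuple_act (adj2 ?s ** ?s) (\<rho> t)"
    by (simp add: sigma_h[OF t a] tuple_act_mult)
  moreover have "adj2 ?s ** ?s = mat 1"
    by (rule adj2_mult[OF SL2_subgroup_det[OF subgroup sigma_in[OF act_in[OF t a]]]])
  ultimately show ?thesis
    by (metis matrix_mul_assoc matrix_mul_lid tuple_act_id tuple_act_mult)
qed

lemmas sec_simps = act_in h_in h_mult h_stab rho_act sigma_act sigma_h tuple_act_mult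
  r_of k_of rk_simps rho_in sigma_in

lemma dv_r:
  assumes "c \<in> chains \<Gamma> S n"
  shows "dv (r c) = r (dv c)"
proof (rule chains_eqI[OF assms add_hom_comp[OF add_hom_dv add_hom_r] add_hom_comp[OF add_hom_r add_hom_dv]])
  fix gs t assume *: "length gs = n" "set gs \<subseteq> \<Gamma>" "t \<in> S"
  then show "dv (r (frag_of (gs, t))) = r (dv (frag_of (gs, t)))"
    by (cases "(gs, t)" rule: bar_bd.cases) (auto simp: sec_simps)
qed

lemma homotopy:
  assumes "c \<in> chains \<Gamma> S n" "n = 1 \<or> n = 2"
  shows "r c - c = dv (k c) + k (dv c)"
proof (rule chains_eqI[OF assms(1) add_hom_sub[OF add_hom_r add_hom_id]
        add_hom_plus[OF add_hom_comp[OF add_hom_dv add_hom_k] add_hom_comp[OF add_hom_k add_hom_dv]]])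
  fix gs t assume *: "length gs = n" "set gs \<subseteq> \<Gamma>" "t \<in> S"
  with assms(2) consider a where "gs = [a]" | a b where "gs = [a, b]"
    by (auto simp: length_eq_1_2_3)
  then show "r (frag_of (gs, t)) - frag_of (gs, t) = dv (k (frag_of (gs, t))) + k (dv (frag_of (gs, t)))"
    by cases (use * in \<open>simp_all add: sec_simps\<close>)
qed

lemma r_in:
  assumes "c \<in> chains \<Gamma> S n"
  shows "r c \<in> frags {(gs, \<rho> t) | gs t. length gs = n \<and> set gs \<subseteq> {M \<in> \<Gamma>. tuple_act M (\<rho> t) = \<rho> t} \<and> t \<in> S}"
proof (rule chains_in_subgroup[OF assms add_hom_r add_subgroup_frags])
  fix gs t assume *: "length gs = n" "set gs \<subseteq> \<Gamma>" "t \<in> S"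
  have fold: "set gs \<subseteq> \<Gamma> \<Longrightarrow> foldr tuple_act gs t \<in> S \<and> \<rho> (foldr tuple_act gs t) = \<rho> t" for gs
    by (induction gs) (use *(3) in \<open>auto simp: act_in rho_act\<close>)
  have "set gs \<subseteq> \<Gamma> \<Longrightarrow> length (r_list gs t) = length gs \<and>
      set (r_list gs t) \<subseteq> {M \<in> \<Gamma>. tuple_act M (\<rho> t) = \<rho> t}"
  proof (induction gs)
    case (Cons a gs)
    then show ?case using fold[of gs] h_in[of "foldr tuple_act gs t" a] h_stab[of "foldr tuple_act gs t" a]
      by auto
  qed simp
  then show "r (frag_of (gs, t)) \<in>
      frags {(gs, \<rho> t) | gs t. length gs = n \<and> set gs \<subseteq> {M \<in> \<Gamma>. tuple_act M (\<rho> t) = \<rho> t} \<and> t \<in> S}"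
    using * by (auto simp: r_of)
qed

lemma k_in:
  assumes "c \<in> chains \<Gamma> S n"
  shows "k c \<in> chains \<Gamma> S (Suc n)"
proof (rule chains_in_subgroup[OF assms add_hom_k add_subgroup_chains])
  fix gs t assume *: "length gs = n" "set gs \<subseteq> \<Gamma>" "t \<in> S"
  then show "k (frag_of (gs, t)) \<in> chains \<Gamma> S (Suc n)"
    by (cases "(gs, t)" rule: k_list.cases) (auto simp: sec_simps intro!: chains_intros)
qed

lemma homotopy_0:
  assumes "c \<in> chains \<Gamma> S 0"
  shows "r c - c = dv (k c)"
  by (rule chains_eqI[OF assms add_hom_sub[OF add_hom_r add_hom_id] add_hom_comp[OF add_hom_dv add_hom_k]])
     (simp add: sec_simps)

lemma cycle_homologous:
  assumes "c \<in> chains \<Gamma> S n" "n = 1 \<or> n = 2" "dv c = 0"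
  shows "r c - c \<in> dv ` chains \<Gamma> S (Suc n)"
  using homotopy[OF assms(1,2)] assms(3) k_in[OF assms(1)] by (auto simp: rk_simps)

end

section \<open>Symmetric cocycles of abelian groups\<close>

text \<open>Positive and negative parts as words, so that an equality of chains becomes an equality
  of multisets of letters.\<close>

lemma frag_as_lists:
  assumes "c \<in> frags K"
  obtains I J where "set I \<subseteq> K" "set J \<subseteq> K"
    "c = sum_list (map frag_of I) - sum_list (map frag_of J)"
proof -
  let ?P = "\<lambda>c. \<exists>I J. set I \<subseteq> K \<and> set J \<subseteq> K \<and> c = sum_list (map frag_of I) - sum_list (map frag_of J)"
  have "?P c"
  proof (rule frag_induct_of[OF assms])
    show "add_subgroup {x. ?P x}"
      unfolding add_subgroup_def
    proof (intro conjI ballI)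
      show "0 \<in> {x. ?P x}" by (intro CollectI exI[of _ "[]"] conjI) auto
      fix x y assume "x \<in> {x. ?P x}" "y \<in> {x. ?P x}"
      then obtain I J I' J' where *: "set I \<subseteq> K" "set J \<subseteq> K" "set I' \<subseteq> K" "set J' \<subseteq> K"
        and xy: "x = sum_list (map frag_of I) - sum_list (map frag_of J)"
          "y = sum_list (map frag_of I') - sum_list (map frag_of J')" by auto
      show "x - y \<in> {x. ?P x}"
        by (rule CollectI, rule exI[of _ "I @ J'"], rule exI[of _ "J @ I'"])
           (use * in \<open>auto simp: xy algebra_simps\<close>)
    qed
  next
    fix x assume "x \<in> K"
    then show "?P (frag_of x)" by (intro exI[of _ "[x]"] exI[of _ "[]"] conjI) auto
  qed
  then show ?thesis using that by blast
qed

lemma lookup_sum_list_frag_of: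
  "poly_mapping.lookup (sum_list (map frag_of xs)) x = int (count (mset xs) x)"
  by (induction xs) (simp_all add: lookup_add)

lemma sum_list_frag_of_eq:
  "sum_list (map frag_of xs) = sum_list (map frag_of ys) \<Longrightarrow> mset xs = mset ys"
  by (metis lookup_sum_list_frag_of multiset_eqI of_nat_eq_iff)

text \<open>The cocycle defines an abelian extension of \<open>U\<close> by the group modulo
  \<open>N\<close>, and such an extension is trivial on second homology: products of lifts do not
  depend on the order, while a cycle multiplies the same letters in two ways. Counting with words
  makes this explicit without splitting the extension.\<close>

locale symmetric_cocycle =
  fixes U :: "'a::comm_monoid_mult set" and N :: "'m::ab_group_add set" and g :: "'a \<Rightarrow> 'a \<Rightarrow> 'm"
  assumes one: "1 \<in> U" and mult: "a \<in> U \<Longrightarrow> b \<in> U \<Longrightarrow> a * b \<in> U"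
    and N: "add_subgroup N"
    and cocycle: "a \<in> U \<Longrightarrow> b \<in> U \<Longrightarrow> c \<in> U \<Longrightarrow> g b c - g (a * b) c + g a (b * c) - g a b \<in> N"
    and symmetric: "a \<in> U \<Longrightarrow> b \<in> U \<Longrightarrow> g a b - g b a \<in> N"
begin

text \<open>
  Multiplying out the word \<open>xs\<close> in the abelian extension defined by \<open>g\<close>, with every letter lifted
  by the standard section, yields \<open>word xs\<close> as the coordinate in the kernel.
\<close>

fun word :: "'a list \<Rightarrow> 'm" where
  "word [] = 0"
| "word (x # xs) = word xs + g x (prod_list xs)"

lemma prod_list_in: "set xs \<subseteq> U \<Longrightarrow> prod_list xs \<in> U"
  by (induction xs) (simp_all add: one mult)

text \<open>Exchanging the neighbours \<open>u\<close> and \<open>x\<close> in front of a word with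
  product \<open>w\<close> compares the cocycle relations of \<open>(u, x, w)\<close> and
  \<open>(x, u, w)\<close>; symmetry of \<open>g\<close> accounts for what remains.\<close>

lemma word_swap:
  assumes "x \<in> U" "set us \<subseteq> U" "set vs \<subseteq> U"
  shows "word (us @ x # vs) - word (x # us @ vs) \<in> N"
  using assms(2)
proof (induction us)
  case (Cons u us)
  let ?w = "prod_list (us @ vs)"
  have w: "?w \<in> U" using Cons.prems assms by (intro prod_list_in) auto
  have u: "u \<in> U" using Cons.prems by simp
  have "word ((u # us) @ x # vs) - word (x # (u # us) @ vs) =
      (word (us @ x # vs) - word (x # us @ vs))
      + (g x ?w - g (u * x) ?w + g u (x * ?w) - g u x) - (g u ?w - g (x * u) ?w + g x (u * ?w) - g x u)
      + (g u x - g x u)"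
    by (simp add: ac_simps)
  then show ?case
    using Cons.IH Cons.prems
      add_subgroup_add[OF N add_subgroup_diff[OF N add_subgroup_add[OF N
        Cons.IH cocycle[OF u assms(1) w]] cocycle[OF assms(1) u w]] symmetric[OF u assms(1)]]
    by (simp only: list.set insert_subset)
qed (simp add: add_subgroup_zero[OF N])

lemma word_perm:
  assumes "mset xs = mset ys" "set xs \<subseteq> U"
  shows "word xs - word ys \<in> N"
  using assms
proof (induction xs arbitrary: ys)
  case (Cons x xs)
  then have "x \<in> set ys" by (metis list.set_intros(1) set_mset_mset)
  then obtain us vs where ys: "ys = us @ x # vs" by (meson split_list)
  have m: "mset xs = mset (us @ vs)" using Cons.prems(1) by (simp add: ys)
  have p: "prod_list xs = prod_list (us @ vs)" using m by (metis prod_mset_prod_list)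
  have U: "set us \<subseteq> U" "set vs \<subseteq> U" "x \<in> U" "set xs \<subseteq> U"
    using Cons.prems(2) mset_eq_setD[OF Cons.prems(1)] by (auto simp: ys)
  have "word (x # xs) - word ys =
      (word xs - word (us @ vs)) - (word (us @ x # vs) - word (x # us @ vs))"
    using p by (simp add: ys)
  then show ?case
    using Cons.IH[OF m U(4)] word_swap[OF U(3,1,2)] by (simp only: add_subgroup_diff[OF N])
qed (simp add: add_subgroup_zero[OF N])

text \<open>Fusing the letters \<open>a\<close>, \<open>b\<close> into the single letter
  \<open>a * b\<close> costs exactly \<open>g a b\<close>, by the cocycle relation with the rest of
  the word.\<close>

lemma word_pairs:
  assumes "set I \<subseteq> U \<times> U" "set zs \<subseteq> U"
  shows "word (concat (map (\<lambda>(a, b). [a, b]) I) @ zs)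
    - (sum_list (map (\<lambda>(a, b). g a b) I) + word (map (\<lambda>(a, b). a * b) I @ zs)) \<in> N"
  using assms(1)
proof (induction I)
  case (Cons i I)
  obtain a b where i: "i = (a, b)" by fastforce
  have ab: "a \<in> U" "b \<in> U" using Cons.prems by (auto simp: i)
  let ?ws = "concat (map (\<lambda>(a, b). [a, b]) I) @ zs"
  let ?vs = "map (\<lambda>(a, b). a * b) I @ zs"
  have p: "prod_list ?ws = prod_list ?vs"
    by (induction I) (auto simp: mult.assoc)
  have w: "prod_list ?ws \<in> U" by (rule prod_list_in) (use Cons.prems assms(2) in auto)
  have "word (concat (map (\<lambda>(a, b). [a, b]) (i # I)) @ zs)
    - (sum_list (map (\<lambda>(a, b). g a b) (i # I)) + word (map (\<lambda>(a, b). a * b) (i # I) @ zs)) =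
     (word ?ws - (sum_list (map (\<lambda>(a, b). g a b) I) + word ?vs))
     + (g b (prod_list ?ws) - g (a * b) (prod_list ?ws) + g a (b * prod_list ?ws) - g a b)"
    using p by (simp add: i)
  then show ?case
    using Cons.prems add_subgroup_add[OF N Cons.IH cocycle[OF ab w]]
    by (simp only: list.set insert_subset)
qed (simp add: add_subgroup_zero[OF N])

text \<open>The cycle condition says that the letters of \<open>I\<close> with the products of
  \<open>J\<close> are a rearrangement of the letters of \<open>J\<close> with the products of
  \<open>I\<close>. Rearranging is free, fusing costs the two sums of \<open>g\<close>, so these
  sums agree modulo \<open>N\<close>.\<close>

lemma vanishes_on_cycles:
  assumes c: "c \<in> frags (U \<times> U)"
    and cycle: "frag_extend (\<lambda>(a, b). frag_of b - frag_of (a * b) + frag_of a) c = 0"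
    and f: "add_hom f" "\<And>a b. a \<in> U \<Longrightarrow> b \<in> U \<Longrightarrow> f (frag_of (a, b)) = g a b"
  shows "f c \<in> N"
proof -
  obtain I J where IJ: "set I \<subseteq> U \<times> U" "set J \<subseteq> U \<times> U"
    and c_eq: "c = sum_list (map frag_of I) - sum_list (map frag_of J)"
    using frag_as_lists[OF c] .
  let ?p = "\<lambda>I. concat (map (\<lambda>(a, b). [a, b]) I)" and ?q = "\<lambda>I. map (\<lambda>(a, b). a * b) I"
  have bd: "frag_extend (\<lambda>(a, b). frag_of b - frag_of (a * b) + frag_of a) (sum_list (map frag_of I)) =
      sum_list (map frag_of (?p I)) - sum_list (map frag_of (?q I))" for I :: "('a \<times> 'a) list"
    by (induction I) (auto simp: frag_extend_add)
  have "sum_list (map frag_of (?p I @ ?q J)) = sum_list (map frag_of (?p J @ ?q I))"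
    using cycle unfolding c_eq frag_extend_diff bd by (simp add: algebra_simps)
  then have "mset (?p I @ ?q J) = mset (?p J @ ?q I)" by (rule sum_list_frag_of_eq)
  then have 1: "word (?p I @ ?q J) - word (?p J @ ?q I) \<in> N"
    by (rule word_perm) (use IJ mult in auto)
  have 2: "word (?p I @ ?q J) - (sum_list (map (\<lambda>(a, b). g a b) I) + word (?q I @ ?q J)) \<in> N"
    by (rule word_pairs) (use IJ mult in auto)
  have 3: "word (?p J @ ?q I) - (sum_list (map (\<lambda>(a, b). g a b) J) + word (?q J @ ?q I)) \<in> N"
    by (rule word_pairs) (use IJ mult in auto)
  have 4: "word (?q I @ ?q J) - word (?q J @ ?q I) \<in> N"
    by (rule word_perm) (use IJ mult in auto)
  have "f (sum_list (map frag_of I)) = sum_list (map (\<lambda>(a, b). g a b) I)"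
    if "set I \<subseteq> U \<times> U" for I
    using that f(2) by (induction I) (auto simp: add_hom_zero[OF f(1)] add_hom_add[OF f(1)])
  then have "f c = (word (?p I @ ?q J) - word (?p J @ ?q I))
      - (word (?p I @ ?q J) - (sum_list (map (\<lambda>(a, b). g a b) I) + word (?q I @ ?q J)))
      + (word (?p J @ ?q I) - (sum_list (map (\<lambda>(a, b). g a b) J) + word (?q J @ ?q I)))
      - (word (?q I @ ?q J) - word (?q J @ ?q I))"
    using IJ by (simp add: c_eq add_hom_diff[OF f(1)])
  then show ?thesis
    using add_subgroup_diff[OF N add_subgroup_add[OF N add_subgroup_diff[OF N 1 2] 3] 4] by (simp only:)
qed

end

section \<open>Exactness of the complex of tuples in general position\<close>

text \<open>For lines, \<open>tv_cotrans\<close> expresses that not being transversal is transitive.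
  In \<open>common\<close> three points are required because an edge is filled from a base point,
  and the new point must avoid the base point and both ends.\<close>

locale general_position =
  fixes P :: "'p set" and tv :: "'p \<Rightarrow> 'p \<Rightarrow> bool"
  assumes tv_sym: "p \<in> P \<Longrightarrow> q \<in> P \<Longrightarrow> tv p q \<Longrightarrow> tv q p"
    and common: "p \<in> P \<Longrightarrow> q \<in> P \<Longrightarrow> r \<in> P \<Longrightarrow> \<exists>s\<in>P. tv s p \<and> tv s q \<and> tv s r"
    and nonempty: "P \<noteq> {}"
    and tv_cotrans: "p \<in> P \<Longrightarrow> q \<in> P \<Longrightarrow> r \<in> P \<Longrightarrow> tv p r \<Longrightarrow> tv p q \<or> tv q r"
begin

definition tuples :: "nat \<Rightarrow> 'p list set" where
  "tuples m = {t. length t = m \<and> set t \<subseteq> P \<and> sorted_wrt tv t}"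

lemma tuples_0 [simp]: "t \<in> tuples 0 \<longleftrightarrow> t = []"
  and tuples_1: "t \<in> tuples (Suc 0) \<longleftrightarrow> (\<exists>p\<in>P. t = [p])"
  and tuples_2: "t \<in> tuples 2 \<longleftrightarrow> (\<exists>p\<in>P. \<exists>q\<in>P. tv p q \<and> t = [p, q])"
  and tuples_3: "t \<in> tuples 3 \<longleftrightarrow> (\<exists>p\<in>P. \<exists>q\<in>P. \<exists>r\<in>P. tv p q \<and> tv p r \<and> tv q r \<and> t = [p, q, r])"
  by (auto simp: tuples_def length_Suc_conv eval_nat_numeral)

lemma dh_exact_0:
  assumes "c \<in> frags (L \<times> tuples 0)"
  obtains b where "b \<in> frags (L \<times> tuples 1)" "dh b = c"
proof -
  obtain p where p: "p \<in> P" using nonempty by blast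
  have "c \<in> dh ` frags (L \<times> tuples 1)"
  proof (rule frag_induct_of[OF assms(1)])
    show "add_subgroup {x. x \<in> dh ` frags (L \<times> tuples 1)}"
      using add_subgroup_image[OF add_hom_dh add_subgroup_frags] by simp
    fix x assume "x \<in> L \<times> tuples 0"
    then obtain l where l: "l \<in> L" "x = (l, [])" by auto
    then show "frag_of x \<in> dh ` frags (L \<times> tuples 1)"
      using p by (intro image_eqI[of _ _ "frag_of (l, [p])"]) (auto simp: tuples_1)
  qed
  then show ?thesis using that by blast
qed

text \<open>A contraction up to boundaries suffices: on a cycle the term
  \<open>frag_extend hh (dh c)\<close> vanishes.\<close>

lemma dh_exact_aux:
  assumes c: "c \<in> frags (L \<times> tuples m)" and "dh c = 0"
    and hh: "\<And>l t. l \<in> L \<Longrightarrow> t \<in> tuples m \<Longrightarrow>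
      frag_of (l, t) - frag_extend hh (face_bd l t) \<in> dh ` frags (L \<times> tuples (Suc m))"
  obtains b where "b \<in> frags (L \<times> tuples (Suc m))" "dh b = c"
proof -
  have "c - frag_extend hh (dh c) \<in> dh ` frags (L \<times> tuples (Suc m))"
    by (rule add_hom_in_subgroup[OF add_hom_sub[OF add_hom_id add_hom_comp[OF add_hom_frag_extend add_hom_dh]]
          add_subgroup_image[OF add_hom_dh add_subgroup_frags] c])
       (use hh in auto)
  then show ?thesis using that assms(2) by auto
qed

lemma dh_exact_1:
  assumes c: "c \<in> frags (L \<times> tuples 1)" and "dh c = 0"
  obtains b where "b \<in> frags (L \<times> tuples 2)" "dh b = c"
proof -
  obtain p where p: "p \<in> P" using nonempty by blast
  have "frag_of (l, t) - frag_extend (\<lambda>(l, t). frag_of (l, [p])) (face_bd l t) \<in> dh ` frags (L \<times> tuples (Suc 1))"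
    if l: "l \<in> L" and t: "t \<in> tuples 1" for l t
  proof -
    obtain q where q: "q \<in> P" "t = [q]" using t by (auto simp: tuples_1)
    \<comment> \<open>The points \<open>p\<close> and \<open>q\<close> need not be transversal, so
      they are joined through \<open>s\<close>.\<close>
    obtain s where s: "s \<in> P" "tv s p" "tv s q" using common[OF p q(1) q(1)] by blast
    show ?thesis
      by (rule image_eqI[of _ _ "frag_of (l, [s, q]) - frag_of (l, [s, p])"])
         (use s q p l in \<open>auto simp: tuples_2 simp flip: numeral_2_eq_2 intro!: frags_diff\<close>)
  qed
  from dh_exact_aux[OF c assms(2) this] obtain b where "b \<in> frags (L \<times> tuples (Suc 1))" "dh b = c"
    by blast
  then show ?thesis using that by (simp add: numeral_2_eq_2)
qed

text \<open>
  Modulo boundaries the edge \<open>(p, q)\<close> is \<open>hh q - hh p\<close>, where \<open>hh q\<close> is a path of length two from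
  a base point to \<open>q\<close>, independent of the point in the middle.
\<close>

lemma dh_exact_2:
  fixes L :: "'l set"
  assumes c: "c \<in> frags (L \<times> tuples 2)" and "dh c = 0"
  obtains b where "b \<in> frags (L \<times> tuples 3)" "dh b = c"
proof -
  let ?B = "dh ` frags (L \<times> tuples 3)"
  have B: "add_subgroup ?B" by (rule add_subgroup_image[OF add_hom_dh add_subgroup_frags])
  let ?e = "\<lambda>l p q. frag_of (l, [p, q])"
  have tri: "?e l q r - ?e l p r + ?e l p q \<in> ?B"
    if "l \<in> L" "p \<in> P" "q \<in> P" "r \<in> P" "tv p q" "tv p r" "tv q r" for l p q r
    by (rule image_eqI[of _ _ "frag_of (l, [p, q, r])"]) (use that in \<open>auto simp: tuples_3\<close>)
  have anti: "?e l p q + ?e l q p \<in> ?B"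
    if *: "l \<in> L" "p \<in> P" "q \<in> P" "tv p q" for l p q
  proof -
    obtain s where s: "s \<in> P" "tv s p" "tv s q" using common[OF *(2,3,3)] by blast
    have "?e l p q + ?e l q p =
      (?e l p q - ?e l s q + ?e l s p) + (?e l q p - ?e l s p + ?e l s q)" by simp
    moreover have "\<dots> \<in> ?B"
      by (rule add_subgroup_add[OF B tri tri]) (use * s tv_sym in auto)
    ultimately show ?thesis by (simp only:)
  qed
  obtain o' where o: "o' \<in> P" using nonempty by blast
  define sel where "sel q = (SOME s. s \<in> P \<and> tv s o' \<and> tv s q)" for q
  have sel: "sel q \<in> P \<and> tv (sel q) o' \<and> tv (sel q) q" if "q \<in> P" for q
    unfolding sel_def by (rule someI_ex) (use common[OF o that that] in blast)
  define hh where "hh l q = ?e l o' (sel q) + ?e l (sel q) q" for l :: 'l and q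
  have indep: "hh l q - (?e l o' s + ?e l s q) \<in> ?B"
    if *: "l \<in> L" "q \<in> P" "s \<in> P" "tv s o'" "tv s q" for l q s
  proof -
    have step: "(?e l o' s' + ?e l s' q) - (?e l o' s + ?e l s q) \<in> ?B"
      if s': "s \<in> P" "tv s o'" "tv s q" "s' \<in> P" "tv s' o'" "tv s' q" "tv s s'" for s s'
    proof -
      have "(?e l o' s' + ?e l s' q) - (?e l o' s + ?e l s q) =
          (?e l s' q - ?e l s q + ?e l s s') - (?e l s s' - ?e l o' s' + ?e l o' s)" by simp
      moreover have "\<dots> \<in> ?B"
        by (rule add_subgroup_diff[OF B tri tri]) (use * s' tv_sym o in auto)
      ultimately show ?thesis by (simp only:)
    qed
    obtain s' where s': "s' \<in> P" "tv s' o'" "tv s' q" "tv s' s" using common[OF o *(2,3)] by blast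
    note z = sel[OF *(2)]
    show ?thesis
    proof (cases "tv s (sel q)")
      case True
      then show ?thesis using step[of s "sel q"] * z by (simp add: hh_def)
    next
      case False
      \<comment> \<open>Middle points that are not transversal to each other are compared through
        \<open>s'\<close>, which cotransitivity makes transversal to both.\<close>
      then have "tv s' (sel q)" using tv_cotrans[of s' "sel q" s] tv_sym s' z * by blast
      have "hh l q - (?e l o' s + ?e l s q) =
        (hh l q - (?e l o' s' + ?e l s' q)) + ((?e l o' s' + ?e l s' q) - (?e l o' s + ?e l s q))"
        by simp
      moreover have "\<dots> \<in> ?B"
        unfolding hh_def by (rule add_subgroup_add[OF B step step]) (use * s' z tv_sym \<open>tv s' (sel q)\<close> in auto)
      ultimately show ?thesis by (simp only:)
    qed
  qed
  have "frag_of (l, t) - frag_extend (\<lambda>(l, t). hh l (hd t)) (face_bd l t) \<in> dh ` frags (L \<times> tuples (Suc 2))"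
    if l: "l \<in> L" and t: "t \<in> tuples 2" for l t
  proof -
    obtain p q where pq: "p \<in> P" "q \<in> P" "tv p q" "t = [p, q]" using t by (auto simp: tuples_2)
    \<comment> \<open>One middle point serves both ends: the edge and the two paths then differ by
      the boundary of \<open>[s, p, q]\<close>.\<close>
    obtain s where s: "s \<in> P" "tv s o'" "tv s p" "tv s q" using common[OF o pq(1,2)] by blast
    have "frag_of (l, t) - frag_extend (\<lambda>(l, t). hh l (hd t)) (face_bd l t) =
        (?e l p q - ?e l s q + ?e l s p) - (hh l q - (?e l o' s + ?e l s q)) + (hh l p - (?e l o' s + ?e l s p))"
      by (simp add: pq frag_extend_diff)
    moreover have "\<dots> \<in> ?B"
      by (rule add_subgroup_add[OF B add_subgroup_diff[OF B tri indep] indep]) (use l pq s in auto)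
    ultimately show ?thesis by (simp add: eval_nat_numeral)
  qed
  from dh_exact_aux[OF c assms(2) this] obtain b where "b \<in> frags (L \<times> tuples (Suc 2))" "dh b = c"
    by blast
  then show ?thesis using that by (simp add: eval_nat_numeral)
qed

end

section \<open>Finite local rings of odd residue characteristic\<close>

text \<open>The ring-theoretic hypotheses in elementary form. The element \<open>\<gamma>\<close>
  lifts a generator of the cyclic group of residue units.\<close>

locale odd_local_ring =
  fixes \<mm> :: "'a::{comm_ring_1, finite} set" and \<gamma> :: 'a
  assumes m_zero: "0 \<in> \<mm>" and m_add: "x \<in> \<mm> \<Longrightarrow> y \<in> \<mm> \<Longrightarrow> x + y \<in> \<mm>"
    and m_mult: "x \<in> \<mm> \<Longrightarrow> c * x \<in> \<mm>"
    and unit_iff: "x dvd 1 \<longleftrightarrow> x \<notin> \<mm>"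
    and two: "2 \<notin> \<mm>"
    and gen: "\<gamma> \<notin> \<mm>" "x \<notin> \<mm> \<Longrightarrow> \<exists>i. x - \<gamma> ^ i \<in> \<mm>"

lemma odd_local_ringI:
  fixes \<mm> :: "'a::{comm_ring_1, finite} set"
  assumes max: "{I. maximalideal I (type_ring TYPE('a))} = {\<mm>}"
    and char: "group.ord (add_monoid (type_ring TYPE('a) Quot \<mm>)) \<one>\<^bsub>type_ring TYPE('a) Quot \<mm>\<^esub> > 2"
  obtains \<gamma> where "odd_local_ring \<mm> \<gamma>"
proof -
  let ?R = "type_ring TYPE('a)" and ?K = "type_ring TYPE('a) Quot \<mm>"
  have R_simps: "carrier ?R = UNIV" "\<And>x y. x \<otimes>\<^bsub>?R\<^esub> y = x * y" "\<And>x y. x \<oplus>\<^bsub>?R\<^esub> y = x + y"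
    "\<one>\<^bsub>?R\<^esub> = 1" "\<zero>\<^bsub>?R\<^esub> = 0"
    by (simp_all add: ring_of_type_algebra_def)
  interpret R: cring ?R by (rule cring_from_type_algebra)
  interpret m: maximalideal \<mm> ?R using max by blast
  interpret K: field ?K by (rule m.quotient_is_field) (rule R.is_cring)
  interpret q: ring_hom_ring ?R ?K "(+>\<^bsub>?R\<^esub>) \<mm>" by (rule m.rcos_ring_hom_ring)
  have zero: "0 \<in> \<mm>" using m.zero_closed by (simp add: R_simps)
  have add: "x + y \<in> \<mm>" if "x \<in> \<mm>" "y \<in> \<mm>" for x y
    using m.a_closed[OF that] by (simp add: R_simps)
  have mult: "c * x \<in> \<mm>" if "x \<in> \<mm>" for c x
    using m.I_l_closed[OF that, of c] by (simp add: R_simps)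
  have neg: "- x \<in> \<mm>" if "x \<in> \<mm>" for x using mult[OF that, of "-1"] by simp
  have one: "1 \<notin> \<mm>"
    using m.one_imp_carrier m.I_notcarr by (metis R_simps(4))
  have unit: "x dvd 1 \<longleftrightarrow> x \<notin> \<mm>" for x
  proof
    assume "x dvd 1" then show "x \<notin> \<mm>" using mult one by (metis dvdE mult.commute)
  next
    assume x: "x \<notin> \<mm>"
    show "x dvd 1"
    proof (rule ccontr)
      assume nx: "\<not> x dvd 1"
      \<comment> \<open>An ideal of greatest cardinality among the proper ones containing the
        nonunit \<open>x\<close> is maximal; finiteness takes the place of Zorn's lemma.\<close>
      define F where "F = {J. ideal J ?R \<and> x \<in> J \<and> 1 \<notin> J}"
      have "ideal (PIdl\<^bsub>?R\<^esub> x) ?R" "x \<in> PIdl\<^bsub>?R\<^esub> x"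
        using R.cgenideal_ideal[of x] R.cgenideal_self[of x] by (simp_all add: R_simps)
      moreover have "1 \<notin> PIdl\<^bsub>?R\<^esub> x"
      proof
        assume "1 \<in> PIdl\<^bsub>?R\<^esub> x"
        then obtain c where "1 = c * x" by (auto simp: cgenideal_def R_simps)
        then show False using nx by (metis dvd_triv_right)
      qed
      ultimately have F: "PIdl\<^bsub>?R\<^esub> x \<in> F" by (simp add: F_def)
      have bound: "\<forall>I. I \<in> F \<longrightarrow> card I < Suc (card (UNIV :: 'a set))"
        by (simp add: card_mono less_Suc_eq_le)
      obtain J where J: "J \<in> F" and Jmax: "\<forall>I. I \<in> F \<longrightarrow> card I \<le> card J"
        using ex_has_greatest_nat[of "\<lambda>I. I \<in> F", OF F bound] by (elim exE conjE)
      have "maximalideal J ?R"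
      proof (rule maximalidealI)
        show "ideal J ?R" using J by (simp add: F_def)
        show "carrier ?R \<noteq> J" using J by (auto simp: F_def R_simps)
        fix I assume I: "ideal I ?R" "J \<subseteq> I" "I \<subseteq> carrier ?R"
        show "I = J \<or> I = carrier ?R"
        proof (cases "1 \<in> I")
          case True then show ?thesis using ideal.one_imp_carrier[OF I(1)] by (simp add: R_simps)
        next
          case False
          then have "I \<in> F" using I J by (auto simp: F_def)
          then show ?thesis using Jmax card_seteq[of I J] I(2) by auto
        qed
      qed
      then have "J = \<mm>" using max by blast
      then show False using J x by (simp add: F_def)
    qed
  qed
  have add_coset: "x - y \<in> \<mm>" if "\<mm> +>\<^bsub>?R\<^esub> x = \<mm> +>\<^bsub>?R\<^esub> y" for x y
  proof -
    have "x \<in> \<mm> +>\<^bsub>?R\<^esub> y" using m.a_rcos_self[of x] by (simp add: R_simps that)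
    then show ?thesis by (auto simp: a_r_coset_def' R_simps)
  qed
  have two: "2 \<notin> \<mm>"
  proof
    assume 2: "2 \<in> \<mm>"
    have "1 \<oplus>\<^bsub>?R\<^esub> 1 = (2::'a)" by (simp only: R_simps one_add_one)
    then have "\<mm> +>\<^bsub>?R\<^esub> 2 = (\<mm> +>\<^bsub>?R\<^esub> 1) \<oplus>\<^bsub>?K\<^esub> (\<mm> +>\<^bsub>?R\<^esub> 1)"
      using q.hom_add[of 1 1] by (simp only: R_simps UNIV_I)
    moreover have "\<mm> +>\<^bsub>?R\<^esub> 1 = \<one>\<^bsub>?K\<^esub>" by (simp only: FactRing_def R_simps ring.simps monoid.simps)
    moreover have "\<mm> +>\<^bsub>?R\<^esub> 2 = \<zero>\<^bsub>?K\<^esub>"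
      using m.a_rcos_const[OF 2] by (simp only: FactRing_def ring.simps)
    ultimately have "\<one>\<^bsub>?K\<^esub> \<oplus>\<^bsub>?K\<^esub> \<one>\<^bsub>?K\<^esub> = \<zero>\<^bsub>?K\<^esub>" by (simp only:)
    \<comment> \<open>With 2 equal to zero in the residue field, the additive order of one would
      divide 2, against the hypothesis on the characteristic.\<close>
    then have "\<one>\<^bsub>?K\<^esub> [^]\<^bsub>add_monoid ?K\<^esub> (2::nat) = \<one>\<^bsub>add_monoid ?K\<^esub>"
      by (simp add: nat_pow_def numeral_2_eq_2)
    then have "group.ord (add_monoid ?K) \<one>\<^bsub>?K\<^esub> dvd 2"
      by (subst group.pow_eq_id[OF K.a_group, symmetric]) simp_all
    then show False using char by (auto dest: dvd_imp_le)
  qed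
  have "finite (carrier ?K)" by (rule finite)
  from K.finite_field_mult_group_has_gen[OF this] obtain C where C: "C \<in> carrier (Multiplicative_Group.mult_of ?K)"
    "carrier (Multiplicative_Group.mult_of ?K) = {C [^]\<^bsub>?K\<^esub> i | i::nat. i \<in> UNIV}"
    by (elim bexE)
  have K: "C \<in> carrier (Multiplicative_Group.mult_of ?K) \<longleftrightarrow> (\<exists>x. C = \<mm> +>\<^bsub>?R\<^esub> x) \<and> C \<noteq> \<mm>" for C
    by (simp only: Multiplicative_Group.carrier_mult_of FactRing_def A_RCOSETS_def' R_simps
        ring.simps partial_object.simps Diff_iff UN_iff singleton_iff UNIV_I bex_UNIV) 
  obtain \<gamma> where \<gamma>: "C = \<mm> +>\<^bsub>?R\<^esub> \<gamma>"
    using C(1) unfolding K by (elim conjE exE)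
  have "\<exists>i. x - \<gamma> ^ i \<in> \<mm>" if x: "x \<notin> \<mm>" for x
  proof -
    have "\<mm> +>\<^bsub>?R\<^esub> x \<noteq> \<mm>"
      using m.a_rcos_self[of x] x unfolding R_simps by (metis UNIV_I)
    then have "\<mm> +>\<^bsub>?R\<^esub> x \<in> carrier (Multiplicative_Group.mult_of ?K)"
      unfolding K by (intro conjI exI[of _ x] refl)
    then obtain i :: nat where "\<mm> +>\<^bsub>?R\<^esub> x = C [^]\<^bsub>?K\<^esub> i"
      unfolding C(2) mem_Collect_eq by (elim exE conjE)
    also have "\<dots> = \<mm> +>\<^bsub>?R\<^esub> (\<gamma> [^]\<^bsub>?R\<^esub> i)"
      unfolding \<gamma> using q.hom_nat_pow[of \<gamma> i] by (simp add: R_simps)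
    also have "\<gamma> [^]\<^bsub>?R\<^esub> i = \<gamma> ^ i"
      by (induction i) (simp_all add: R_simps mult.commute nat_pow_def)
    finally show ?thesis using add_coset by blast
  qed
  moreover have "\<gamma> \<notin> \<mm>"
    using C(1) m.a_rcos_const unfolding K \<gamma> by metis
  ultimately have "odd_local_ring \<mm> \<gamma>"
    by unfold_locales (use zero add mult unit two in auto)
  then show ?thesis using that by blast
qed

text \<open>Negation pairs off all elements other than 0.\<close>

lemma odd_card_negation_closed:
  fixes S :: "'b::ab_group_add set"
  assumes "finite S" "0 \<in> S" "\<And>x. x \<in> S \<Longrightarrow> - x \<in> S" "\<And>x. x \<in> S \<Longrightarrow> x = - x \<Longrightarrow> x = 0"
  shows "odd (card S)"
proof -
  have "even (card T)"
    if "finite T" "0 \<notin> T" "T \<subseteq> S" "\<And>x. x \<in> T \<Longrightarrow> - x \<in> T" for T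
    using that
  proof (induction "card T" arbitrary: T rule: less_induct)
    case less
    show ?case
    proof (cases "T = {}")
      case False
      then obtain x where x: "x \<in> T" by blast
      have nx: "- x \<in> T" "x \<noteq> - x" using x less.prems assms(4) by auto
      let ?T = "T - {x, - x}"
      have c: "card T = card ?T + 2"
      proof -
        have "{x, - x} \<subseteq> T" and 2: "card {x, - x} = 2" using x nx by auto
        then have "card ?T = card T - 2" "2 \<le> card T"
          using card_Diff_subset[of "{x, - x}" T] card_mono[OF less.prems(1), of "{x, - x}"] by simp_all
        then show ?thesis by linarith
      qed
      have "even (card ?T)"
      proof (rule less.hyps)
        show "- y \<in> ?T" if "y \<in> ?T" for y
          using that less.prems(4)[of y] by (metis DiffD1 DiffD2 DiffI insert_iff minus_minus singletonD)
      qed (use c less.prems in auto)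
      then show ?thesis using c by simp
    qed simp
  qed
  from this[of "S - {0}"] have "even (card (S - {0}))" using assms by auto
  moreover have "card S = Suc (card (S - {0}))" using assms(1,2) by (metis card.remove)
  ultimately show ?thesis by simp
qed

context odd_local_ring
begin

lemma m_minus: "x \<in> \<mm> \<Longrightarrow> - x \<in> \<mm>"
  using m_mult[of x "-1"] by simp

lemma m_diff: "x \<in> \<mm> \<Longrightarrow> y \<in> \<mm> \<Longrightarrow> x - y \<in> \<mm>"
  using m_add[of x "- y"] m_minus[of y] by simp

lemma m_mult_right: "x \<in> \<mm> \<Longrightarrow> x * c \<in> \<mm>"
  using m_mult[of x c] by (simp add: mult.commute)

lemma one_notin: "1 \<notin> \<mm>" using unit_iff[of 1] by simp

lemma zero_neq_one': "(0::'a) \<noteq> 1" using one_notin m_zero by auto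

lemma unit_plus_m: "x \<in> \<mm> \<Longrightarrow> u dvd 1 \<Longrightarrow> (u + x) dvd 1"
  using m_diff[of "u + x" x] by (auto simp: unit_iff)

lemma unit_mult: "(a::'a) * b dvd 1 \<longleftrightarrow> a dvd 1 \<and> b dvd 1"
  by (metis dvd_mult_left dvd_mult_right mult.right_neutral mult_dvd_mono)

lemma unit_power: "(a::'a) dvd 1 \<Longrightarrow> a ^ n dvd 1"
  by (induction n) (simp_all add: unit_mult)

lemma unit_cancel: "(u::'a) dvd 1 \<Longrightarrow> u * x = u * y \<Longrightarrow> x = y"
  by (metis dvdE mult.assoc mult.commute mult_1)

lemma minus_self: "x = - x \<Longrightarrow> x = (0::'a)"
proof -
  assume "x = - x"
  then have "x + x = 0" by (metis add.right_inverse)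
  then have "2 * x = 2 * 0" by (simp only: mult_2 add_0)
  then show "x = 0" by (rule unit_cancel[rotated]) (simp add: unit_iff two)
qed

lemma odd_card_UNIV: "odd (card (UNIV :: 'a set))"
  by (rule odd_card_negation_closed[OF finite UNIV_I UNIV_I minus_self])

lemma odd_card_m: "odd (card \<mm>)"
  by (rule odd_card_negation_closed[OF finite m_zero m_minus minus_self])

text \<open>Lagrange's theorem for the group \<open>1 + \<mm>\<close>: multiplication by an element
  permutes the group, so the product of all elements absorbs the power.\<close>

lemma one_plus_m_power:
  assumes "x \<in> \<mm>"
  shows "(1 + x) ^ card \<mm> = 1"
proof -
  let ?U = "(+) 1 ` \<mm>"
  have unit: "(1 + x) dvd 1" using unit_plus_m[OF assms, of 1] by simp
  have inj: "inj_on ((*) (1 + x)) ?U"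
    using unit_cancel[OF unit] by (auto intro: inj_onI)
  have "(*) (1 + x) ` ?U \<subseteq> ?U"
  proof clarify
    fix y assume "y \<in> \<mm>"
    then have "x + y + x * y \<in> \<mm>" using assms by (intro m_add m_mult)
    then show "(1 + x) * (1 + y) \<in> ?U" by (intro image_eqI[of _ _ "x + y + x * y"]) (auto simp: algebra_simps)
  qed
  then have img: "(*) (1 + x) ` ?U = ?U" using inj by (intro endo_inj_surj) auto
  have "\<Prod>?U = (\<Prod>u\<in>?U. (1 + x) * u)"
    by (subst img[symmetric]) (simp only: prod.reindex[OF inj] comp_def)
  also have "\<dots> = (1 + x) ^ card \<mm> * \<Prod>?U"
    by (simp add: prod.distrib card_image)
  finally have "\<Prod>?U * ((1 + x) ^ card \<mm>) = \<Prod>?U * 1" by (simp add: mult.commute)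
  moreover have "\<Prod>?U dvd 1"
  proof -
    have "(\<Prod>u\<in>T. u) dvd (1::'a)" if "finite T" "T \<subseteq> ?U" for T
      using that by (induction T) (use unit_plus_m[of _ 1] in \<open>auto simp: unit_mult\<close>)
    from this[of ?U] show ?thesis by simp
  qed
  ultimately show ?thesis using unit_cancel by blast
qed

section \<open>Square classes of units\<close>

definition sq :: "'a \<Rightarrow> bool" where "sq a \<longleftrightarrow> (\<exists>b. b dvd 1 \<and> a = b * b)"

lemma sq_unit: "sq a \<Longrightarrow> a dvd 1"
  by (auto simp: sq_def unit_mult)

lemma sq_mult: "sq a \<Longrightarrow> sq b \<Longrightarrow> sq (a * b)"
proof -
  assume "sq a" "sq b"
  then obtain u v where "u dvd 1" "v dvd 1" "a = u * u" "b = v * v" by (auto simp: sq_def)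
  then have "u * v dvd 1" "a * b = (u * v) * (u * v)" by (simp_all add: unit_mult ac_simps)
  then show "sq (a * b)" unfolding sq_def by blast
qed

lemma sq_one: "sq 1" by (auto simp: sq_def intro: exI[of _ 1])

lemma sq_mult_cancel: "sq a \<Longrightarrow> sq (a * b) \<longleftrightarrow> sq b"
proof
  assume "sq a" "sq (a * b)"
  then obtain u v where uv: "u dvd 1" "v dvd 1" "a = u * u" "a * b = v * v" by (auto simp: sq_def)
  obtain w where w: "u * w = 1" using uv(1) by (metis dvdE)
  have "b = (u * w) * (u * w) * b" by (simp add: w)
  also have "\<dots> = ((u * u) * b) * (w * w)" by (simp only: ac_simps)
  also have "\<dots> = (v * v) * (w * w)" using uv(3,4) by simp
  also have "\<dots> = (v * w) * (v * w)" by (simp only: ac_simps)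
  finally have "b = (v * w) * (v * w)" .
  moreover have "w dvd 1" using w by (metis dvd_triv_right)
  ultimately show "sq b" using uv(2) unit_mult[of v w] unfolding sq_def by blast
qed (simp add: sq_mult)

text \<open>An element killed by the odd exponent \<open>2 * k + 1\<close> is the square of its
  power with exponent \<open>k + 1\<close>.\<close>

lemma sq_one_plus_m: "x \<in> \<mm> \<Longrightarrow> sq (1 + x)"
proof -
  assume x: "x \<in> \<mm>"
  obtain k where k: "card \<mm> = 2 * k + 1" using odd_card_m by (metis oddE)
  have "(1 + x) ^ (k + 1) * (1 + x) ^ (k + 1) = (1 + x) ^ card \<mm> * (1 + x)"
    by (simp add: k power_add power_mult power2_eq_square power_mult_distrib ac_simps)
  also have "\<dots> = 1 + x" by (simp add: one_plus_m_power[OF x])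
  finally have "1 + x = (1 + x) ^ (k + 1) * (1 + x) ^ (k + 1)" by simp
  moreover have "(1 + x) ^ (k + 1) dvd 1"
    using unit_plus_m[OF x, of 1] by (intro unit_power) simp
  ultimately show "sq (1 + x)" unfolding sq_def by blast
qed

text \<open>Two units with the same residue differ by a factor in \<open>1 + \<mm>\<close>, which is
  a square.\<close>

lemma sq_cong:
  assumes "a dvd 1" "a - b \<in> \<mm>"
  shows "sq a \<longleftrightarrow> sq b"
proof -
  obtain c where c: "a * c = 1" using assms(1) by (metis dvdE)
  have "(1 + - (c * (a - b))) * a = a - (a * c) * (a - b)" by (simp add: algebra_simps)
  then have "b = (1 + - (c * (a - b))) * a" by (simp add: c)
  then have "sq b \<longleftrightarrow> sq ((1 + - (c * (a - b))) * a)" by simp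
  also have "\<dots> \<longleftrightarrow> sq a" by (rule sq_mult_cancel[OF sq_one_plus_m[OF m_minus[OF m_mult[OF assms(2)]]]])
  finally show ?thesis by simp
qed

text \<open>Residues are powers of \<open>\<gamma>\<close>; a nonsquare has an odd exponent, and two
  odd exponents add up to an even one.\<close>

lemma nonsquare_product:
  assumes "a dvd 1" "b dvd 1" "\<not> sq a" "\<not> sq b"
  shows "sq (a * b)"
proof -
  have "\<exists>i. a - \<gamma> ^ i \<in> \<mm>" "\<exists>i. b - \<gamma> ^ i \<in> \<mm>" using gen(2) assms(1,2) by (auto simp: unit_iff)
  then obtain i j where i: "a - \<gamma> ^ i \<in> \<mm>" and j: "b - \<gamma> ^ j \<in> \<mm>" by blast
  have ev: "sq (\<gamma> ^ (2 * n))" for n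
    unfolding sq_def using gen(1)
    by (intro exI[of _ "\<gamma> ^ n"]) (auto simp: unit_iff[symmetric] unit_power power_mult power2_eq_square power_mult_distrib)
  have "odd i" "odd j" using sq_cong[OF assms(1) i] sq_cong[OF assms(2) j] assms(3,4) ev by (metis evenE)+
  then obtain n where n: "i + j = 2 * n" by (metis evenE odd_even_add)
  have "a * b - \<gamma> ^ (i + j) = (a - \<gamma> ^ i) * b + \<gamma> ^ i * (b - \<gamma> ^ j)"
    by (simp add: algebra_simps power_add)
  also have "\<dots> \<in> \<mm>" using i j by (intro m_add m_mult m_mult_right)
  finally show ?thesis
    using sq_cong[of "a * b"] assms(1,2) ev[of n] by (simp add: unit_mult n)
qed

lemma sq_mult_iff: "a dvd 1 \<Longrightarrow> b dvd 1 \<Longrightarrow> sq (a * b) \<longleftrightarrow> (sq a \<longleftrightarrow> sq b)"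
  by (metis mult.commute nonsquare_product sq_mult_cancel)

text \<open>The factors \<open>x - 1\<close> and \<open>x + 1\<close> differ by the unit 2, so one
  of them is a unit and the other one is zero.\<close>

lemma square_root_of_one: "x * x = (1::'a) \<Longrightarrow> x = 1 \<or> x = - 1"
proof -
  assume x: "x * x = 1"
  then have p: "(x - 1) * (x + 1) = 0" by (simp add: algebra_simps)
  have "x - 1 \<notin> \<mm> \<or> x + 1 \<notin> \<mm>" using m_diff[of "x + 1" "x - 1"] two by auto
  then show ?thesis
  proof
    assume "x - 1 \<notin> \<mm>"
    then have "x + 1 = 0" using unit_cancel[of "x - 1" "x + 1" 0] p by (simp add: unit_iff)
    then show ?thesis by (simp add: eq_neg_iff_add_eq_0)
  next
    assume "x + 1 \<notin> \<mm>"
    then have "x - 1 = 0" using unit_cancel[of "x + 1" "x - 1" 0] p by (simp add: unit_iff mult.commute)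
    then show ?thesis by simp
  qed
qed

text \<open>Otherwise squaring would be a surjection of the finite set of units, hence injective,
  although 1 and -1 have the same square.\<close>

lemma nonsquare_exists: "\<exists>e. e dvd 1 \<and> \<not> sq e"
proof (rule ccontr)
  assume "\<not> ?thesis"
  then have all: "\<And>e. e dvd 1 \<Longrightarrow> sq e" by blast
  let ?U = "{u::'a. u dvd 1}"
  have "?U \<subseteq> (\<lambda>b. b * b) ` ?U"
  proof
    fix u assume "u \<in> ?U"
    then obtain b where "b dvd 1" "u = b * b" using all[of u] by (auto simp: sq_def)
    then show "u \<in> (\<lambda>b. b * b) ` ?U" by blast
  qed
  moreover have "finite ?U" by simp
  ultimately have "card ((\<lambda>b. b * b) ` ?U) = card ?U"
    by (intro antisym card_image_le card_mono) auto
  then have "inj_on (\<lambda>b. b * b) ?U" by (intro eq_card_imp_inj_on) auto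
  then have "(1::'a) = - 1" by (rule inj_onD) simp_all
  then show False using minus_self[of 1] zero_neq_one'[symmetric] by metis
qed

text \<open>
  Otherwise the squares modulo \<open>\<mm>\<close> would be closed under addition, hence contain \<open>- 1\<close> (a sum of
  ones) and all differences of squares, that is, everything.
\<close>

lemma nonsquare_pair: "\<exists>x. x dvd 1 \<and> (1 - x) dvd 1 \<and> \<not> sq x \<and> \<not> sq (1 - x)"
proof (rule ccontr)
  assume no: "\<not> ?thesis"
  define Q where "Q = {a. \<exists>b. a - b * b \<in> \<mm>}"
  have sum: "a * a + b * b \<in> Q" for a b
  proof (cases "a \<in> \<mm> \<or> b \<in> \<mm> \<or> a * a + b * b \<in> \<mm>")
    case True
    then consider "a \<in> \<mm>" | "b \<in> \<mm>" | "a * a + b * b \<in> \<mm>" by blast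
    then show ?thesis
    proof cases
      case 1 then show ?thesis using m_mult[of a a] by (auto simp: Q_def intro: exI[of _ b])
    next
      case 2 then show ?thesis using m_mult[of b b] by (auto simp: Q_def intro: exI[of _ a])
    next
      case 3 then show ?thesis by (auto simp: Q_def intro: exI[of _ 0])
    qed
  next
    case False
    let ?e = "a * a + b * b"
    have u: "a dvd 1" "b dvd 1" "?e dvd 1" using False by (auto simp: unit_iff)
    obtain d where d: "?e * d = 1" using u(3) by (metis dvdE)
    have du: "d dvd 1" using d by (metis dvd_triv_right)
    have sqs: "sq (a * a)" "sq (b * b)" using u by (auto simp: sq_def)
    \<comment> \<open>The inverse \<open>d\<close> of the sum scales the two squares to a pair with
      sum 1. By assumption one member is a square, hence so are \<open>d\<close> and the
      sum.\<close>
    have e2: "1 - (a * a) * d = (b * b) * d" using d by (simp add: algebra_simps)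
    have "sq (a * a * d) \<or> sq (b * b * d)"
      using no u du e2 by (metis unit_mult)
    then have "sq d" using sq_mult_cancel sqs by blast
    then have "sq ?e" using d sq_mult_cancel[of d ?e] sq_one by (simp add: mult.commute)
    then obtain c where "?e = c * c" by (auto simp: sq_def)
    then have "?e - c * c \<in> \<mm>" using m_zero by simp
    then show ?thesis unfolding Q_def by blast
  qed
  have Q_add: "x + y \<in> Q" if xy: "x \<in> Q" "y \<in> Q" for x y
  proof -
    obtain a where a: "x - a * a \<in> \<mm>" using xy(1) by (auto simp: Q_def)
    obtain b where b: "y - b * b \<in> \<mm>" using xy(2) by (auto simp: Q_def)
    obtain c where c: "a * a + b * b - c * c \<in> \<mm>" using sum[of a b] by (auto simp: Q_def)
    have "x + y - c * c = (x - a * a) + (y - b * b) + (a * a + b * b - c * c)" by simp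
    also have "\<dots> \<in> \<mm>" using a b c by (intro m_add)
    finally show ?thesis by (auto simp: Q_def)
  qed
  have Q_sq: "a * a \<in> Q" for a using m_zero by (auto simp: Q_def intro: exI[of _ a])
  have Q_nat: "of_nat n \<in> Q" for n
    by (induction n) (use Q_sq[of 0] Q_sq[of 1] Q_add in auto)
  have "\<not> inj (of_nat :: nat \<Rightarrow> 'a)"
    using finite_imageD[of of_nat UNIV] by (metis finite infinite_UNIV_nat)
  then obtain i j :: nat where ij: "i < j" "(of_nat i :: 'a) = of_nat j"
    by (metis injI linorder_neqE_nat)
  then have "(of_nat (j - i - 1) :: 'a) = - 1"
    by (simp add: of_nat_diff Suc_leI)
  then have "- 1 \<in> Q" using Q_nat by metis
  then obtain i where i: "- 1 - i * i \<in> \<mm>" by (auto simp: Q_def)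
  obtain e where e: "e dvd 1" "\<not> sq e" using nonsquare_exists by blast
  obtain h where h: "2 * h = (1::'a)" using two by (metis dvdE unit_iff)
  \<comment> \<open>Chosen with \<open>e\<close> equal to the difference of the squares of
    \<open>?u\<close> and \<open>?v\<close>; as -1 is a square modulo \<open>\<mm>\<close>, this is
    a sum of two squares there.\<close>
  let ?u = "(e + 1) * h" and ?v = "(e - 1) * h"
  have "?u * ?u - ?v * ?v = e * ((2 * h) * (2 * h))" by (simp add: algebra_simps)
  then have uv: "e = ?u * ?u - ?v * ?v" using h by simp
  have "?u * ?u + (i * ?v) * (i * ?v) \<in> Q" by (rule sum)
  then obtain c where c: "?u * ?u + (i * ?v) * (i * ?v) - c * c \<in> \<mm>" by (auto simp: Q_def)
  have "e - c * c = (?u * ?u + (i * ?v) * (i * ?v) - c * c) + (?v * ?v) * (- 1 - i * i)"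
    by (subst uv) (simp add: algebra_simps)
  also have "\<dots> \<in> \<mm>" by (intro m_add c m_mult i)
  finally have ec: "e - c * c \<in> \<mm>" .
  then have "c * c \<notin> \<mm>" using e(1) m_add[of "e - c * c" "c * c"] by (auto simp: unit_iff)
  then have "sq (c * c)" using m_mult[of c c] by (auto simp: sq_def unit_iff)
  then show False using sq_cong[OF e(1) ec] e(2) by simp
qed

end

section \<open>Lines and transversality\<close>

definition mat2 :: "'a \<Rightarrow> 'a \<Rightarrow> 'a \<Rightarrow> 'a \<Rightarrow> 'a::comm_ring_1^2^2" where
  "mat2 a b c d = vector [vector [a, b], vector [c, d]]"

lemma mat2_nth [simp]:
  "mat2 a b c d $ 1 $ 1 = a" "mat2 a b c d $ 1 $ 2 = b" "mat2 a b c d $ 2 $ 1 = c" "mat2 a b c d $ 2 $ 2 = d"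
  by (simp_all add: mat2_def)

lemma mat2_eq_iff: "M = N \<longleftrightarrow> M$1$1 = N$1$1 \<and> M$1$2 = N$1$2 \<and> M$2$1 = N$2$1 \<and> M$2$2 = N$2$2"
  for M N :: "'a::comm_ring_1^2^2"
  by (auto simp: vec_eq_iff forall_2)

lemma mult2_nth [simp]:
  "(M ** N)$i$j = M$i$1 * N$1$j + M$i$2 * N$2$j" for M N :: "'a::comm_ring_1^2^2"
  by (simp add: matrix_matrix_mult_def sum_2)

lemma mult2_vec_nth [simp]:
  "(M *v x)$i = M$i$1 * x$1 + M$i$2 * x$2" for M :: "'a::comm_ring_1^2^2"
  by (simp add: matrix_vector_mult_def sum_2)

lemma axis2_nth [simp]: "(axis 1 x :: 'a::zero^2)$1 = x" "(axis 1 x :: 'a^2)$2 = 0"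
  "(axis 2 x :: 'a^2)$1 = 0" "(axis 2 x :: 'a^2)$2 = x"
  by (simp_all add: axis_def)

lemma mat_nth [simp]: "(mat x :: 'a::zero^2^2)$1$1 = x" "(mat x :: 'a^2^2)$1$2 = 0"
  "(mat x :: 'a^2^2)$2$1 = 0" "(mat x :: 'a^2^2)$2$2 = x"
  by (simp_all add: mat_def)

lemma vec2_eq_iff: "u = v \<longleftrightarrow> u$1 = v$1 \<and> u$2 = v$2" for u v :: "'a::comm_ring_1^2"
  by (simp add: vec_eq_iff forall_2)

definition dt :: "'a::comm_ring_1^2 \<Rightarrow> 'a^2 \<Rightarrow> 'a" where
  "dt u v = u$1 * v$2 - v$1 * u$2"

lemma dt_mult: "dt (M *v u) (M *v v) = det M * dt u v"
  by (simp add: dt_def det_2 algebra_simps)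

lemma dt_scale: "dt (a *s u) v = a * dt u v" "dt u (a *s v) = a * dt u v"
  by (simp_all add: dt_def algebra_simps)

lemma dt_anti: "dt v u = - dt u v"
  by (simp add: dt_def)

lemma dt_self [simp]: "dt u u = 0"
  by (simp add: dt_def)

text \<open>Cramer's rule: if \<open>dt u w\<close> is a unit, this expands \<open>v\<close> in the
  basis \<open>u\<close>, \<open>w\<close>.\<close>

lemma dt_plucker: "dt u w *s v = dt v w *s u + dt u v *s w"
  by (simp add: dt_def vec2_eq_iff algebra_simps)

lemma dt_axis [simp]: "dt (axis 1 1) (axis 2 1) = 1" "dt (axis 1 1) u = u$2" "dt u (axis 2 1) = u$1"
  by (simp_all add: dt_def)

lemma line_refl: "u \<in> line u"
  using mem_line_iff[of u u] by (metis vector_smult_lid)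

lemma image_line_eigen: "(*v) M ` line u = line u \<Longrightarrow> \<exists>a. M *v u = a *s u"
  using line_refl[of "M *v u"] by (simp add: image_line mem_line_iff)

text \<open>The witness \<open>w\<close> completes \<open>v\<close> to an invertible matrix, so
  these are the lines of unimodular vectors (\<open>unimodular_iff\<close>).\<close>

definition pts :: "('a::comm_ring_1^2) set set" where
  "pts = {line v | v. \<exists>w. dt v w dvd 1}"

definition tv :: "('a::comm_ring_1^2) set \<Rightarrow> ('a^2) set \<Rightarrow> bool" where
  "tv p q \<longleftrightarrow> (\<exists>u v. p = line u \<and> q = line v \<and> dt u v dvd 1)"

abbreviation p_inf :: "('a::comm_ring_1^2) set" where "p_inf \<equiv> line (axis 1 1)"
abbreviation p_zero :: "('a::comm_ring_1^2) set" where "p_zero \<equiv> line (axis 2 1)"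

lemma line_eq_scale:
  assumes "line u = line v" "dt u w dvd 1"
  obtains c where "c dvd 1" "v = c *s u"
proof -
  obtain c where c: "v = c *s u" using line_refl[of v] assms(1) by (metis mem_line_iff)
  obtain d where d: "u = d *s v" using line_refl[of u] assms(1) by (metis mem_line_iff)
  have "dt u w = (c * d) * dt u w"
    by (subst d, subst c) (simp add: dt_scale ac_simps)
  moreover obtain e where "dt u w * e = 1" using assms(2) by (metis dvdE)
  ultimately have "c * d = 1" by (metis mult.assoc mult_1_right)
  then show ?thesis using that c by (metis dvd_triv_left)
qed

lemma line_smult_unit: "c dvd 1 \<Longrightarrow> line (c *s u) = line u"
  using line_smult by (metis dvdE)

lemma dvd_one_mult: "a dvd 1 \<Longrightarrow> b dvd 1 \<Longrightarrow> (a * b :: 'a::comm_ring_1) dvd 1"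
  using mult_dvd_mono[of a 1 b 1] by simp

text \<open>The choice of generators is immaterial, because generators of such a line differ by a
  unit.\<close>

lemma tv_line [simp]: "tv (line u) (line v) \<longleftrightarrow> dt u v dvd 1"
proof
  assume "tv (line u) (line v)"
  then obtain u' v' where uv: "line u' = line u" "line v' = line v" "dt u' v' dvd 1"
    by (auto simp: tv_def)
  obtain c where c: "c dvd 1" "u = c *s u'" using line_eq_scale[OF uv(1,3)] .
  have "dt v' u' dvd 1" using uv(3) by (simp add: dt_anti[of v'])
  then obtain d where d: "d dvd 1" "v = d *s v'" using line_eq_scale[OF uv(2)] by blast
  show "dt u v dvd 1" using uv(3) c(1) d(1) by (simp add: c(2) d(2) dt_scale dvd_one_mult)
qed (auto simp: tv_def)

lemma ptsE:
  assumes "p \<in> pts"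
  obtains v w where "p = line v" "dt v w dvd 1"
  using assms by (auto simp: pts_def)

lemma dt_unit_sym: "dt v u dvd 1 \<longleftrightarrow> dt u v dvd 1"
  by (simp add: dt_anti[of v u])

lemma line_in_pts:
  assumes "dt u v dvd 1"
  shows "line u \<in> pts" "line v \<in> pts"
  using assms dt_unit_sym[of v u] by (auto simp: pts_def)

lemma tv_sym': "tv p q \<Longrightarrow> tv q p"
  unfolding tv_def using dt_unit_sym by blast

lemma SL2_pts:
  assumes "det M = 1" "p \<in> pts"
  shows "(*v) M ` p \<in> pts"
proof -
  obtain v w where "p = line v" "dt v w dvd 1" using assms(2) by (rule ptsE)
  then show ?thesis
    using line_in_pts(1)[of "M *v v" "M *v w"] assms(1) by (simp add: image_line dt_mult)
qed

lemma SL2_tv: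
  assumes "det M = 1" "tv p q"
  shows "tv ((*v) M ` p) ((*v) M ` q)"
proof -
  obtain u v where "p = line u" "q = line v" "dt u v dvd 1" using assms(2) by (auto simp: tv_def)
  then show ?thesis using assms(1) by (simp add: image_line dt_mult)
qed

lemma cols_det: "det (mat2 (u$1) (v$1) (u$2) (v$2)) = dt u v"
  by (simp add: det_2 dt_def)

text \<open>Generators of the lines serve as columns; dividing the second by the determinant does
  not change its line.\<close>

lemma tv_orbit:
  assumes "tv p q"
  obtains M where "det M = 1" "(*v) M ` p_inf = p" "(*v) M ` p_zero = q"
proof -
  obtain u v where uv: "p = line u" "q = line v" "dt u v dvd 1" using assms by (auto simp: tv_def)
  then obtain e where e: "dt u v * e = 1" by (metis dvdE)
  let ?M = "mat2 (u$1) (e * v$1) (u$2) (e * v$2)"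
  have "det ?M = 1" using e by (simp add: det_2 dt_def algebra_simps)
  moreover have "?M *v axis 1 1 = u" "?M *v axis 2 1 = e *s v"
    by (simp_all add: vec2_eq_iff)
  ultimately show ?thesis
    using that[of ?M] uv e line_smult_unit[of e v] by (auto simp: image_line) (metis dvd_triv_right)
qed

lemma pts_orbit:
  assumes "p \<in> pts"
  obtains M where "det M = 1" "(*v) M ` p_inf = p"
proof -
  obtain v w where v: "p = line v" "dt v w dvd 1" using assms by (rule ptsE)
  then have "tv p (line w)" by simp
  then show ?thesis using that by (rule tv_orbit)
qed

lemma p_inf_zero: "p_inf \<in> pts" "p_zero \<in> pts" "tv p_inf p_zero" "tv p_zero p_inf"
  using line_in_pts[of "axis 1 1" "axis 2 1"] by (auto simp: dt_def)

lemma stab_inf: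
  "(*v) M ` p_inf = p_inf \<Longrightarrow> M$2$1 = 0"
  "M$2$1 = 0 \<Longrightarrow> det M = 1 \<Longrightarrow> (*v) M ` p_inf = p_inf"
proof -
  assume "(*v) M ` p_inf = p_inf"
  then obtain a where "M *v axis 1 1 = a *s axis 1 1" using image_line_eigen by blast
  then show "M$2$1 = 0" by (simp add: vec2_eq_iff)
next
  assume "M$2$1 = 0" "det M = 1"
  then have "M *v axis 1 1 = M$1$1 *s axis 1 1" "M$1$1 dvd 1"
    by (simp add: vec2_eq_iff) (metis \<open>M $ 2 $ 1 = 0\<close> \<open>det M = 1\<close> det_2 diff_zero dvd_triv_left mult_zero_right)
  then show "(*v) M ` p_inf = p_inf" by (simp add: image_line line_smult_unit)
qed

lemma stab_zero: "(*v) M ` p_zero = p_zero \<Longrightarrow> M$1$2 = 0"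
proof -
  assume "(*v) M ` p_zero = p_zero"
  then obtain a where "M *v axis 2 1 = a *s axis 2 1" using image_line_eigen by blast
  then show "M$1$2 = 0" by (simp add: vec2_eq_iff)
qed

context odd_local_ring
begin

lemma primitive_iff: "(\<exists>w. dt v w dvd 1) \<longleftrightarrow> v$1 \<notin> \<mm> \<or> v$2 \<notin> \<mm>"
proof
  assume "\<exists>w. dt v w dvd 1"
  then obtain w where "dt v w \<notin> \<mm>" by (auto simp: unit_iff)
  then show "v$1 \<notin> \<mm> \<or> v$2 \<notin> \<mm>"
    unfolding dt_def using m_diff[OF m_mult_right m_mult] by blast
next
  assume "v$1 \<notin> \<mm> \<or> v$2 \<notin> \<mm>"
  then show "\<exists>w. dt v w dvd 1"
    using dt_unit_sym[of v "axis 1 1"] by (metis dt_axis(2,3) unit_iff)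
qed

text \<open>If \<open>dt u v\<close> and \<open>dt v w\<close> lie in \<open>\<mm>\<close>, then
  \<open>dt_plucker\<close> puts the multiple of \<open>v\<close> by the unit \<open>dt u w\<close>
  into \<open>\<mm>\<close>, although \<open>v\<close> is primitive.\<close>

lemma tv_cotrans':
  fixes p :: "('a^2) set"
  assumes "p \<in> pts" "q \<in> pts" "r \<in> pts" "tv p r"
  shows "tv p q \<or> tv q r"
proof (rule ccontr)
  assume no: "\<not> ?thesis"
  obtain u v w where uvw: "p = line u" "q = line v" "r = line w" "\<exists>w. dt v w dvd 1"
    using assms by (metis ptsE)
  have m: "dt u v \<in> \<mm>" "dt v w \<in> \<mm>" "dt u w dvd 1"
    using no assms(4) by (auto simp: uvw unit_iff)
  have "dt u w * v$1 \<in> \<mm>" "dt u w * v$2 \<in> \<mm>"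
    using m dt_plucker[of u w v] m_add[OF m_mult_right[OF m(2)] m_mult_right[OF m(1)]]
    by (simp_all add: vec2_eq_iff)
  then have "v$1 \<in> \<mm>" "v$2 \<in> \<mm>" using m(3) unit_mult by (metis unit_iff)+
  then show False using uvw(4) by (simp add: primitive_iff)
qed

text \<open>By cotransitivity a line fails to be transversal to at most one of four pairwise
  transversal lines, so three lines leave one of the four. The last two of the chosen lines have
  determinant -2, which is where 2 has to be a unit.\<close>

lemma common':
  assumes pts: "p \<in> pts" "q \<in> pts" "r \<in> pts"
  shows "\<exists>s\<in>pts. tv s p \<and> tv s q \<and> tv s (r::('a^2) set)"
proof -
  define s1 s2 s3 s4 :: "('a^2) set" where s: "s1 = p_inf" "s2 = p_zero"
    "s3 = line (axis 1 1 + axis 2 1)" "s4 = line (axis 1 1 - axis 2 1)"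
  have tvs: "tv s1 s2" "tv s1 s3" "tv s1 s4" "tv s2 s3" "tv s2 s4" "tv s3 s4"
    using two by (simp_all add: s dt_def unit_iff[symmetric])
  have "tv s3 s1" using tvs(2) by (rule tv_sym')
  then have sp: "s1 \<in> pts" "s2 \<in> pts" "s3 \<in> pts" "s4 \<in> pts"
    using p_inf_zero tvs tv_sym'[OF tvs(6)] unfolding s tv_line by (auto intro: line_in_pts)
  have one: "tv a x \<or> tv b x" if "a \<in> pts" "b \<in> pts" "x \<in> pts" "tv a b" for a b x :: "('a^2) set"
    using tv_cotrans'[OF that(1,3,2,4)] tv_sym' by blast
  have "\<And>x. x \<in> pts \<Longrightarrow> (tv s1 x \<or> tv s2 x) \<and> (tv s1 x \<or> tv s3 x) \<and> (tv s1 x \<or> tv s4 x)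
      \<and> (tv s2 x \<or> tv s3 x) \<and> (tv s2 x \<or> tv s4 x) \<and> (tv s3 x \<or> tv s4 x)"
    using one sp tvs by blast
  from this[OF pts(1)] this[OF pts(2)] this[OF pts(3)] show ?thesis using sp by metis
qed

sublocale general_position "pts :: ('a^2) set set" tv
  by unfold_locales (use tv_sym' tv_cotrans' common' p_inf_zero in blast)+

lemma stable_tuples: "stable_under {M. det M = 1} (tuples m)"
  unfolding stable_under_def
proof clarsimp
  fix M :: "'a^2^2" and t :: "('a^2) set list"
  assume M: "det M = 1" and t: "t \<in> tuples m"
  have "sorted_wrt tv t \<Longrightarrow> sorted_wrt tv (tuple_act M t)" for t
    unfolding tuple_act_def sorted_wrt_map
    by (erule sorted_wrt_mono_rel[rotated]) (rule SL2_tv[OF M])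
  then show "tuple_act M t \<in> tuples m"
    using t SL2_pts[OF M] by (auto simp: tuples_def) (auto simp: tuple_act_def)
qed

lemma transpose_vector: "transpose (vector [u, v]) = mat2 (u$1) (v$1) (u$2) (v$2)"
  for u v :: "'a^2"
  by (simp add: mat2_eq_iff transpose_def)

lemma invertible_iff: "invertible (M :: 'a^2^2) \<longleftrightarrow> det M dvd 1"
proof
  assume "invertible M"
  then show "det M dvd 1" unfolding invertible_def by (metis det_I det_mul dvd_triv_left)
next
  assume "det M dvd 1"
  then show "invertible M" using invertible_2 by (metis dvdE)
qed

lemma unimodular_iff: "unimodular (v :: 'a^2) \<longleftrightarrow> (\<exists>w. dt v w dvd 1)"
proof
  assume "unimodular v"
  then obtain M :: "'a^2^2" where M: "invertible M" "column 1 M = v" by (auto simp: unimodular_def)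
  then have "dt v (column 2 M) dvd 1" by (auto simp: invertible_iff dt_def det_2 column_def mult.commute)
  then show "\<exists>w. dt v w dvd 1" by blast
next
  assume "\<exists>w. dt v w dvd 1"
  then obtain w where "dt v w dvd 1" by blast
  then have "invertible (mat2 (v$1) (w$1) (v$2) (w$2))"
    by (simp add: invertible_iff cols_det)
  moreover have "column 1 (mat2 (v$1) (w$1) (v$2) (w$2)) = v" by (simp add: column_def vec2_eq_iff)
  ultimately show "unimodular v" unfolding unimodular_def by blast
qed

lemma config_tuples_eq: "(config_tuples 2 :: ('a^2) set list set) = tuples 3"
proof (intro equalityI subsetI)
  fix t :: "('a^2) set list" assume "t \<in> config_tuples 2"
  then obtain vs where vs: "t = map line vs" "length vs = 3" and uni: "\<forall>v\<in>set vs. unimodular v"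
    and inv: "\<And>i j. i < 3 \<Longrightarrow> j < 3 \<Longrightarrow> i \<noteq> j \<Longrightarrow> invertible (transpose (vector [vs ! i, vs ! j]) :: 'a^2^2)"
    by (auto simp: config_tuples_def eval_nat_numeral)
  obtain u v w where uvw: "vs = [u, v, w]" using vs(2) by (auto simp: length_eq_1_2_3)
  have *: "dt u v dvd 1" "dt u w dvd 1" "dt v w dvd 1"
    using inv[of 0 1] inv[of 0 2] inv[of 1 2]
    by (simp_all add: uvw transpose_vector invertible_iff cols_det)
  then show "t \<in> tuples 3"
    using line_in_pts[OF *(1)] line_in_pts(2)[OF *(2)] by (simp add: tuples_3 vs(1) uvw)
next
  fix t :: "('a^2) set list" assume "t \<in> tuples 3"
  then obtain p q r where t: "t = [p, q, r]" "p \<in> pts" "q \<in> pts" "r \<in> pts" "tv p q" "tv p r" "tv q r"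
    by (auto simp: tuples_3)
  obtain u v w where uvw: "p = line u" "q = line v" "r = line w"
    and prim: "\<exists>x. dt u x dvd 1" "\<exists>x. dt v x dvd 1" "\<exists>x. dt w x dvd 1"
    using t(2-4) by (metis ptsE)
  have dts: "dt u v dvd 1" "dt u w dvd 1" "dt v w dvd 1" "dt v u dvd 1" "dt w u dvd 1" "dt w v dvd 1"
    using t(5-7) tv_sym'[OF t(5)] tv_sym'[OF t(6)] tv_sym'[OF t(7)] by (simp_all add: uvw)
  have "invertible (transpose (vector [[u, v, w] ! i, [u, v, w] ! j]) :: 'a^2^2)"
    if "i < Suc 2" "j < Suc 2" "i \<noteq> j" for i j
  proof -
    have "i = 0 \<or> i = 1 \<or> i = 2" "j = 0 \<or> j = 1 \<or> j = 2" using that by auto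
    then show ?thesis using that(3) dts
      by (elim disjE) (simp_all add: transpose_vector invertible_iff cols_det)
  qed
  then show "t \<in> config_tuples 2"
    unfolding config_tuples_def using prim
    by (intro CollectI exI[of _ "[u, v, w]"]) (auto simp: t(1) uvw unimodular_iff)
qed

text \<open>The eigenvalues on the three lines have pairwise products 1, since determinants are
  preserved. So they coincide and square to 1, and the matrix is scalar because two of the lines
  already span.\<close>

lemma stab_triple:
  assumes t: "t \<in> tuples 3" and M: "det M = 1" and fix_t: "tuple_act M t = t"
  shows "M = mat 1 \<or> M = mat (- 1 :: 'a)"
proof -
  obtain p q r where pqr: "p \<in> pts" "q \<in> pts" "r \<in> pts" "tv p q" "tv p r" "tv q r" "t = [p, q, r]"
    using t unfolding tuples_3 by blast
  obtain u v w where uvw: "p = line u" "q = line v" "r = line w"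
    using pqr(1-3) by (elim ptsE)
  have dts: "dt u v dvd 1" "dt u w dvd 1" "dt v w dvd 1"
    using pqr(4-6) unfolding uvw tv_line .
  have fx: "(*v) M ` line u = line u" "(*v) M ` line v = line v" "(*v) M ` line w = line w"
    using fix_t by (simp_all add: pqr(7) uvw tuple_act_def)
  obtain a b c where ev: "M *v u = a *s u" "M *v v = b *s v" "M *v w = c *s w"
    using image_line_eigen[OF fx(1)] image_line_eigen[OF fx(2)] image_line_eigen[OF fx(3)]
    by (elim exE)
  have e: "dt (M *v x) (M *v y) = dt x y" for x y using M by (simp add: dt_mult)
  have p: "dt u v * (a * b) = dt u v * 1" "dt u w * (a * c) = dt u w * 1" "dt v w * (b * c) = dt v w * 1"
    using e[of u v] e[of u w] e[of v w] by (simp_all add: ev dt_scale ac_simps)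
  have abc: "a * b = 1" "a * c = 1" "b * c = 1"
    using unit_cancel[OF dts(1) p(1)] unit_cancel[OF dts(2) p(2)] unit_cancel[OF dts(3) p(3)] by auto
  have "a = a * (b * c)" using abc(3) by simp
  also have "\<dots> = b * (a * c)" by (simp only: ac_simps)
  finally have ab: "a = b" using abc(2) by simp
  then have "a * a = 1" using abc(1) by simp
  then have a: "a = 1 \<or> a = - 1" by (rule square_root_of_one)
  have "M *v x = a *s x" for x
  proof -
    have "dt u v *s (M *v x) = M *v (dt u v *s x)" by (simp add: matrix_vector_mult_smult)
    also have "\<dots> = a *s (dt u v *s x)"
      unfolding dt_plucker[of u v x]
      by (simp add: matrix_vector_right_distrib matrix_vector_mult_smult ev ab[symmetric]
          vector_add_ldistrib vector_smult_assoc mult.commute)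
    finally have "(dt u v *s (M *v x))$i = (a *s (dt u v *s x))$i" for i
      by (simp only:)
    then have "dt u v * (M *v x)$i = dt u v * (a * x$i)" for i
      by (simp only: vector_smult_component mult.left_commute)
    then have "(M *v x)$i = a * x$i" for i by (rule unit_cancel[OF dts(1)])
    then show ?thesis by (simp only: vec_eq_iff vector_smult_component simp_thms)
  qed
  from this[of "axis 1 1"] this[of "axis 2 1"] have "M = mat a"
    by (simp add: vec2_eq_iff mat2_eq_iff)
  then show ?thesis using a by auto
qed

end

section \<open>Cocycles of abelian groups\<close>

locale abelian_cocycle =
  fixes U :: "'a::comm_monoid_mult set" and N :: "('k \<Rightarrow>\<^sub>0 int) set" and f :: "'a \<Rightarrow> 'a \<Rightarrow> 'k \<Rightarrow>\<^sub>0 int"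
  assumes one: "1 \<in> U" and mult: "a \<in> U \<Longrightarrow> b \<in> U \<Longrightarrow> a * b \<in> U"
    and N: "add_subgroup N"
    and cocycle: "a \<in> U \<Longrightarrow> b \<in> U \<Longrightarrow> c \<in> U \<Longrightarrow> f b c - f (a * b) c + f a (b * c) - f a b \<in> N"
begin

text \<open>The commutator pairing of the central extension of \<open>U\<close> with cocycle
  \<open>f\<close> modulo \<open>N\<close>: it is bimultiplicative modulo \<open>N\<close> and
  measures the failure of symmetry.\<close>

definition comm :: "'a \<Rightarrow> 'a \<Rightarrow> 'k \<Rightarrow>\<^sub>0 int" where "comm a b = f a b - f b a"

lemma comm_anti: "comm b a = - comm a b" by (simp add: comm_def)

text \<open>The alternating sum of the cocycle relations over the three positions of
  \<open>x\<close> relative to \<open>a\<close>, \<open>b\<close>.\<close>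

lemma comm_mult:
  assumes "a \<in> U" "b \<in> U" "x \<in> U"
  shows "comm (a * b) x - (comm a x + comm b x) \<in> N"
proof -
  have "comm (a * b) x - (comm a x + comm b x) =
      - (f b x - f (a * b) x + f a (b * x) - f a b) + (f x b - f (a * x) b + f a (x * b) - f a x)
      - (f a b - f (x * a) b + f x (a * b) - f x a)"
    by (simp add: comm_def mult.commute[of x])
  then show ?thesis
    using add_subgroup_diff[OF N add_subgroup_add[OF N add_subgroup_minus[OF N cocycle[OF assms]]
      cocycle[OF assms(1,3,2)]] cocycle[OF assms(3,1,2)]] by (simp only:)
qed

lemma comm_one: "x \<in> U \<Longrightarrow> comm 1 x \<in> N"
  using add_subgroup_minus[OF N comm_mult[OF one one, of x]] by simp

lemma power_in: "a \<in> U \<Longrightarrow> a ^ n \<in> U"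
  by (induction n) (simp_all add: one mult)

lemma comm_power_left:
  assumes "a \<in> U" "x \<in> U"
  shows "comm (a ^ n) x - frag_cmul (int n) (comm a x) \<in> N"
proof (induction n)
  case (Suc n)
  have "comm (a ^ Suc n) x - frag_cmul (int (Suc n)) (comm a x) =
     (comm (a * a ^ n) x - (comm a x + comm (a ^ n) x)) + (comm (a ^ n) x - frag_cmul (int n) (comm a x))"
    by (simp add: frag_cmul_distrib)
  then show ?case
    using add_subgroup_add[OF N comm_mult[OF assms(1) power_in[OF assms(1)] assms(2)] Suc.IH] by (simp only:)
qed (simp add: comm_one assms)

lemma comm_power:
  assumes "a \<in> U" "x \<in> U"
  shows "comm (a ^ n) (x ^ m) - frag_cmul (int n * int m) (comm a x) \<in> N"
proof -
  have "comm (a ^ n) (x ^ m) - frag_cmul (int n * int m) (comm a x) =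
     (comm (a ^ n) (x ^ m) - frag_cmul (int n) (comm a (x ^ m)))
     - frag_cmul (int n) (comm (x ^ m) a - frag_cmul (int m) (comm x a))"
    unfolding comm_anti[of "x ^ m" a] comm_anti[of x a]
    by (rule poly_mapping_eqI) (simp add: lookup_minus lookup_add algebra_simps)
  then show ?thesis
    using add_subgroup_diff[OF N comm_power_left[OF assms(1) power_in[OF assms(2)]]
      add_subgroup_cmul[OF N comm_power_left[OF assms(2,1)]]] by (simp only:)
qed

text \<open>Inverting one argument of a bimultiplicative pairing changes the sign, inverting both
  restores it.\<close>

lemma comm_inverse:
  assumes "a \<in> U" "b \<in> U" "a' \<in> U" "b' \<in> U" "a * a' = 1" "b * b' = 1"
  shows "comm a' b' - comm a b \<in> N"
proof -
  have "comm a' b' - comm a b = - (comm (a * a') b' - (comm a b' + comm a' b')) + comm 1 b'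
      - (comm (b * b') a - (comm b a + comm b' a)) + comm 1 a"
    using assms(5,6) by (simp add: comm_anti[of b a] comm_anti[of b' a])
  then show ?thesis
    using add_subgroup_add[OF N add_subgroup_diff[OF N add_subgroup_add[OF N add_subgroup_minus[OF N
      comm_mult[OF assms(1,3,4)]] comm_one[OF assms(4)]] comm_mult[OF assms(2,4,1)]] comm_one[OF assms(1)]]
    by (simp only:)
qed

end

section \<open>The double complex of SL2 and the homology of its columns\<close>

context odd_local_ring
begin

abbreviation SL :: "('a^2^2) set" where "SL \<equiv> {M. det M = 1}"
abbreviation BB :: "('a^2^2) set" where "BB \<equiv> {M. det M = 1 \<and> M$2$1 = 0}"
abbreviation TT :: "('a^2^2) set" where "TT \<equiv> {M. det M = 1 \<and> M$2$1 = 0 \<and> M$1$2 = 0}"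

abbreviation ch :: "nat \<Rightarrow> nat \<Rightarrow> 'a chain set" where
  "ch n m \<equiv> chains SL (tuples m) n"

lemma SL2_subgroup_SL: "SL2_subgroup SL"
  by (simp add: SL2_subgroup_def det_adj2 det_mul)

lemma SL2_subgroup_BB: "SL2_subgroup BB"
  by (simp add: SL2_subgroup_def det_adj2 det_mul) (simp add: adj2_def)

lemma dh_chains:
  assumes "c \<in> ch n (Suc m)" "m \<le> 2"
  shows "dh c \<in> ch n m"
proof (rule chains_in_subgroup[OF assms(1) add_hom_dh add_subgroup_chains])
  fix gs t assume *: "length gs = n" "set gs \<subseteq> SL" "t \<in> tuples (Suc m)"
  then show "dh (frag_of (gs, t)) \<in> ch n m"
    by (cases "(gs, t)" rule: face_bd.cases)
       (auto simp: tuples_def intro!: chains_intros)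
qed

lemmas dv_ch = dv_chains[OF SL2_subgroup_SL stable_tuples]

definition tens :: "('a^2) set list \<Rightarrow> (('a^2^2) list \<Rightarrow>\<^sub>0 int) \<Rightarrow> 'a chain" where
  "tens t = frag_extend (\<lambda>gs. frag_of (gs, t))"

definition proj :: "'a chain \<Rightarrow> (('a^2^2) list \<Rightarrow>\<^sub>0 int)" where
  "proj = frag_extend (\<lambda>(gs, t). frag_of gs)"

lemma add_hom_tens: "add_hom (tens t)" and add_hom_proj: "add_hom proj"
  by (simp_all add: tens_def proj_def add_hom_frag_extend)

lemma tens_of [simp]: "tens t (frag_of gs) = frag_of (gs, t)"
  and proj_of [simp]: "proj (frag_of (gs, t)) = frag_of gs"
  by (simp_all add: tens_def proj_def)

lemma proj_tens [simp]: "proj (tens t c) = c"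
  by (rule add_hom_eqI[OF add_hom_comp[OF add_hom_proj add_hom_tens] add_hom_id, of _ UNIV]) simp_all

definition lists :: "('a^2^2) set \<Rightarrow> nat \<Rightarrow> ('a^2^2) list set" where
  "lists \<Gamma> n = {gs. length gs = n \<and> set gs \<subseteq> \<Gamma>}"

lemma tens_in: "c \<in> frags (lists \<Gamma> n) \<Longrightarrow> t \<in> S \<Longrightarrow> tens t c \<in> chains \<Gamma> S n"
  by (rule add_hom_in_subgroup[OF add_hom_tens add_subgroup_chains]) (auto simp: lists_def)

lemma proj_in: "c \<in> chains \<Gamma> S n \<Longrightarrow> proj c \<in> frags (lists \<Gamma> n)"
  by (rule chains_in_subgroup[OF _ add_hom_proj add_subgroup_frags]) (auto simp: lists_def)

lemma tens_proj: "c \<in> chains \<Gamma> {t} n \<Longrightarrow> tens t (proj c) = c"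
  by (rule chains_eqI[OF _ add_hom_comp[OF add_hom_tens add_hom_proj] add_hom_id]) auto

subsection \<open>The stabiliser of one point\<close>

definition w0 :: "'a^2^2" where "w0 = mat2 0 (- 1) 1 0"

lemma p_inf_neq_zero: "p_inf \<noteq> (p_zero :: ('a^2) set)"
proof
  assume "p_inf = (p_zero :: ('a^2) set)"
  then have "tv p_inf (p_inf :: ('a^2) set)" using p_inf_zero(3) by metis
  then show False using zero_neq_one' by simp
qed

lemma w0: "det w0 = 1" "(*v) w0 ` p_inf = p_zero"
proof -
  show "det w0 = 1" by (simp add: w0_def det_2)
  have "w0 *v axis 1 1 = axis 2 1" by (simp add: w0_def vec2_eq_iff)
  then show "(*v) w0 ` p_inf = p_zero" by (simp add: image_line)
qed

text \<open>
  The value at \<open>p_inf\<close> makes the retraction of \<open>S0\<close> the identity on the Borel subgroup; the value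
  at \<open>p_zero\<close> makes it the inversion on the diagonal subgroup.
\<close>

definition sec0 :: "('a^2) set list \<Rightarrow> 'a^2^2" where
  "sec0 t = (if hd t = p_inf then mat 1 else if hd t = p_zero then w0
     else SOME M. det M = 1 \<and> (*v) M ` p_inf = hd t)"

lemma sec0: "p \<in> pts \<Longrightarrow> det (sec0 [p]) = 1 \<and> (*v) (sec0 [p]) ` p_inf = p"
proof -
  assume "p \<in> pts"
  then have "\<exists>M. det M = 1 \<and> (*v) M ` p_inf = p" by (elim pts_orbit) blast
  from someI_ex[OF this] show ?thesis
    using w0 by (auto simp: sec0_def image_line)
qed

sublocale S0: orbit_section SL "tuples (Suc 0)" "\<lambda>_. [p_inf]" sec0
proof
  show "SL2_subgroup SL" by (rule SL2_subgroup_SL)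
  show "stable_under SL (tuples (Suc 0))" by (rule stable_tuples)
qed (use sec0 p_inf_zero in \<open>auto simp: tuples_1 tuple_act_def\<close>)

lemma tuple_act_inf_iff: "M \<in> SL \<and> tuple_act M [p_inf] = [p_inf] \<longleftrightarrow> M \<in> BB"
  using stab_inf[of M] by (auto simp: tuple_act_def simp del: image_ident)

lemma S0_r_in: "c \<in> ch n (Suc 0) \<Longrightarrow> S0.r c \<in> chains BB {[p_inf]} n"
  unfolding chains_def[of BB]
  by (rule frags_mono[rotated], rule S0.r_in) (use tuple_act_inf_iff in auto)

lemma S0_r_BB:
  assumes "c \<in> chains BB {[p_inf]} n"
  shows "S0.r c = c"
proof (rule chains_eqI[OF assms S0.add_hom_r add_hom_id])
  fix gs t assume *: "length gs = n" "set gs \<subseteq> BB" "t \<in> {[p_inf :: ('a^2) set]}"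
  have "foldr tuple_act gs [p_inf] = [p_inf] \<and> S0.r_list gs [p_inf] = gs" if "set gs \<subseteq> BB" for gs
    using that
  proof (induction gs)
    case (Cons a gs)
    then have "tuple_act a [p_inf] = [p_inf]" using tuple_act_inf_iff[of a] by auto
    moreover have "adj2 (mat 1) = (mat 1 :: 'a^2^2)" by (simp add: mat2_eq_iff adj2_def)
    moreover have "sec0 [p_inf] = mat 1" by (simp add: sec0_def)
    ultimately show ?case using Cons by (simp add: S0.h_def)
  qed simp
  then show "S0.r (frag_of (gs, t)) = frag_of (gs, t)" using * by (simp add: S0.r_of)
qed

lemma H2_point_surj:
  assumes "c \<in> ch 2 (Suc 0)" "dv c = 0"
  obtains b y where "b \<in> frags (lists BB 2)" "y \<in> ch 3 (Suc 0)" "c = tens [p_inf] b + dv y"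
proof -
  obtain y where y: "y \<in> ch 3 (Suc 0)" "S0.r c - c = dv y"
    using S0.cycle_homologous[OF assms(1) _ assms(2)] by (auto simp: eval_nat_numeral)
  have r: "S0.r c \<in> chains BB {[p_inf]} 2" by (rule S0_r_in[OF assms(1)])
  show ?thesis
    by (rule that[OF proj_in[OF r] chains_minus[OF y(1)]])
       (use y(2) in \<open>simp add: tens_proj[OF r]\<close>, simp add: y(2)[symmetric])
qed

text \<open>The retraction is the identity on chains of the Borel subgroup, so it carries a bounding
  chain into that subgroup.\<close>

lemma H2_point_inj:
  assumes "c \<in> chains BB {[p_inf]} n" "c \<in> dv ` ch (Suc n) (Suc 0)"
  shows "c \<in> dv ` chains BB {[p_inf]} (Suc n)"
proof -
  obtain y where y: "y \<in> ch (Suc n) (Suc 0)" "c = dv y" using assms(2) by blast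
  have "c = dv (S0.r y)" using S0_r_BB[OF assms(1)] S0.dv_r[OF y(1)] y(2) by simp
  then show ?thesis using S0_r_in[OF y(1)] by blast
qed

subsection \<open>The stabiliser of a pair of points\<close>

abbreviation s01 :: "('a^2) set list" where "s01 \<equiv> [p_inf, p_zero]"

definition sec1 :: "('a^2) set list \<Rightarrow> 'a^2^2" where
  "sec1 t = (SOME M. det M = 1 \<and> tuple_act M s01 = t)"

lemma sec1: "t \<in> tuples 2 \<Longrightarrow> det (sec1 t) = 1 \<and> tuple_act (sec1 t) s01 = t"
proof -
  assume "t \<in> tuples 2"
  then obtain p q where "tv p q" "t = [p, q]" by (auto simp: tuples_2)
  then have "\<exists>M. det M = 1 \<and> tuple_act M s01 = t"
    by (auto simp: tuple_act_def elim: tv_orbit)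
  from someI_ex[OF this] show ?thesis by (simp add: sec1_def)
qed

sublocale S1: orbit_section SL "tuples 2" "\<lambda>_. s01" sec1
proof
  show "SL2_subgroup SL" by (rule SL2_subgroup_SL)
  show "stable_under SL (tuples 2)" by (rule stable_tuples)
qed (use sec1 p_inf_zero in \<open>auto simp: tuples_2\<close>)

lemma tuple_act_s01_TT: "M \<in> SL \<and> tuple_act M s01 = s01 \<Longrightarrow> M \<in> TT"
  using stab_inf[of M] stab_zero[of M] by (auto simp: tuple_act_def)

lemma TT_fix_zero: "M \<in> TT \<Longrightarrow> (*v) M ` p_zero = p_zero"
proof -
  assume M: "M \<in> TT"
  then have z: "M$2$1 = 0" "M$1$2 = 0" and "det M = 1" by auto
  then have "M$2$2 * M$1$1 = 1" by (simp add: det_2 mult.commute)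
  then have "M$2$2 dvd 1" by (metis dvd_triv_left)
  moreover have "M *v axis 2 1 = M$2$2 *s axis 2 1" using M by (simp add: vec2_eq_iff)
  ultimately show ?thesis by (simp add: image_line line_smult_unit)
qed

lemma TT_fix_inf: "M \<in> TT \<Longrightarrow> (*v) M ` p_inf = p_inf"
  using stab_inf(2)[of M] by auto

lemma S1_r_in: "c \<in> ch n 2 \<Longrightarrow> S1.r c \<in> chains TT {s01} n"
  unfolding chains_def[of TT]
  by (rule frags_mono[rotated], rule S1.r_in) (use tuple_act_s01_TT in auto)

abbreviation U :: "'a set" where "U \<equiv> {a. a dvd 1}"

definition uinv :: "'a \<Rightarrow> 'a" where "uinv a = (SOME b. a * b = 1)"

lemma uinv: "a dvd 1 \<Longrightarrow> a * uinv a = 1"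
  unfolding uinv_def by (rule someI_ex) (metis dvdE)

lemma uinv_unique: "a * b = 1 \<Longrightarrow> uinv a = b"
  using uinv[of a] unit_cancel[of a "uinv a" b] by (metis dvd_triv_left)

lemma uinv_unit: "a dvd 1 \<Longrightarrow> uinv a dvd 1"
  using uinv by (metis dvd_triv_right)

lemma uinv_mult: "a dvd 1 \<Longrightarrow> b dvd 1 \<Longrightarrow> uinv (a * b) = uinv a * uinv b"
proof (rule uinv_unique)
  assume "a dvd 1" "b dvd 1"
  have "a * b * (uinv a * uinv b) = (a * uinv a) * (b * uinv b)" by (simp only: ac_simps)
  then show "a * b * (uinv a * uinv b) = 1" using uinv[OF \<open>a dvd 1\<close>] uinv[OF \<open>b dvd 1\<close>] by simp
qed

lemma uinv_uinv: "a dvd 1 \<Longrightarrow> uinv (uinv a) = a"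
  by (rule uinv_unique) (use uinv in \<open>simp add: mult.commute\<close>)

definition dg :: "'a \<Rightarrow> 'a^2^2" where "dg a = mat2 a 0 0 (uinv a)"

lemma dg_nth [simp]: "dg a $ 1 $ 1 = a" "dg a $ 1 $ 2 = 0" "dg a $ 2 $ 1 = 0" "dg a $ 2 $ 2 = uinv a"
  by (simp_all add: dg_def)

lemma dg_TT: "a dvd 1 \<Longrightarrow> dg a \<in> TT"
  by (simp add: det_2 uinv)

lemma TT_dg: "M \<in> TT \<Longrightarrow> M$1$1 dvd 1 \<and> M = dg (M$1$1)"
proof -
  assume "M \<in> TT"
  then have z: "M$2$1 = 0" "M$1$2 = 0" and "det M = 1" by auto
  then have "M$1$1 * M$2$2 = 1" by (simp add: det_2)
  then show ?thesis using uinv_unique[of "M$1$1" "M$2$2"] z by (simp add: mat2_eq_iff) (metis dvd_triv_left)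
qed

lemma dg_mult: "a dvd 1 \<Longrightarrow> b dvd 1 \<Longrightarrow> dg (a * b) = dg a ** dg b"
  by (simp add: mat2_eq_iff uinv_mult)

text \<open>The upper left entry is multiplicative on upper triangular matrices. On
  \<open>TT\<close> this identifies bar chains with those of the unit group; on \<open>BB\<close> it
  is the projection to the diagonal part used in \<open>H1_pair\<close>.\<close>

definition entries2 :: "'a chain \<Rightarrow> ('a \<times> 'a) \<Rightarrow>\<^sub>0 int" where
  "entries2 = frag_extend (\<lambda>(gs, t). frag_of ((gs ! 0)$1$1, (gs ! 1)$1$1))"

definition dg2 :: "('a^2) set list \<Rightarrow> (('a \<times> 'a) \<Rightarrow>\<^sub>0 int) \<Rightarrow> 'a chain" where
  "dg2 s = frag_extend (\<lambda>(a, b). frag_of ([dg a, dg b], s))"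

abbreviation is_cycle2 :: "(('a \<times> 'a) \<Rightarrow>\<^sub>0 int) \<Rightarrow> bool" where
  "is_cycle2 c \<equiv> frag_extend (\<lambda>(a, b). frag_of b - frag_of (a * b) + frag_of a) c = 0"

lemma add_hom_dg2: "add_hom (dg2 s)" and add_hom_entries2: "add_hom entries2"
  by (simp_all add: dg2_def entries2_def add_hom_frag_extend)

lemma dg2_of [simp]: "dg2 s (frag_of (a, b)) = frag_of ([dg a, dg b], s)"
  by (simp add: dg2_def)

lemma dg2_in: "c \<in> frags (U \<times> U) \<Longrightarrow> t \<in> S \<Longrightarrow> dg2 t c \<in> chains TT S 2"
  by (rule add_hom_in_subgroup[OF add_hom_dg2 add_subgroup_chains]) (use dg_TT in auto)

lemma diagonal_chain2:
  assumes "c \<in> chains TT {s} 2"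
  obtains c' where "c' \<in> frags (U \<times> U)" "c = dg2 s c'" "dv c = 0 \<Longrightarrow> is_cycle2 c'"
proof
  show "entries2 c \<in> frags (U \<times> U)"
    by (rule chains_in_subgroup[OF assms add_hom_entries2 add_subgroup_frags])
       (use TT_dg in \<open>auto simp: entries2_def length_eq_1_2_3\<close>)
  show "c = dg2 s (entries2 c)"
    by (rule chains_eqI[OF assms add_hom_id add_hom_comp[OF add_hom_dg2 add_hom_entries2]])
       (use TT_dg in \<open>auto simp: entries2_def length_eq_1_2_3\<close>)
  let ?e = "frag_extend (\<lambda>(gs, t). frag_of ((gs ! 0)$1$1)) :: 'a chain \<Rightarrow> 'a \<Rightarrow>\<^sub>0 int"
  have "frag_extend (\<lambda>(a, b). frag_of b - frag_of (a * b) + frag_of a) (entries2 c) = ?e (dv c)"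
    by (rule chains_eqI[OF assms add_hom_comp[OF add_hom_frag_extend add_hom_entries2]
          add_hom_comp[OF add_hom_frag_extend add_hom_dv]])
       (auto simp: entries2_def length_eq_1_2_3 frag_extend_add frag_extend_diff)
  then show "dv c = 0 \<Longrightarrow> is_cycle2 (entries2 c)" by simp
qed

text \<open>The tautological cocycle. Statements about commutators and symmetry of this one cocycle
  become statements about the image of the second homology of \<open>TT\<close> in that of
  \<open>BB\<close>.\<close>

lemma diagonal_cocycle:
  "abelian_cocycle U (dv ` chains BB {[p_inf]} 3) (\<lambda>a b. frag_of ([dg a, dg b], [p_inf]))"
proof
  show "add_subgroup (dv ` chains BB {[p_inf]} 3)" by (rule dv_boundary_subgroup)
  fix a b c assume *: "a \<in> U" "b \<in> U" "c \<in> U"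
  then have TT: "dg a \<in> TT" "dg b \<in> TT" "dg c \<in> TT" using dg_TT by auto
  have c: "tuple_act (dg c) [p_inf] = [p_inf]" using TT_fix_inf[OF TT(3)] by (simp add: tuple_act_def)
  show "frag_of ([dg b, dg c], [p_inf]) - frag_of ([dg (a * b), dg c], [p_inf])
      + frag_of ([dg a, dg (b * c)], [p_inf]) - frag_of ([dg a, dg b], [p_inf])
      \<in> dv ` chains BB {[p_inf]} 3"
    by (rule image_eqI[of _ _ "frag_of ([dg a, dg b, dg c], [p_inf])"])
       (use * TT c dg_mult in auto)
qed (auto simp: unit_mult)

sublocale T: abelian_cocycle U "dv ` chains BB {[p_inf]} 3" "\<lambda>a b. frag_of ([dg a, dg b], [p_inf])"
  by (rule diagonal_cocycle)

end

lemma add_hom_sum: "add_hom f \<Longrightarrow> f (sum g A) = (\<Sum>x\<in>A. f (g x))"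
  by (induction A rule: infinite_finite_induct) (simp_all add: add_hom_zero add_hom_add)

lemma sum_const_frag: "finite A \<Longrightarrow> (\<Sum>x\<in>A. c) = frag_cmul (int (card A)) c"
  by (induction A rule: finite_induct) (simp_all add: frag_cmul_distrib)

context odd_local_ring
begin

abbreviation boundaries_B :: "'a chain set" where "boundaries_B \<equiv> dv ` chains BB {[p_inf]} 3"

lemma boundaries_B_subgroup: "add_subgroup boundaries_B"
  by (rule dv_boundary_subgroup)

lemma boundaries_B_mono: "c \<in> boundaries_B \<Longrightarrow> c \<in> dv ` ch 3 (Suc 0)"
  using p_inf_zero by (auto simp: tuples_1 intro!: imageI elim: chains_mono[rotated 2])

definition dg2_inv :: "(('a \<times> 'a) \<Rightarrow>\<^sub>0 int) \<Rightarrow> 'a chain" where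
  "dg2_inv = frag_extend (\<lambda>(a, b). frag_of ([dg (uinv a), dg (uinv b)], [p_inf]))"

lemma add_hom_dg2_inv: "add_hom dg2_inv"
  by (simp add: dg2_inv_def add_hom_frag_extend)

text \<open>
  Inversion acts trivially on the second homology of an abelian group: the difference of the
  tautological cocycle and its pullback along inversion is a symmetric cocycle.
\<close>

lemma inversion_homologous:
  assumes c: "c \<in> frags (U \<times> U)" "is_cycle2 c"
  shows "dg2_inv c - dg2 [p_inf] c \<in> boundaries_B"
proof -
  let ?f = "\<lambda>a b. frag_of ([dg a, dg b], [p_inf]) :: 'a chain"
  let ?g = "\<lambda>a b. ?f (uinv a) (uinv b) - ?f a b"
  interpret symmetric_cocycle U boundaries_B ?g
  proof
    fix a b assume ab: "a \<in> U" "b \<in> U"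
    then have i: "uinv a \<in> U" "uinv b \<in> U" "a * uinv a = 1" "b * uinv b = 1" using uinv uinv_unit by auto
    have "?g a b - ?g b a = T.comm (uinv a) (uinv b) - T.comm a b"
      by (simp add: T.comm_def)
    then show "?g a b - ?g b a \<in> boundaries_B" using T.comm_inverse[OF ab i] by (simp only:)
  next
    fix a b c assume abc: "a \<in> U" "b \<in> U" "c \<in> U"
    then have i: "uinv a \<in> U" "uinv b \<in> U" "uinv c \<in> U" using uinv_unit by auto
    have "?g b c - ?g (a * b) c + ?g a (b * c) - ?g a b =
      (?f (uinv b) (uinv c) - ?f (uinv a * uinv b) (uinv c) + ?f (uinv a) (uinv b * uinv c) - ?f (uinv a) (uinv b))
      - (?f b c - ?f (a * b) c + ?f a (b * c) - ?f a b)"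
      using abc by (simp add: uinv_mult)
    then show "?g b c - ?g (a * b) c + ?g a (b * c) - ?g a b \<in> boundaries_B"
      using add_subgroup_diff[OF boundaries_B_subgroup T.cocycle[OF i] T.cocycle[OF abc]] by (simp only:)
  qed (auto simp: unit_mult boundaries_B_subgroup)
  show ?thesis
    by (rule vanishes_on_cycles[OF c add_hom_sub[OF add_hom_dg2_inv add_hom_dg2]])
       (simp add: dg2_inv_def)
qed

lemma dg2_zero_cycle:
  assumes c: "c \<in> frags (U \<times> U)" "is_cycle2 c"
  shows "dv (dg2 [p_zero] c) = 0"
proof -
  let ?e = "frag_extend (\<lambda>a. frag_of ([dg a], [p_zero])) :: _ \<Rightarrow> 'a chain"
  have "dv (dg2 [p_zero] c) = ?e (frag_extend (\<lambda>(a, b). frag_of b - frag_of (a * b) + frag_of a) c)"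
  proof (rule add_hom_eqI[OF add_hom_comp[OF add_hom_dv add_hom_dg2]
        add_hom_comp[OF add_hom_frag_extend add_hom_frag_extend] c(1)], clarify)
    fix a b :: 'a assume ab: "a dvd 1" "b dvd 1"
    have "tuple_act (dg b) [p_zero] = [p_zero]"
      using TT_fix_zero[OF dg_TT[OF ab(2)]] by (simp add: tuple_act_def)
    then show "dv (dg2 [p_zero] (frag_of (a, b))) =
        ?e (frag_extend (\<lambda>(a, b). frag_of b - frag_of (a * b) + frag_of a) (frag_of (a, b)))"
      using ab by (simp add: frag_extend_add frag_extend_diff dg_mult)
  qed
  then show ?thesis using c(2) by simp
qed

lemma S0_h_dg: "a dvd 1 \<Longrightarrow> S0.h (dg a) [p_zero] = dg (uinv a)" "a dvd 1 \<Longrightarrow> S0.h (dg a) [p_inf] = dg a"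
proof -
  assume a: "a dvd 1"
  have act: "tuple_act (dg a) [p_zero] = [p_zero]" "tuple_act (dg a) [p_inf] = [p_inf]"
    using TT_fix_zero[OF dg_TT[OF a]] TT_fix_inf[OF dg_TT[OF a]] by (simp_all add: tuple_act_def)
  have s: "sec0 [p_zero] = w0" "sec0 [p_inf] = mat 1"
    using p_inf_neq_zero by (simp_all add: sec0_def)
  show "S0.h (dg a) [p_zero] = dg (uinv a)"
    unfolding S0.h_def act s by (simp add: mat2_eq_iff adj2_def w0_def uinv_uinv[OF a])
  show "S0.h (dg a) [p_inf] = dg a"
    unfolding S0.h_def act s by (simp add: mat2_eq_iff adj2_def)
qed

lemma S0_r_dg2_zero:
  assumes "c \<in> frags (U \<times> U)"
  shows "S0.r (dg2 [p_zero] c) = dg2_inv c"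
proof (rule add_hom_eqI[OF add_hom_comp[OF S0.add_hom_r add_hom_dg2] add_hom_dg2_inv assms], clarify)
  fix a b :: 'a assume ab: "a dvd 1" "b dvd 1"
  have act: "tuple_act (dg a) [p_zero] = [p_zero]" if "a dvd 1" for a
    using TT_fix_zero[OF dg_TT[OF that]] by (simp add: tuple_act_def)
  show "S0.r (dg2 [p_zero] (frag_of (a, b))) = dg2_inv (frag_of (a, b))"
    using ab by (simp add: S0.r_of dg2_inv_def act S0_h_dg)
qed

text \<open>After retraction to \<open>s01\<close>, the two faces carry the same diagonal chain over
  \<open>p_zero\<close> and over \<open>p_inf\<close>. Moving the first to \<open>p_inf\<close>
  conjugates it by \<open>w0\<close>, that is, inverts it.\<close>

lemma H2_pair_to_point:
  assumes x: "x \<in> ch 2 2" "dv x = 0"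
  shows "dh x \<in> dv ` ch 3 (Suc 0)"
proof -
  let ?N = "dv ` ch 3 (Suc 0)"
  have N: "add_subgroup ?N" by (rule dv_boundary_subgroup)
  obtain k where k: "k \<in> ch 3 2" "S1.r x - x = dv k"
    using S1.cycle_homologous[OF x(1) _ x(2)] by (auto simp: eval_nat_numeral)
  have r: "S1.r x \<in> chains TT {s01} 2" by (rule S1_r_in[OF x(1)])
  have "dv (S1.r x) = 0" using S1.dv_r[OF x(1)] x(2) by (simp add: S1.rk_simps)
  moreover obtain c where "c \<in> frags (U \<times> U)" "S1.r x = dg2 s01 c" "dv (S1.r x) = 0 \<longrightarrow> is_cycle2 c"
    by (rule diagonal_chain2[OF r]) blast
  ultimately have c: "c \<in> frags (U \<times> U)" "S1.r x = dg2 s01 c" "is_cycle2 c" by blast+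
  let ?y = "dg2 [p_zero] c"
  have dh: "dh (dg2 s01 c) = ?y - dg2 [p_inf] c"
    by (rule add_hom_eqI[OF add_hom_comp[OF add_hom_dh add_hom_dg2] add_hom_sub[OF add_hom_dg2 add_hom_dg2], of _ UNIV])
       auto
  have y: "?y \<in> ch 2 (Suc 0)"
    by (rule chains_mono[OF _ _ dg2_in[OF c(1), of _ "{[p_zero]}"]]) (auto simp: tuples_1 p_inf_zero)
  have 1: "S0.r ?y - ?y \<in> ?N"
    using S0.cycle_homologous[OF y _ dg2_zero_cycle[OF c(1,3)]] by (simp add: eval_nat_numeral)
  have 2: "S0.r ?y - dg2 [p_inf] c \<in> ?N"
    unfolding S0_r_dg2_zero[OF c(1)] by (rule boundaries_B_mono[OF inversion_homologous[OF c(1,3)]])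
  have "dh k \<in> ch 3 (Suc 0)" by (rule dh_chains) (use k in \<open>simp_all add: numeral_2_eq_2\<close>)
  then have 3: "dv (dh k) \<in> ?N" by blast
  have "x = S1.r x - dv k" using k(2) by (simp add: algebra_simps)
  then have "dh x = (S0.r ?y - dg2 [p_inf] c) - (S0.r ?y - ?y) - dv (dh k)"
    by (simp add: c(2) dh dv_dh)
  then show ?thesis using add_subgroup_diff[OF N add_subgroup_diff[OF N 2 1] 3] by (simp only:)
qed

subsection \<open>Torsion in the second homology of the Borel subgroup\<close>

text \<open>Writing \<open>a\<close> as \<open>\<gamma> ^ i\<close> times an element of
  \<open>1 + \<mm>\<close>, the exponent kills the second factor.\<close>

lemma residue_power:
  assumes "a dvd 1"
  shows "\<exists>i. a ^ card \<mm> = \<gamma> ^ (i * card \<mm>)"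
proof -
  obtain i where i: "a - \<gamma> ^ i \<in> \<mm>" using gen(2) assms by (auto simp: unit_iff)
  have g: "\<gamma> ^ i dvd 1" using gen(1) unit_power by (simp add: unit_iff[symmetric])
  define x where "x = uinv (\<gamma> ^ i) * (a - \<gamma> ^ i)"
  have "\<gamma> ^ i * (1 + x) = \<gamma> ^ i + (\<gamma> ^ i * uinv (\<gamma> ^ i)) * (a - \<gamma> ^ i)"
    by (simp add: x_def algebra_simps)
  then have "a = \<gamma> ^ i * (1 + x)" by (simp add: uinv[OF g])
  moreover have "x \<in> \<mm>" unfolding x_def by (rule m_mult[OF i])
  ultimately have "a ^ card \<mm> = (\<gamma> ^ i) ^ card \<mm>"
    using one_plus_m_power[of x] by (simp add: power_mult_distrib)
  then show ?thesis by (auto simp: power_mult)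
qed

text \<open>
  The powers \<open>a ^ card \<mm>\<close> of units form a cyclic group, on which every alternating bilinear map
  vanishes.
\<close>

lemma diagonal_cycle_killed:
  assumes c: "c \<in> frags (U \<times> U)" "is_cycle2 c"
  shows "frag_cmul (int (card \<mm>) * int (card \<mm>)) (dg2 [p_inf] c) \<in> boundaries_B"
proof -
  let ?n = "card \<mm>"
  let ?f = "\<lambda>a b. frag_of ([dg a, dg b], [p_inf]) :: 'a chain"
  \<comment> \<open>One factor \<open>card \<mm>\<close> for each argument of the commutator
    pairing.\<close>
  let ?g = "\<lambda>a b. frag_cmul (int ?n * int ?n) (?f a b)"
  interpret symmetric_cocycle U boundaries_B ?g
  proof
    fix a b assume ab: "a \<in> U" "b \<in> U"
    obtain i where i: "a ^ ?n = \<gamma> ^ (i * ?n)" using residue_power ab(1) by blast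
    obtain j where j: "b ^ ?n = \<gamma> ^ (j * ?n)" using residue_power ab(2) by blast
    have g: "\<gamma> \<in> U" using gen(1) by (simp add: unit_iff)
    have "T.comm \<gamma> \<gamma> = 0" by (simp add: T.comm_def)
    then have 1: "T.comm (a ^ ?n) (b ^ ?n) \<in> boundaries_B"
      using T.comm_power[OF g g, of "i * ?n" "j * ?n"] by (simp add: i j)
    have "?g a b - ?g b a = T.comm (a ^ ?n) (b ^ ?n)
        - (T.comm (a ^ ?n) (b ^ ?n) - frag_cmul (int ?n * int ?n) (T.comm a b))"
      unfolding T.comm_def by (rule poly_mapping_eqI) (simp add: lookup_minus lookup_add algebra_simps)
    then show "?g a b - ?g b a \<in> boundaries_B"
      using add_subgroup_diff[OF boundaries_B_subgroup 1 T.comm_power[OF ab, of ?n ?n]] by (simp only:)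
  next
    fix a b c assume abc: "a \<in> U" "b \<in> U" "c \<in> U"
    have "?g b c - ?g (a * b) c + ?g a (b * c) - ?g a b =
      frag_cmul (int ?n * int ?n) (?f b c - ?f (a * b) c + ?f a (b * c) - ?f a b)"
      by (rule poly_mapping_eqI) (simp add: lookup_minus lookup_add algebra_simps)
    then show "?g b c - ?g (a * b) c + ?g a (b * c) - ?g a b \<in> boundaries_B"
      using add_subgroup_cmul[OF boundaries_B_subgroup T.cocycle[OF abc]] by (simp only:)
  qed (auto simp: unit_mult boundaries_B_subgroup)
  have "add_hom (\<lambda>c. frag_cmul (int ?n * int ?n) (dg2 [p_inf] c))"
    by (simp add: add_hom_def add_hom_add[OF add_hom_dg2] frag_cmul_distrib2)
  from vanishes_on_cycles[OF c this] show ?thesis by simp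
qed

text \<open>As \<open>x\<close> varies these lines form the orbit of \<open>p_zero\<close> under
  \<open>BB\<close>, a copy of the cosets of \<open>TT\<close>.\<close>

definition aff :: "'a \<Rightarrow> ('a^2) set" where "aff x = line (x *s axis 1 1 + axis 2 1)"

lemma aff_inj: "aff x = aff y \<Longrightarrow> x = y"
proof -
  assume "aff x = aff y"
  then have "y *s axis 1 1 + axis 2 1 \<in> line (x *s axis 1 1 + axis 2 1)"
    unfolding aff_def using line_refl by blast
  then obtain c where "y *s axis 1 1 + axis 2 1 = c *s (x *s axis 1 1 + axis 2 1 :: 'a^2)"
    by (auto simp: mem_line_iff)
  then show "x = y" by (simp add: vec2_eq_iff)
qed

lemma aff_zero: "aff 0 = p_zero" by (simp add: aff_def)

lemma aff_act:
  assumes "M \<in> BB"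
  shows "(*v) M ` aff x = aff (M$1$1 * (M$1$1 * x + M$1$2))"
proof -
  have z: "M$2$1 = 0" "det M = 1" using assms by auto
  then have d: "M$1$1 * M$2$2 = 1" by (simp add: det_2)
  have "M$1$1 *s (M *v (x *s axis 1 1 + axis 2 1)) = (M$1$1 * (M$1$1 * x + M$1$2)) *s axis 1 1 + axis 2 1"
    using z d by (simp add: vec2_eq_iff)
  then show ?thesis
    using line_smult[OF d, of "M *v (x *s axis 1 1 + axis 2 1)"] by (simp add: aff_def image_line)
qed

lemma aff_act_bij: "M \<in> BB \<Longrightarrow> bij (\<lambda>x. M$1$1 * (M$1$1 * x + M$1$2))"
proof -
  assume "M \<in> BB"
  then have "M$2$1 = 0" "det M = 1" by auto
  then have "M$1$1 * M$2$2 = 1" by (simp add: det_2)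
  then have u: "M$1$1 dvd 1" by (metis dvd_triv_left)
  have "inj (\<lambda>x. M$1$1 * (M$1$1 * x + M$1$2))"
    using unit_cancel[OF u] by (auto intro!: injI) (metis add_right_cancel)
  then show ?thesis by (simp add: bij_def finite_UNIV_inj_surj)
qed

definition sec_aff :: "('a^2) set list \<Rightarrow> 'a^2^2" where
  "sec_aff t = mat2 1 (THE x. t = [aff x]) 0 1"

lemma sec_aff_aff: "sec_aff [aff x] = mat2 1 x 0 1"
proof -
  have "(THE y. [aff x] = [aff y]) = x" by (rule the_equality) (auto dest: aff_inj)
  then show ?thesis by (simp add: sec_aff_def)
qed

sublocale S_aff: orbit_section BB "range (\<lambda>x. [aff x])" "\<lambda>_. [p_zero]" sec_aff
proof
  show "SL2_subgroup BB" by (rule SL2_subgroup_BB)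
  show "stable_under BB (range (\<lambda>x. [aff x]))"
    unfolding stable_under_def using aff_act by (auto simp: tuple_act_def)
  fix t :: "('a^2) set list" assume "t \<in> range (\<lambda>x. [aff x])"
  then obtain x where t: "t = [aff x]" by blast
  show "[p_zero] \<in> range (\<lambda>x. [aff x])" by (metis aff_zero rangeI)
  have BB: "mat2 1 x 0 1 \<in> BB" by (simp add: det_2)
  then show "sec_aff t \<in> BB" by (simp only: t sec_aff_aff)
  show "tuple_act (sec_aff t) [p_zero] = t"
    using aff_act[OF BB, of 0] by (simp add: t sec_aff_aff tuple_act_def aff_zero)
qed simp

lemma S_aff_r_in: "c \<in> chains BB (range (\<lambda>x. [aff x])) n \<Longrightarrow> S_aff.r c \<in> chains TT {[p_zero]} n"
proof -
  assume c: "c \<in> chains BB (range (\<lambda>x. [aff x])) n"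
  have "M \<in> TT" if "M \<in> BB" "tuple_act M [p_zero] = [p_zero]" for M
    using that stab_zero[of M] by (auto simp: tuple_act_def)
  then show ?thesis
    unfolding chains_def[of TT] by (intro frags_mono[OF _ S_aff.r_in[OF c]]) auto
qed

text \<open>Corestriction: the affine point is forgotten and the chain is read in the Borel
  subgroup.\<close>

definition to_inf :: "'a chain \<Rightarrow> 'a chain" where "to_inf c = tens [p_inf] (proj c)"

lemma add_hom_to_inf: "add_hom to_inf"
  unfolding to_inf_def by (rule add_hom_comp[OF add_hom_tens add_hom_proj])

lemma to_inf_in: "c \<in> chains BB S n \<Longrightarrow> to_inf c \<in> chains BB {[p_inf]} n"
  unfolding to_inf_def by (intro tens_in[of _ BB] proj_in) simp_all

lemma dv_to_inf:
  assumes "c \<in> chains BB S n"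
  shows "dv (to_inf c) = to_inf (dv c)"
proof (rule chains_eqI[OF assms add_hom_comp[OF add_hom_dv add_hom_to_inf] add_hom_comp[OF add_hom_to_inf add_hom_dv]])
  fix gs t assume *: "length gs = n" "set gs \<subseteq> BB" "t \<in> S"
  have "tuple_act M [p_inf] = [p_inf]" if "M \<in> set gs" for M
    using tuple_act_inf_iff[of M] that *(2) by auto
  then show "dv (to_inf (frag_of (gs, t))) = to_inf (dv (frag_of (gs, t)))"
    by (cases "(gs, t)" rule: bar_bd.cases)
       (auto simp: to_inf_def add_hom_add[OF add_hom_tens] add_hom_diff[OF add_hom_tens]
         add_hom_add[OF add_hom_proj] add_hom_diff[OF add_hom_proj]
         add_hom_zero[OF add_hom_tens] add_hom_zero[OF add_hom_proj])
qed

text \<open>Transfer to the diagonal subgroup, whose index \<open>card UNIV\<close> is odd.\<close>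

lemma H2_Borel_torsion:
  assumes b: "b \<in> frags (lists BB 2)" and cyc: "dv (tens [p_inf] b) = 0"
  shows "frag_cmul (int (card \<mm>) * int (card \<mm>) * int (card (UNIV :: 'a set))) (tens [p_inf] b) \<in> boundaries_B"
proof -
  let ?S = "range (\<lambda>x. [aff x]) :: ('a^2) set list set"
  define e where "e = (frag_extend (\<lambda>gs. frag_of [gs ! 1] - frag_of [gs ! 0 ** gs ! 1] + frag_of [gs ! 0])
    :: (('a^2^2) list \<Rightarrow>\<^sub>0 int) \<Rightarrow> _)"
  have add_e: "add_hom e" by (simp add: e_def add_hom_frag_extend)
  have pb: "proj (dv (tens t b)) = e b" for t
    by (rule add_hom_eqI[OF add_hom_comp[OF add_hom_proj add_hom_comp[OF add_hom_dv add_hom_tens]] add_e b])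
       (auto simp: e_def lists_def length_eq_1_2_3 add_hom_diff[OF add_hom_proj] add_hom_add[OF add_hom_proj])
  have e0: "e b = 0" using pb[of "[p_inf]"] cyc by (simp add: add_hom_zero[OF add_hom_proj])
  \<comment> \<open>The transfer of \<open>b\<close>, a sum over all cosets of \<open>TT\<close>
    represented by affine points.\<close>
  define w where "w = (\<Sum>x\<in>UNIV. tens [aff x] b)"
  have w: "w \<in> chains BB ?S 2"
    unfolding w_def chains_def
    by (intro frags_sum) (use tens_in[OF b, of _ ?S] in \<open>auto simp: chains_def\<close>)
  have "dv w = (\<Sum>x\<in>UNIV. dv (tens [aff x] b))" by (simp add: w_def add_hom_sum[OF add_hom_dv])
  also have "\<dots> = (\<Sum>x\<in>UNIV. tens [aff x] (e b))"
  proof (rule add_hom_eqI[OF _ _ b])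
    fix gs assume "gs \<in> lists BB 2"
    then obtain g h where gs: "gs = [g, h]" and gh: "g \<in> BB" "h \<in> BB" by (auto simp: lists_def length_eq_1_2_3)
    \<comment> \<open>The element \<open>h\<close> permutes the affine points, so the twist in the
      last face disappears in the sum.\<close>
    have "(\<Sum>x\<in>UNIV. frag_of ([g], tuple_act h [aff x])) = (\<Sum>x\<in>UNIV. frag_of ([g], [aff x]) :: 'a chain)"
      using sum.reindex_bij_betw[OF aff_act_bij[OF gh(2)], of "\<lambda>x. frag_of ([g], [aff x]) :: 'a chain"]
      by (simp add: tuple_act_def aff_act[OF gh(2)])
    then show "(\<Sum>x\<in>UNIV. dv (tens [aff x] (frag_of gs))) = (\<Sum>x\<in>UNIV. tens [aff x] (e (frag_of gs)))"
      by (simp add: gs e_def sum.distrib sum_subtractf add_hom_add[OF add_hom_tens] add_hom_diff[OF add_hom_tens])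
  qed (simp_all add: add_hom_def sum.distrib add_hom_add[OF add_hom_tens] add_hom_add[OF add_e])
  also have "\<dots> = 0" by (simp add: e0 add_hom_zero[OF add_hom_tens])
  finally have dw: "dv w = 0" .
  obtain k where k: "k \<in> chains BB ?S 3" "S_aff.r w - w = dv k"
    using S_aff.cycle_homologous[OF w _ dw] by (auto simp: eval_nat_numeral)
  have r: "S_aff.r w \<in> chains TT {[p_zero]} 2" by (rule S_aff_r_in[OF w])
  have "dv (S_aff.r w) = 0" using S_aff.dv_r[OF w] dw by (simp add: S_aff.rk_simps)
  moreover obtain c where "c \<in> frags (U \<times> U)" "S_aff.r w = dg2 [p_zero] c" "dv (S_aff.r w) = 0 \<longrightarrow> is_cycle2 c"
    by (rule diagonal_chain2[OF r]) blast
  ultimately have c: "c \<in> frags (U \<times> U)" "S_aff.r w = dg2 [p_zero] c" "is_cycle2 c" by blast+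
  have pc: "to_inf (dg2 [p_zero] c) = dg2 [p_inf] c"
    by (rule add_hom_eqI[OF add_hom_comp[OF add_hom_to_inf add_hom_dg2] add_hom_dg2, of _ UNIV])
       (auto simp: to_inf_def)
  \<comment> \<open>Transfer followed by corestriction is multiplication by the index.\<close>
  have pw: "to_inf w = frag_cmul (int (card (UNIV :: 'a set))) (tens [p_inf] b)"
    by (simp add: w_def add_hom_sum[OF add_hom_to_inf]) (simp add: to_inf_def sum_const_frag)
  have "to_inf (S_aff.r w) - to_inf w = dv (to_inf k)"
    using k by (simp add: add_hom_diff[OF add_hom_to_inf, symmetric] dv_to_inf)
  then have "frag_cmul (int (card (UNIV :: 'a set))) (tens [p_inf] b) = dg2 [p_inf] c - dv (to_inf k)"
    by (simp add: c(2) pc pw algebra_simps)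
  then have "frag_cmul (int (card \<mm>) * int (card \<mm>) * int (card (UNIV :: 'a set))) (tens [p_inf] b) =
      frag_cmul (int (card \<mm>) * int (card \<mm>)) (dg2 [p_inf] c - dv (to_inf k))"
    by (simp flip: frag_cmul_cmul)
  also have "\<dots> = frag_cmul (int (card \<mm>) * int (card \<mm>)) (dg2 [p_inf] c)
      - frag_cmul (int (card \<mm>) * int (card \<mm>)) (dv (to_inf k))"
    by (rule poly_mapping_eqI) (simp add: lookup_minus algebra_simps)
  also have "\<dots> \<in> boundaries_B"
    by (rule add_subgroup_diff[OF boundaries_B_subgroup diagonal_cycle_killed[OF c(1,3)]
          add_subgroup_cmul[OF boundaries_B_subgroup imageI[OF to_inf_in[OF k(1)]]]])
  finally show ?thesis .
qed

text \<open>The double and an odd multiple of the cycle are boundaries, hence so is the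
  cycle.\<close>

lemma H2_Borel_no_2_torsion:
  assumes b: "b \<in> frags (lists BB 2)" and 2: "frag_cmul 2 (tens [p_inf] b) \<in> boundaries_B"
  shows "tens [p_inf] b \<in> boundaries_B"
proof -
  let ?b = "tens [p_inf] b" and ?L = "int (card \<mm>) * int (card \<mm>) * int (card (UNIV :: 'a set))"
  obtain x where "frag_cmul 2 ?b = dv x" using 2 by blast
  then have "dv (frag_cmul 2 ?b) = 0" by (simp only: dv_dv)
  then have "dv ?b = 0" by simp
  then have L: "frag_cmul ?L ?b \<in> boundaries_B" by (rule H2_Borel_torsion[OF b])
  have "odd ?L" using odd_card_m odd_card_UNIV by simp
  then obtain n where n: "?L = 2 * n + 1" by (metis oddE)
  have e: "?b = frag_cmul ?L ?b - frag_cmul n (frag_cmul 2 ?b)"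
    unfolding n by (rule poly_mapping_eqI) (simp add: lookup_minus algebra_simps)
  have "frag_cmul ?L ?b - frag_cmul n (frag_cmul 2 ?b) \<in> boundaries_B"
    by (rule add_subgroup_diff[OF boundaries_B_subgroup L add_subgroup_cmul[OF boundaries_B_subgroup 2]])
  then show ?thesis by (subst e)
qed

end

context odd_local_ring
begin

subsection \<open>First homology of the stabilisers\<close>

text \<open>First homology of the unit group is the unit group itself: multiplying out the letters
  gives the same product before and after fusing pairs, so a boundary cannot relate different
  units.\<close>

lemma unit_frag_difference:
  assumes c: "c \<in> frags (U \<times> U)"
    and eq: "frag_extend (\<lambda>(a, b). frag_of b - frag_of (a * b) + frag_of a) c = frag_of x - frag_of y"
  shows "x = y"
proof -
  obtain I J where IJ: "set I \<subseteq> U \<times> U" "set J \<subseteq> U \<times> U"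
    and c_eq: "c = sum_list (map frag_of I) - sum_list (map frag_of J)"
    using frag_as_lists[OF c] .
  let ?p = "\<lambda>I. concat (map (\<lambda>(a, b). [a, b]) I)" and ?q = "\<lambda>I. map (\<lambda>(a, b). a * b) I :: 'a list"
  have bd: "frag_extend (\<lambda>(a, b). frag_of b - frag_of (a * b) + frag_of a) (sum_list (map frag_of I)) =
      sum_list (map frag_of (?p I)) - sum_list (map frag_of (?q I))" for I :: "('a \<times> 'a) list"
    by (induction I) (auto simp: frag_extend_add)
  have "sum_list (map frag_of (y # ?p I @ ?q J)) = sum_list (map frag_of (x # ?p J @ ?q I))"
    using eq unfolding c_eq frag_extend_diff bd by (simp add: algebra_simps)
  then have "mset (y # ?p I @ ?q J) = mset (x # ?p J @ ?q I)" by (rule sum_list_frag_of_eq)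
  then have "prod_list (y # ?p I @ ?q J) = prod_list (x # ?p J @ ?q I)" by (metis prod_mset_prod_list)
  moreover have pq: "prod_list (?p I) = prod_list (?q I)" for I :: "('a \<times> 'a) list"
    by (induction I) (auto simp: mult.assoc)
  ultimately have "(prod_list (?q I) * prod_list (?q J)) * y = (prod_list (?q I) * prod_list (?q J)) * x"
    by (simp add: pq mult.commute mult.left_commute)
  moreover have "prod_list (?q I) dvd 1" if "set I \<subseteq> U \<times> U" for I
    using that by (induction I) (auto simp: unit_mult)
  ultimately show "x = y" using IJ unit_mult unit_cancel by metis
qed

lemma tuple_act_s01: "a dvd 1 \<Longrightarrow> tuple_act (dg a) s01 = s01"
  using TT_fix_zero[OF dg_TT] TT_fix_inf[OF dg_TT] by (simp add: tuple_act_def)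

lemma dg_one: "dg 1 = mat 1"
  using uinv_unique[of 1 1] by (simp add: mat2_eq_iff)

lemma dg_minus_one: "dg (- 1) = mat (- 1)"
  using uinv_unique[of "- 1" "- 1"] by (simp add: mat2_eq_iff)

lemma s01_in: "s01 \<in> tuples 2"
  using p_inf_zero by (auto simp: tuples_2)

lemma dg_SL: "a dvd 1 \<Longrightarrow> dg a \<in> SL"
  using dg_TT by blast

text \<open>The boundary of \<open>[dg a, dg b]\<close> merges two symbols into one, so every chain
  is homologous to a single symbol.\<close>

lemma diagonal_chain1:
  assumes "c \<in> chains TT {s01} 1"
  shows "\<exists>a\<in>U. c - frag_of ([dg a], s01) \<in> dv ` ch 2 2"
proof (rule chains_induct[OF assms])
  let ?N = "dv ` ch 2 2"
  have N: "add_subgroup ?N" by (rule dv_boundary_subgroup)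
  have rel: "frag_of ([dg b], s01) - frag_of ([dg (a * b)], s01) + frag_of ([dg a], s01) \<in> ?N"
    if "a dvd 1" "b dvd 1" for a b
    by (rule image_eqI[of _ _ "frag_of ([dg a, dg b], s01)"])
       (use that dg_SL s01_in in \<open>simp_all add: tuple_act_s01 dg_mult\<close>)
  show "add_subgroup {x. \<exists>a\<in>U. x - frag_of ([dg a], s01) \<in> ?N}"
    unfolding add_subgroup_def
  proof (intro conjI ballI)
    show "0 \<in> {x. \<exists>a\<in>U. x - frag_of ([dg a], s01) \<in> ?N}"
      using add_subgroup_minus[OF N rel[of 1 1]] by (intro CollectI bexI[of _ 1]) simp_all
    fix x y assume "x \<in> {x. \<exists>a\<in>U. x - frag_of ([dg a], s01) \<in> ?N}"
      "y \<in> {x. \<exists>a\<in>U. x - frag_of ([dg a], s01) \<in> ?N}"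
    then obtain a b where ab: "a dvd 1" "b dvd 1"
      and x: "x - frag_of ([dg a], s01) \<in> ?N" and y: "y - frag_of ([dg b], s01) \<in> ?N" by blast
    have "a * uinv b * b = a * (b * uinv b)" by (simp only: ac_simps)
    then have "a * uinv b * b = a" using uinv[OF ab(2)] by simp
    then have r: "frag_of ([dg b], s01) - frag_of ([dg a], s01) + frag_of ([dg (a * uinv b)], s01) \<in> ?N"
      using rel[of "a * uinv b" b] ab uinv_unit by (simp add: unit_mult)
    have "x - y - frag_of ([dg (a * uinv b)], s01) = (x - frag_of ([dg a], s01)) - (y - frag_of ([dg b], s01))
      - (frag_of ([dg b], s01) - frag_of ([dg a], s01) + frag_of ([dg (a * uinv b)], s01))" by simp
    then have "x - y - frag_of ([dg (a * uinv b)], s01) \<in> ?N"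
      using add_subgroup_diff[OF N add_subgroup_diff[OF N x y] r] by (simp only:)
    then show "x - y \<in> {x. \<exists>a\<in>U. x - frag_of ([dg a], s01) \<in> ?N}"
      using ab uinv_unit by (intro CollectI bexI[of _ "a * uinv b"]) (simp_all add: unit_mult)
  qed
  fix gs t assume *: "length gs = 1" "set gs \<subseteq> TT" "t \<in> {s01}"
  then obtain M where M: "gs = [M]" "M \<in> TT" by (auto simp: length_eq_1_2_3)
  then show "\<exists>a\<in>U. frag_of (gs, t) - frag_of ([dg a], s01) \<in> ?N"
    using TT_dg[OF M(2)] * add_subgroup_zero[OF N] by (intro bexI[of _ "M$1$1"]) auto
qed

lemma tuple_act_minus_one: "t \<in> tuples m \<Longrightarrow> tuple_act (mat (- 1)) t = t"
proof -
  assume "t \<in> tuples m"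
  then have "set t \<subseteq> pts" by (simp add: tuples_def)
  moreover have "(*v) (mat (- 1)) ` p = p" if p: "p \<in> pts" for p :: "('a^2) set"
  proof -
    obtain v w where v: "p = line v" "dt v w dvd 1" using p by (rule ptsE)
    have "mat (- 1) *v v = (- 1) *s v" by (simp add: vec2_eq_iff)
    then show ?thesis using line_smult_unit[of "- 1" v] by (simp add: v image_line)
  qed
  ultimately show "tuple_act (mat (- 1)) t = t"
    unfolding tuple_act_def by (intro map_idI) blast
qed

lemma minus_one_SL: "mat (- 1) \<in> SL"
  by (simp add: det_2)

text \<open>Since -1 is central, the two orders of multiplying it with the element moving
  \<open>s01\<close> to \<open>s\<close> give the same product, and the difference of the two
  squares transports \<open>[mat (- 1)]\<close> from \<open>s01\<close> to \<open>s\<close>.\<close>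

lemma central_pair:
  assumes "s \<in> tuples 2"
  shows "frag_of ([mat (- 1)], s) - frag_of ([mat (- 1)], s01) \<in> dv ` ch 2 2"
proof -
  let ?z = "mat (- 1) :: 'a^2^2" and ?g = "sec1 s"
  have g: "det ?g = 1" "tuple_act ?g s01 = s" using sec1[OF assms] by auto
  have "?z ** ?g = ?g ** ?z" by (simp add: mat2_eq_iff)
  then have "frag_of ([?z], s) - frag_of ([?z], s01) =
      dv (frag_of ([?z, ?g], s01) - frag_of ([?g, ?z], s01))"
    using g tuple_act_minus_one[OF s01_in] by simp
  then show ?thesis
    by (rule image_eqI) (use g minus_one_SL s01_in in \<open>auto intro!: chains_diff\<close>)
qed

text \<open>On first homology the map from pairs to points sends the unit \<open>a\<close> to its
  inverse squared. Its kernel is therefore spanned by -1, which comes from triples because -1 fixes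
  all lines.\<close>

lemma H1_pair:
  assumes x: "x \<in> ch 1 2" "dv x = 0" and dhx: "dh x \<in> dv ` ch 2 (Suc 0)"
  obtains u v where "u \<in> ch 1 3" "v \<in> ch 2 2" "dv u = 0" "x = dh u + dv v"
proof -
  let ?N = "dv ` ch 2 2"
  have N: "add_subgroup ?N" by (rule dv_boundary_subgroup)
  have 1: "S1.r x - x \<in> ?N"
    using S1.cycle_homologous[OF x(1) _ x(2)] by (simp add: numeral_2_eq_2)
  obtain a where a: "a dvd 1" and 2: "S1.r x - frag_of ([dg a], s01) \<in> ?N"
    using diagonal_chain1[OF S1_r_in[OF x(1)]] by blast
  let ?\<tau> = "frag_of ([dg a], s01)"
  have "x - ?\<tau> = (S1.r x - ?\<tau>) - (S1.r x - x)" by simp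
  then have 3: "x - ?\<tau> \<in> ?N" using add_subgroup_diff[OF N 2 1] by (simp only:)
  then obtain y where y: "y \<in> ch 2 2" "x - ?\<tau> = dv y" by blast
  obtain y' where y': "y' \<in> ch 2 (Suc 0)" "dh x = dv y'" using dhx by blast
  have "x = ?\<tau> + dv y" using y(2) by (simp add: algebra_simps)
  then have "dh ?\<tau> = dh x - dh (dv y)" by simp
  also have "\<dots> = dv (y' - dh y)" by (simp add: y'(2) dv_dh)
  finally have "dh ?\<tau> = dv (y' - dh y)" .
  moreover have Y: "y' - dh y \<in> ch 2 (Suc 0)"
    by (intro chains_diff y'(1) dh_chains) (use y in \<open>simp_all add: numeral_2_eq_2\<close>)
  ultimately have "S0.r (dh ?\<tau>) = dv (S0.r (y' - dh y))" using S0.dv_r[OF Y] by simp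
  moreover have "S0.r (dh ?\<tau>) = frag_of ([dg (uinv a)], [p_inf]) - frag_of ([dg a], [p_inf])"
    by (simp add: S0.rk_simps S0.r_of S0_h_dg[OF a])
  moreover define e where "e = (frag_extend (\<lambda>(gs, t). frag_of ((gs ! 0)$1$1)) :: 'a chain \<Rightarrow> 'a \<Rightarrow>\<^sub>0 int)"
  ultimately have e: "e (dv (S0.r (y' - dh y))) = frag_of (uinv a) - frag_of a"
    by (simp add: frag_extend_diff)
  have r: "S0.r (y' - dh y) \<in> chains BB {[p_inf]} 2" by (rule S0_r_in[OF Y])
  \<comment> \<open>The upper left entry is a character of \<open>BB\<close>, so the bounding
    relation over \<open>p_inf\<close> can be read in the unit group, where it forces
    \<open>uinv a = a\<close>.\<close>
  have BB: "M$1$1 dvd 1 \<and> (M ** M')$1$1 = M$1$1 * M'$1$1" if "M \<in> BB" "M' \<in> BB" for M M' :: "'a^2^2"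
  proof -
    have "M$2$1 = 0" "M'$2$1 = 0" "det M = 1" using that by auto
    then have "M$1$1 * M$2$2 = 1" by (simp add: det_2)
    then have "M$1$1 dvd 1" by (metis dvd_triv_left)
    then show ?thesis using \<open>M'$2$1 = 0\<close> by simp
  qed
  have e2: "entries2 (S0.r (y' - dh y)) \<in> frags (U \<times> U)"
    by (rule chains_in_subgroup[OF r add_hom_entries2 add_subgroup_frags])
       (use BB in \<open>auto simp: entries2_def length_eq_1_2_3\<close>)
  have "frag_extend (\<lambda>(a, b). frag_of b - frag_of (a * b) + frag_of a) (entries2 (S0.r (y' - dh y)))
      = e (dv (S0.r (y' - dh y)))"
    by (rule chains_eqI[OF r add_hom_comp[OF add_hom_frag_extend add_hom_entries2]
          add_hom_comp[OF _ add_hom_dv]])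
       (use BB in \<open>auto simp: e_def entries2_def length_eq_1_2_3 frag_extend_add frag_extend_diff add_hom_frag_extend\<close>)
  then have "uinv a = a" unfolding e by (rule unit_frag_difference[OF e2])
  then have "a * a = 1" using uinv[OF a] by simp
  then have "a = 1 \<or> a = - 1" by (rule square_root_of_one)
  then show ?thesis
  proof
    assume a1: "a = 1"
    have "?\<tau> = dv (frag_of ([mat 1, mat 1], s01))" by (simp add: a1 dg_one tuple_act_id)
    moreover have "frag_of ([mat 1, mat 1], s01) \<in> ch 2 2" using s01_in by simp
    ultimately show ?thesis
      using that[of 0 "y + frag_of ([mat 1, mat 1], s01)"] y \<open>x = ?\<tau> + dv y\<close> by (simp add: chains_add)
  next
    assume a1: "a = - 1"
    \<comment> \<open>Any triple extending \<open>s01\<close> works: its three faces carry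
      homologous copies of \<open>[mat (- 1)]\<close> with signs plus, minus, plus, which leaves one
      copy.\<close>
    let ?z = "mat (- 1) :: 'a^2^2" and ?p = "aff 1"
    have tv: "tv p_inf ?p" "tv p_zero ?p" by (simp_all add: aff_def dt_def)
    have p: "?p \<in> pts" using tv(1) unfolding aff_def tv_line by (rule line_in_pts(2))
    let ?t = "[p_inf, p_zero, ?p]"
    have t: "?t \<in> tuples 3" using p_inf_zero tv p by (simp add: tuples_3)
    have u: "frag_of ([?z], ?t) \<in> ch 1 3" using t minus_one_SL by simp
    have du: "dv (frag_of ([?z], ?t)) = 0" using tuple_act_minus_one[OF t] by simp
    have s: "[p_zero, ?p] \<in> tuples 2" "[p_inf, ?p] \<in> tuples 2"
      using p_inf_zero tv p by (auto simp: tuples_2)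
    have "x - dh (frag_of ([?z], ?t)) = (x - ?\<tau>) - (frag_of ([?z], [p_zero, ?p]) - frag_of ([?z], s01))
        + (frag_of ([?z], [p_inf, ?p]) - frag_of ([?z], s01))"
      by (simp add: a1 dg_minus_one)
    then have "x - dh (frag_of ([?z], ?t)) \<in> ?N"
      using add_subgroup_add[OF N add_subgroup_diff[OF N 3 central_pair[OF s(1)]] central_pair[OF s(2)]]
      by (simp only:)
    then obtain v where v: "v \<in> ch 2 2" "x - dh (frag_of ([?z], ?t)) = dv v" by blast
    then have "x = dh (frag_of ([?z], ?t)) + dv v" by (metis add.commute diff_add_cancel)
    then show ?thesis by (rule that[OF u v(1) du])
  qed
qed

text \<open>Chosen from the class alone, which makes the section \<open>S2\<close> constant on
  orbits.\<close>

definition rep_class :: "'a set \<Rightarrow> ('a^2) set list" where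
  "rep_class C = (SOME t. t \<in> tuples 3 \<and> triple_class t = C)"

definition sec2 :: "('a^2) set list \<Rightarrow> 'a^2^2" where
  "sec2 t = (SOME M. det M = 1 \<and> tuple_act M (rep_class (triple_class t)) = t)"

lemma SL_carrier: "carrier (SL2 TYPE('a)) = SL"
  by (simp add: SL2_def)

lemma triple_class_iff:
  fixes t :: "('a^2) set list"
  assumes "t \<in> tuples 3" "t' \<in> tuples 3"
  shows "triple_class t = triple_class t' \<longleftrightarrow> (\<exists>M\<in>SL. t' = tuple_act M t)"
  using triple_class_eq_iff[of t t'] assms by (simp add: config_tuples_eq SL_carrier)

lemma rep_class:
  assumes "t \<in> tuples 3"
  shows "rep_class (triple_class t) \<in> tuples 3" "triple_class (rep_class (triple_class t)) = triple_class t"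
proof -
  have "\<exists>t'. t' \<in> tuples 3 \<and> triple_class t' = triple_class t" using assms by blast
  from someI_ex[OF this] show "rep_class (triple_class t) \<in> tuples 3"
    "triple_class (rep_class (triple_class t)) = triple_class t"
    by (simp_all add: rep_class_def)
qed

lemma sec2:
  assumes "t \<in> tuples 3"
  shows "det (sec2 t) = 1 \<and> tuple_act (sec2 t) (rep_class (triple_class t)) = t"
proof -
  have "\<exists>M. det M = 1 \<and> tuple_act M (rep_class (triple_class t)) = t"
    using triple_class_iff[OF rep_class(1)[OF assms] assms] rep_class(2)[OF assms] by auto
  from someI_ex[OF this] show ?thesis by (simp add: sec2_def)
qed

sublocale S2: orbit_section SL "tuples 3" "\<lambda>t. rep_class (triple_class t)" sec2
proof
  show "SL2_subgroup SL" by (rule SL2_subgroup_SL)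
  show "stable_under SL (tuples 3)" by (rule stable_tuples)
  fix t :: "('a^2) set list" and M :: "'a^2^2" assume t: "t \<in> tuples 3"
  show "rep_class (triple_class t) \<in> tuples 3" by (rule rep_class[OF t])
  show "sec2 t \<in> SL" "tuple_act (sec2 t) (rep_class (triple_class t)) = t" using sec2[OF t] by auto
  assume "M \<in> SL"
  then show "rep_class (triple_class (tuple_act M t)) = rep_class (triple_class t)"
    using triple_class_tuple_act[of M t] by (simp add: SL_carrier)
qed

text \<open>The retraction lands in the groups of order two generated by -1, where the boundary of
  \<open>[M, M]\<close> is twice \<open>[M]\<close> minus the symbol of the identity, itself a
  boundary.\<close>

lemma H1_triple:
  assumes y: "y \<in> ch 1 3" "dv y = 0"
  shows "frag_cmul 2 y \<in> dv ` ch 2 3"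
proof -
  let ?N = "dv ` ch 2 3"
  have N: "add_subgroup ?N" by (rule dv_boundary_subgroup)
  have 1: "S2.r y - y \<in> ?N"
    using S2.cycle_homologous[OF y(1) _ y(2)] by (simp add: numeral_2_eq_2)
  have "frag_cmul 2 (S2.r y) \<in> ?N"
  proof (rule add_hom_in_subgroup[OF _ N S2.r_in[OF y(1)]])
    show "add_hom (frag_cmul 2)" by (simp add: add_hom_def frag_cmul_distrib2)
    fix x assume "x \<in> {(gs, rep_class (triple_class t)) |gs t. length gs = 1 \<and>
      set gs \<subseteq> {M \<in> SL. tuple_act M (rep_class (triple_class t)) = rep_class (triple_class t)} \<and> t \<in> tuples 3}"
    then obtain M t where x: "x = ([M], t)" and t: "t \<in> tuples 3" and M: "det M = 1" "tuple_act M t = t"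
      using rep_class(1) by (auto simp: length_eq_1_2_3)
    have one: "frag_of ([mat 1], t) \<in> ?N"
      by (rule image_eqI[of _ _ "frag_of ([mat 1, mat 1], t)"]) (use t in \<open>simp_all add: tuple_act_id\<close>)
    from stab_triple[OF t M] show "frag_cmul 2 (frag_of x) \<in> ?N"
    proof
      assume "M = mat 1"
      then show ?thesis using add_subgroup_cmul[OF N one] by (simp add: x)
    next
      assume Mz: "M = mat (- 1)"
      have zz: "mat (- 1) ** mat (- 1) = (mat 1 :: 'a^2^2)" by (simp add: mat2_eq_iff)
      have 2: "dv (frag_of ([M, M], t)) \<in> ?N" using t M by (intro imageI) simp
      have "frag_cmul 2 (frag_of x) = dv (frag_of ([M, M], t)) + frag_of ([mat 1], t)"
        using M(2) zz by (simp add: x Mz frag_cmul_distrib[of 1 1, simplified])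
      then show ?thesis using add_subgroup_add[OF N 2 one] by (simp only:)
    qed
  qed
  then have "frag_cmul 2 (S2.r y) - frag_cmul 2 (S2.r y - y) \<in> ?N"
    using add_subgroup_diff[OF N _ add_subgroup_cmul[OF N 1]] by blast
  moreover have "frag_cmul 2 (S2.r y) - frag_cmul 2 (S2.r y - y) = frag_cmul 2 y"
    by (rule poly_mapping_eqI) (simp add: lookup_minus algebra_simps)
  ultimately show ?thesis by simp
qed

section \<open>The map to the group ring on chains of triples\<close>

definition class_sum :: "'a chain \<Rightarrow> 'a set \<Rightarrow>\<^sub>0 int" where
  "class_sum = frag_extend (\<lambda>(gs, t). frag_of (triple_class t))"

lemma add_hom_class_sum: "add_hom class_sum"
  by (simp add: class_sum_def add_hom_frag_extend)

lemma class_sum_of [simp]: "class_sum (frag_of (gs, t)) = frag_of (triple_class t)"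
  by (simp add: class_sum_def)

text \<open>The class sum determines the retraction to orbit representatives, so a chain with class
  sum zero retracts to zero and the homotopy \<open>S2.k\<close> fills it.\<close>

lemma class_sum_kernel:
  assumes z: "z \<in> ch 0 3" "class_sum z = 0"
  obtains y where "y \<in> ch 1 3" "z = dv y"
proof -
  have "S2.r z = frag_extend (\<lambda>C. frag_of ([], rep_class C)) (class_sum z)"
    by (rule chains_eqI[OF z(1) S2.add_hom_r add_hom_comp[OF add_hom_frag_extend add_hom_class_sum]])
       (simp add: S2.r_of)
  then have "S2.r z = 0" using z(2) by simp
  then have "z = dv (- S2.k z)" using S2.homotopy_0[OF z(1)] by simp (metis minus_minus)
  moreover have "- S2.k z \<in> ch 1 3" using S2.k_in[OF z(1)] by (simp add: chains_minus)
  ultimately show ?thesis using that by blast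
qed

lemma class_sum_dv:
  assumes "y \<in> ch 1 3"
  shows "class_sum (dv y) = 0"
proof (rule chains_eqI[OF assms add_hom_comp[OF add_hom_class_sum add_hom_dv] add_hom_zero_map])
  fix gs and t :: "('a^2) set list" assume "length gs = 1" "set gs \<subseteq> SL" "t \<in> tuples 3"
  then show "class_sum (dv (frag_of (gs, t))) = 0"
    using triple_class_tuple_act[of "gs ! 0" t]
    by (auto simp: length_eq_1_2_3 SL_carrier add_hom_diff[OF add_hom_class_sum])
qed

end

text \<open>Since \<open>frag_extend\<close> takes values in free abelian groups, the integers are
  realised as the one on a single generator and read off as its coefficient.\<close>

definition zsum :: "('b \<Rightarrow> int) \<Rightarrow> ('b \<Rightarrow>\<^sub>0 int) \<Rightarrow> int" where
  "zsum f c = poly_mapping.lookup (frag_extend (\<lambda>x. frag_cmul (f x) (frag_of ())) c) ()"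

lemma add_hom_zsum: "add_hom (zsum f)"
  by (simp add: add_hom_def zsum_def frag_extend_add lookup_add)

lemma zsum_of [simp]: "zsum f (frag_of x) = f x"
  by (simp add: zsum_def)

lemmas zsum_simps [simp] = add_hom_zero[OF add_hom_zsum] add_hom_add[OF add_hom_zsum]
  add_hom_diff[OF add_hom_zsum] add_hom_minus[OF add_hom_zsum]

lemma even_subgroup: "add_subgroup {n::int. even n}"
  by (simp add: add_subgroup_def)

context odd_local_ring
begin

subsection \<open>The class of a triple\<close>

definition square_units :: "'a set" where "square_units = {b. sq b}"
definition nonsquare_units :: "'a set" where "nonsquare_units = {b. b dvd 1 \<and> \<not> sq b}"

text \<open>For the standard triple of \<open>a\<close> the three determinants are 1,
  \<open>a\<close> and -1, whose negated product is \<open>a\<close>. Every vector enters two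
  determinants, so rescaling generators changes the product by a square.\<close>

lemma triple_class_dt:
  assumes t: "[line u, line v, line w] \<in> tuples 3"
  shows "triple_class [line u, line v, line w] =
    (if sq (- (dt u v * dt u w * dt v w)) then square_units else nonsquare_units)"
proof -
  let ?t = "[line u, line v, line w]" and ?R = "type_ring TYPE('a)"
  have unit: "b \<in> Units ?R \<longleftrightarrow> b dvd 1" for b
    unfolding Units_type_ring_iff dvd_def by metis
  obtain a M where a: "a dvd 1" and M: "det M = 1" "?t = tuple_act M (std_triple a)"
    using config_tuple_orbit[of ?t] t by (auto simp: config_tuples_eq SL_carrier unit)
  let ?e1 = "M *v axis 1 1" and ?e2 = "M *v axis 2 1" and ?e3 = "M *v (axis 1 1 + a *s axis 2 1)"
  have l: "line ?e1 = line u" "line ?e2 = line v" "line ?e3 = line w"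
    using M(2) by (simp_all add: tuple_act_std_triple)
  have d: "dt ?e1 ?e2 = 1" "dt ?e1 ?e3 = a" "dt ?e2 ?e3 = - 1"
    by (simp_all add: dt_mult M(1)) (simp add: dt_def)
  obtain c1 where c1: "c1 dvd 1" "u = c1 *s ?e1" by (rule line_eq_scale[OF l(1), of ?e2]) (simp_all only: d, simp)
  obtain c2 where c2: "c2 dvd 1" "v = c2 *s ?e2" by (rule line_eq_scale[OF l(2), of ?e3]) (simp_all only: d, simp)
  have "dt ?e3 ?e1 dvd 1" using a d(2) dt_unit_sym[of ?e3 ?e1] by simp
  then obtain c3 where c3: "c3 dvd 1" "w = c3 *s ?e3" using line_eq_scale[OF l(3)] by blast
  have "- (dt u v * dt u w * dt v w) = (c1 * c2 * c3) * (c1 * c2 * c3) * a"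
    by (simp add: c1(2) c2(2) c3(2) dt_scale d ac_simps)
  moreover have "sq ((c1 * c2 * c3) * (c1 * c2 * c3))"
    unfolding sq_def using c1(1) c2(1) c3(1)
    by (intro exI[of _ "c1 * c2 * c3"]) (simp add: unit_mult)
  ultimately have s: "sq (- (dt u v * dt u w * dt v w)) \<longleftrightarrow> sq a" by (simp add: sq_mult_cancel)
  have "triple_class ?t = triple_class (std_triple a)"
    using triple_class_tuple_act[of M "std_triple a"] M by (simp add: SL_carrier)
  also have "\<dots> = {b. \<exists>c. c dvd 1 \<and> b = c * c * a}"
    using triple_class_std_triple[of a] a
    by (auto simp: unit r_coset_def units_of_mult type_ring_mult)
  also have "\<dots> = {b. b dvd 1 \<and> (sq b \<longleftrightarrow> sq a)}"
  proof (intro equalityI subsetI; clarsimp)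
    fix c assume c: "c dvd (1::'a)"
    have "sq (c * c)" using c by (auto simp: sq_def)
    then show "c * c * a dvd 1 \<and> sq (c * c * a) = sq a" using a c by (simp add: unit_mult sq_mult_cancel)
  next
    fix b assume b: "b dvd 1" "sq b = sq a"
    have "sq (a * uinv a)" using uinv[OF a] sq_one by simp
    then have "sq (b * uinv a)" using b a uinv_unit[OF a] by (simp add: sq_mult_iff)
    then obtain c where c: "c dvd 1" "b * uinv a = c * c" by (auto simp: sq_def)
    have "b = b * (a * uinv a)" using uinv[OF a] by simp
    also have "\<dots> = (b * uinv a) * a" by (simp only: ac_simps)
    finally show "\<exists>c. c dvd 1 \<and> b = c * c * a" using c by auto
  qed
  finally show ?thesis unfolding s square_units_def nonsquare_units_def using sq_unit by auto
qed

subsection \<open>A parity invariant\<close>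

text \<open>
  Modulo squares, the determinants of pairs of chosen generators form a cochain whose coboundary
  is the class of a triple, and \<open>SL2\<close> changes it by the coboundary of the cocycle \<open>multiplier\<close>. So
  the zigzag of a 2-cycle of \<open>SL2\<close> ends in an even multiple of the generator of the augmentation
  ideal.
\<close>

definition sq_parity :: "'a \<Rightarrow> int" where "sq_parity a = (if sq a then 0 else 1)"

definition gen_vec :: "('a^2) set \<Rightarrow> 'a^2" where
  "gen_vec p = (SOME v. p = line v \<and> (\<exists>w. dt v w dvd 1))"

lemma gen_vec: "p \<in> pts \<Longrightarrow> p = line (gen_vec p) \<and> (\<exists>w. dt (gen_vec p) w dvd 1)"
  unfolding gen_vec_def by (rule someI_ex) (auto elim!: ptsE)

definition multiplier :: "'a^2^2 \<Rightarrow> ('a^2) set \<Rightarrow> 'a" where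
  "multiplier M p = (SOME c. c dvd 1 \<and> M *v gen_vec p = c *s gen_vec ((*v) M ` p))"

lemma multiplier:
  assumes "det M = 1" "p \<in> pts"
  shows "multiplier M p dvd 1" "M *v gen_vec p = multiplier M p *s gen_vec ((*v) M ` p)"
proof -
  have q: "(*v) M ` p \<in> pts" by (rule SL2_pts[OF assms])
  have "line (gen_vec ((*v) M ` p)) = line (M *v gen_vec p)"
    using gen_vec[OF q] gen_vec[OF assms(2)] by (metis image_line)
  moreover obtain w where "dt (gen_vec ((*v) M ` p)) w dvd 1" using gen_vec[OF q] by blast
  ultimately obtain c where "c dvd 1" "M *v gen_vec p = c *s gen_vec ((*v) M ` p)" by (rule line_eq_scale)
  then have "\<exists>c. c dvd 1 \<and> M *v gen_vec p = c *s gen_vec ((*v) M ` p)" by (intro exI conjI)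
  from someI_ex[OF this] show "multiplier M p dvd 1" "M *v gen_vec p = multiplier M p *s gen_vec ((*v) M ` p)"
    by (simp_all add: multiplier_def)
qed

lemma multiplier_mult:
  assumes "det M = 1" "det N = 1" "p \<in> pts"
  shows "multiplier (M ** N) p = multiplier M ((*v) N ` p) * multiplier N p"
proof -
  have Np: "(*v) N ` p \<in> pts" by (rule SL2_pts[OF assms(2,3)])
  have MN: "det (M ** N) = 1" by (simp add: assms det_mul)
  have img: "(*v) (M ** N) ` p = (*v) M ` (*v) N ` p"
    by (simp add: image_image matrix_vector_mul_assoc)
  let ?g = "gen_vec ((*v) M ` (*v) N ` p)"
  have "multiplier (M ** N) p *s ?g = M *v (N *v gen_vec p)"
    using multiplier(2)[OF MN assms(3)] by (simp add: img matrix_vector_mul_assoc)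
  also have "\<dots> = (multiplier M ((*v) N ` p) * multiplier N p) *s ?g"
    unfolding multiplier(2)[OF assms(2,3)] matrix_vector_mult_smult multiplier(2)[OF assms(1) Np]
    by (simp add: vector_smult_assoc mult.commute)
  finally have e: "multiplier (M ** N) p *s ?g = (multiplier M ((*v) N ` p) * multiplier N p) *s ?g" .
  obtain w where "dt ?g w dvd 1" using gen_vec[OF SL2_pts[OF assms(1) Np]] by blast
  moreover have "dt ?g w * multiplier (M ** N) p = dt ?g w * (multiplier M ((*v) N ` p) * multiplier N p)"
    using arg_cong[OF e, of "\<lambda>v. dt v w"] by (simp add: dt_scale mult.commute)
  ultimately show ?thesis by (rule unit_cancel)
qed

definition gen_dt :: "('a^2) set \<Rightarrow> ('a^2) set \<Rightarrow> 'a" where "gen_dt p q = dt (gen_vec p) (gen_vec q)"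

lemma gen_dt_unit: "p \<in> pts \<Longrightarrow> q \<in> pts \<Longrightarrow> tv p q \<Longrightarrow> gen_dt p q dvd 1"
  unfolding gen_dt_def using gen_vec by (metis tv_line)

lemma gen_dt_act:
  assumes "det M = 1" "p \<in> pts" "q \<in> pts"
  shows "gen_dt p q = multiplier M p * multiplier M q * gen_dt ((*v) M ` p) ((*v) M ` q)"
proof -
  have "gen_dt p q = dt (M *v gen_vec p) (M *v gen_vec q)" by (simp add: dt_mult assms gen_dt_def)
  also have "\<dots> = multiplier M p * multiplier M q * gen_dt ((*v) M ` p) ((*v) M ` q)"
    unfolding multiplier(2)[OF assms(1,2)] multiplier(2)[OF assms(1,3)] by (simp add: dt_scale gen_dt_def)
  finally show ?thesis .
qed

definition parity_point :: "('a^2^2) list \<times> ('a^2) set list \<Rightarrow> int" where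
  "parity_point = (\<lambda>(gs, t). sq_parity (multiplier (hd gs) (hd t)))"

definition parity_pair :: "('a^2^2) list \<times> ('a^2) set list \<Rightarrow> int" where
  "parity_pair = (\<lambda>(gs, t). sq_parity (gen_dt (t ! 0) (t ! 1)))"

definition parity_triple :: "('a^2^2) list \<times> ('a^2) set list \<Rightarrow> int" where
  "parity_triple = (\<lambda>(gs, t). sq_parity (- (gen_dt (t ! 0) (t ! 1) * gen_dt (t ! 0) (t ! 2) * gen_dt (t ! 1) (t ! 2))))"

lemma parity_point_dv: "y \<in> ch 2 (Suc 0) \<Longrightarrow> even (zsum parity_point (dv y))"
proof -
  assume y: "y \<in> ch 2 (Suc 0)"
  have "zsum parity_point (dv y) \<in> {n. even n}"
  proof (rule chains_in_subgroup[OF y add_hom_comp[OF add_hom_zsum add_hom_dv] even_subgroup])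
    fix gs and t :: "('a^2) set list" assume *: "length gs = 2" "set gs \<subseteq> SL" "t \<in> tuples (Suc 0)"
    then obtain a b p where gs: "gs = [a, b]" "det a = 1" "det b = 1" and t: "t = [p]" "p \<in> pts"
      by (auto simp: length_eq_1_2_3 tuples_1)
    have bp: "(*v) b ` p \<in> pts" by (rule SL2_pts[OF gs(3) t(2)])
    have "even (sq_parity (multiplier b p) - sq_parity (multiplier a ((*v) b ` p) * multiplier b p) + sq_parity (multiplier a ((*v) b ` p)))"
      using sq_mult_iff[OF multiplier(1)[OF gs(2) bp] multiplier(1)[OF gs(3) t(2)]] by (simp add: sq_parity_def)
    then show "zsum parity_point (dv (frag_of (gs, t))) \<in> {n. even n}"
      by (simp add: gs t parity_point_def tuple_act_def multiplier_mult)
  qed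
  then show ?thesis by simp
qed

lemma parity_point_pair: "y \<in> ch 1 2 \<Longrightarrow> even (zsum parity_point (dh y) - zsum parity_pair (dv y))"
proof -
  assume y: "y \<in> ch 1 2"
  have "zsum parity_point (dh y) - zsum parity_pair (dv y) \<in> {n. even n}"
  proof (rule chains_in_subgroup[OF y add_hom_sub[OF add_hom_comp[OF add_hom_zsum add_hom_dh]
        add_hom_comp[OF add_hom_zsum add_hom_dv]] even_subgroup])
    fix gs and t :: "('a^2) set list" assume *: "length gs = 1" "set gs \<subseteq> SL" "t \<in> tuples 2"
    then obtain a p q where gs: "gs = [a]" "det a = 1" and t: "t = [p, q]" "p \<in> pts" "q \<in> pts" "tv p q"
      by (auto simp: length_eq_1_2_3 tuples_2)
    let ?P = "(*v) a ` p" and ?Q = "(*v) a ` q"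
    have u: "multiplier a p dvd 1" "multiplier a q dvd 1" "gen_dt ?P ?Q dvd 1"
      using multiplier(1)[OF gs(2)] gen_dt_unit[OF SL2_pts SL2_pts SL2_tv] gs(2) t by auto
    have "sq (gen_dt p q) \<longleftrightarrow> ((sq (multiplier a p) \<longleftrightarrow> sq (multiplier a q)) \<longleftrightarrow> sq (gen_dt ?P ?Q))"
      using u by (subst gen_dt_act[OF gs(2) t(2,3)]) (simp add: sq_mult_iff unit_mult)
    then have "even (sq_parity (multiplier a q) - sq_parity (multiplier a p) - (sq_parity (gen_dt p q) - sq_parity (gen_dt ?P ?Q)))"
      by (simp add: sq_parity_def)
    then show "zsum parity_point (dh (frag_of (gs, t))) - zsum parity_pair (dv (frag_of (gs, t))) \<in> {n. even n}"
      by (simp add: gs t parity_point_def parity_pair_def tuple_act_def)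
  qed
  then show ?thesis by simp
qed

text \<open>The sign in \<open>parity_triple\<close>, forced by \<open>triple_class_dt\<close>,
  contributes \<open>sq_parity (- 1)\<close> for each triple; this correction drops out on chains of
  augmentation zero.\<close>

lemma parity_pair_triple:
  assumes c: "c \<in> ch 0 3"
  shows "even (zsum parity_pair (dh c) - zsum parity_triple c - sq_parity (- 1) * zsum (\<lambda>x. 1) c)"
proof -
  have "zsum parity_pair (dh c) - zsum parity_triple c - sq_parity (- 1) * zsum (\<lambda>x. 1) c \<in> {n. even n}"
  proof (rule chains_in_subgroup[OF c _ even_subgroup])
    show "add_hom (\<lambda>c::'a chain. zsum parity_pair (dh c) - zsum parity_triple c - sq_parity (- 1) * zsum (\<lambda>x. 1) c)"
      by (simp add: add_hom_def algebra_simps)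
    fix gs and t :: "('a^2) set list" assume *: "length gs = 0" "set gs \<subseteq> SL" "t \<in> tuples 3"
    then obtain p q r where t: "t = [p, q, r]" "gen_dt p q dvd 1" "gen_dt p r dvd 1" "gen_dt q r dvd 1"
      using gen_dt_unit by (fastforce simp: tuples_3)
    have "sq (- (gen_dt p q * gen_dt p r * gen_dt q r)) \<longleftrightarrow> (sq (- 1) \<longleftrightarrow> sq (gen_dt p q * gen_dt p r * gen_dt q r))"
      using sq_mult_iff[of "- 1" "gen_dt p q * gen_dt p r * gen_dt q r"] t(2-4) by (simp add: unit_mult)
    then have "sq (- (gen_dt p q * gen_dt p r * gen_dt q r)) \<longleftrightarrow>
        (sq (- 1) \<longleftrightarrow> ((sq (gen_dt p q) \<longleftrightarrow> sq (gen_dt p r)) \<longleftrightarrow> sq (gen_dt q r)))"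
      using t(2-4) by (simp add: sq_mult_iff unit_mult)
    then show "zsum parity_pair (dh (frag_of (gs, t))) - zsum parity_triple (frag_of (gs, t))
        - sq_parity (- 1) * zsum (\<lambda>x. 1) (frag_of (gs, t)) \<in> {n. even n}"
      by (simp add: t(1) parity_pair_def parity_triple_def sq_parity_def)
  qed
  then show ?thesis by simp
qed

text \<open>With only two square classes, the total count and the count of nonsquare triples
  determine everything.\<close>

lemma class_sum_eq:
  assumes c: "c \<in> ch 0 3"
  shows "class_sum c = frag_cmul (zsum (\<lambda>x. 1) c - zsum parity_triple c) (frag_of square_units)
    + frag_cmul (zsum parity_triple c) (frag_of nonsquare_units)"
proof (rule chains_eqI[OF c add_hom_class_sum])
  show "add_hom (\<lambda>c. frag_cmul (zsum (\<lambda>x. 1) c - zsum parity_triple c) (frag_of square_units)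
    + frag_cmul (zsum parity_triple c) (frag_of nonsquare_units))"
    unfolding add_hom_def
    by (intro allI, rule poly_mapping_eqI) (simp add: lookup_add algebra_simps)
  fix gs and t :: "('a^2) set list" assume *: "length gs = 0" "set gs \<subseteq> SL" "t \<in> tuples 3"
  then obtain p q r where t: "t = [p, q, r]" "p \<in> pts" "q \<in> pts" "r \<in> pts"
    by (auto simp: tuples_3)
  have l: "t = [line (gen_vec p), line (gen_vec q), line (gen_vec r)]" using gen_vec t by metis
  show "class_sum (frag_of (gs, t)) =
      frag_cmul (zsum (\<lambda>x. 1) (frag_of (gs, t)) - zsum parity_triple (frag_of (gs, t))) (frag_of square_units)
      + frag_cmul (zsum parity_triple (frag_of (gs, t))) (frag_of nonsquare_units)"
    using triple_class_dt[of "gen_vec p" "gen_vec q" "gen_vec r"] *(3) unfolding l[symmetric]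
    by (simp add: parity_triple_def sq_parity_def gen_dt_def t(1))
qed

text \<open>The parity of \<open>c2\<close> passes to pairs in \<open>dh c2 = dv c1\<close>, then to
  points in \<open>dh c1 = dv c0\<close>, where it is even. The augmentation of \<open>c2\<close>
  vanishes because that of \<open>dv c1\<close> does.\<close>

lemma parity:
  assumes c0: "c0 \<in> ch 2 (Suc 0)" and c1: "c1 \<in> ch 1 2" and c2: "c2 \<in> ch 0 3"
    and eq: "dv c0 = dh c1" "dv c1 = dh c2"
  shows "\<exists>n. class_sum c2 = frag_cmul n (frag_cmul 2 (frag_of nonsquare_units - frag_of square_units))"
proof -
  have aug1: "zsum (\<lambda>x. 1) (dv c1) = 0"
    by (rule chains_eqI[OF c1 add_hom_comp[OF add_hom_zsum add_hom_dv] add_hom_zero_map])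
       (auto simp: length_eq_1_2_3)
  have aug2: "zsum (\<lambda>x. 1) (dh c2) = zsum (\<lambda>x. 1) c2"
    by (rule chains_eqI[OF c2 add_hom_comp[OF add_hom_zsum add_hom_dh] add_hom_zsum])
       (auto simp: tuples_3)
  have "zsum (\<lambda>x. 1) c2 = 0" using aug1 aug2 eq(2) by simp
  moreover have "even (zsum parity_triple c2)"
    using parity_pair_triple[OF c2] parity_point_pair[OF c1] parity_point_dv[OF c0] calculation eq by simp
  then obtain n where "zsum parity_triple c2 = 2 * n" by (rule evenE)
  ultimately have "class_sum c2 = frag_cmul n (frag_cmul 2 (frag_of nonsquare_units - frag_of square_units))"
    unfolding class_sum_eq[OF c2]
    by (intro poly_mapping_eqI) (simp add: lookup_add lookup_minus algebra_simps)
  then show ?thesis by blast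
qed

text \<open>The boundary of one tuple of four lines. Its faces have the classes of
  \<open>1 - x\<close>, \<open>x * (1 - x)\<close>, \<open>x\<close> and 1 with alternating signs;
  with \<open>x\<close> and \<open>1 - x\<close> both nonsquare the terms add up instead of
  cancelling.\<close>

lemma minimal_cycle:
  obtains z where "z \<in> ch 0 3" "dh z = 0"
    "class_sum z = frag_cmul 2 (frag_of nonsquare_units - frag_of square_units)"
proof -
  obtain x where x: "x dvd 1" "(1 - x) dvd 1" "\<not> sq x" "\<not> sq (1 - x)" using nonsquare_pair by blast
  let ?e1 = "axis 1 1 :: 'a^2" and ?e2 = "axis 2 1 :: 'a^2"
  let ?e3 = "axis 1 1 + axis 2 1 :: 'a^2" and ?e4 = "axis 1 1 + x *s axis 2 1 :: 'a^2"
  have d: "dt ?e1 ?e2 = 1" "dt ?e1 ?e3 = 1" "dt ?e1 ?e4 = x" "dt ?e2 ?e3 = - 1" "dt ?e2 ?e4 = - 1"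
    "dt ?e3 ?e4 = - (1 - x)"
    by (simp_all add: dt_def)
  have t: "tv (line ?e1) (line ?e2)" "tv (line ?e1) (line ?e3)" "tv (line ?e1) (line ?e4)"
    "tv (line ?e2) (line ?e3)" "tv (line ?e2) (line ?e4)" "tv (line ?e3) (line ?e4)"
    unfolding tv_line d using x(1,2) by (simp_all only: minus_dvd_iff dvd_refl)
  have p: "line ?e1 \<in> pts" "line ?e2 \<in> pts" "line ?e3 \<in> pts" "line ?e4 \<in> pts"
    using line_in_pts[of ?e1 ?e2] line_in_pts(2)[of ?e1 ?e3] line_in_pts(2)[of ?e1 ?e4] t
    unfolding tv_line by blast+
  let ?t1 = "[line ?e2, line ?e3, line ?e4]" and ?t2 = "[line ?e1, line ?e3, line ?e4]"
  let ?t3 = "[line ?e1, line ?e2, line ?e4]" and ?t4 = "[line ?e1, line ?e2, line ?e3]"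
  have in3: "?t1 \<in> tuples 3" "?t2 \<in> tuples 3" "?t3 \<in> tuples 3" "?t4 \<in> tuples 3"
    unfolding tuples_3 using t p by blast+
  have "- (x * (x - 1)) = x * (1 - x)" by (simp add: algebra_simps)
  then have sqx: "sq (- (x * (x - 1)))" using nonsquare_product[OF x] by (simp only:)
  have cl: "triple_class ?t1 = nonsquare_units" "triple_class ?t2 = square_units"
    "triple_class ?t3 = nonsquare_units" "triple_class ?t4 = square_units"
    unfolding triple_class_dt[OF in3(1)] triple_class_dt[OF in3(2)] triple_class_dt[OF in3(3)]
      triple_class_dt[OF in3(4)] d
    using x sqx sq_one by simp_all
  let ?z = "frag_of ([], ?t1) - frag_of ([], ?t2) + frag_of ([], ?t3) - frag_of ([], ?t4) :: 'a chain"
  show ?thesis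
  proof (rule that[of ?z])
    show "?z \<in> ch 0 3" using in3 by (intro chains_intros) simp_all
    show "dh ?z = 0" by simp
    show "class_sum ?z = frag_cmul 2 (frag_of nonsquare_units - frag_of square_units)"
      unfolding add_hom_add[OF add_hom_class_sum] add_hom_diff[OF add_hom_class_sum] class_sum_of cl
      by (rule poly_mapping_eqI) (simp only: lookup_add lookup_minus lookup_frag_cmul, simp)
  qed
qed

subsection \<open>Surjectivity\<close>

lemma ch_exact_0: "c \<in> ch n 0 \<Longrightarrow> \<exists>b\<in>ch n (Suc 0). dh b = c"
  unfolding chains_def by (erule dh_exact_0) auto

lemma ch_exact_1: "c \<in> ch n (Suc 0) \<Longrightarrow> dh c = 0 \<Longrightarrow> \<exists>b\<in>ch n 2. dh b = c"
  unfolding chains_def One_nat_def[symmetric] by (erule (1) dh_exact_1) auto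

lemma ch_exact_2: "c \<in> ch n 2 \<Longrightarrow> dh c = 0 \<Longrightarrow> \<exists>b\<in>ch n 3. dh b = c"
  unfolding chains_def by (erule (1) dh_exact_2) auto

lemma dh_tens: "dh (tens [p] c) = tens [] c"
  by (rule add_hom_eqI[OF add_hom_comp[OF add_hom_dh add_hom_tens] add_hom_tens, of _ UNIV]) simp_all

lemma H2_surj:
  assumes c: "c \<in> ch 2 0" "dv c = 0"
  obtains b e where "b \<in> frags (lists BB 2)" "dv (tens [p_inf] b) = 0" "e \<in> ch 3 0" "c = tens [] b + dv e"
proof -
  obtain c0 where c0: "c0 \<in> ch 2 (Suc 0)" "dh c0 = c" using ch_exact_0[OF c(1)] by blast
  have "dv c0 \<in> ch 1 (Suc 0)" by (rule dv_ch) (use c0 in \<open>simp add: numeral_2_eq_2\<close>)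
  moreover have "dh (dv c0) = 0" by (simp add: dv_dh[symmetric] c0 c)
  ultimately obtain c1 where c1: "c1 \<in> ch 1 2" "dh c1 = dv c0" using ch_exact_1 by blast
  have "dv c1 \<in> ch 0 2" by (rule dv_ch) (use c1 in simp)
  moreover have "dh (dv c1) = 0" by (simp add: dv_dh[symmetric] c1)
  ultimately obtain c2 where c2: "c2 \<in> ch 0 3" "dh c2 = dv c1" using ch_exact_2 by blast
  obtain n where n: "class_sum c2 = frag_cmul n (frag_cmul 2 (frag_of nonsquare_units - frag_of square_units))"
    using parity[OF c0(1) c1(1) c2(1)] c1(2) c2(2) by metis
  obtain z where z: "z \<in> ch 0 3" "dh z = 0"
    "class_sum z = frag_cmul 2 (frag_of nonsquare_units - frag_of square_units)"
    by (rule minimal_cycle)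
  \<comment> \<open>As \<open>z\<close> is invisible to \<open>dh\<close>, subtracting a multiple of
    it removes the class sum without disturbing the zigzag.\<close>
  have "c2 - frag_cmul n z \<in> ch 0 3" by (intro chains_intros c2 z)
  moreover have "class_sum (c2 - frag_cmul n z) = 0"
    by (simp only: add_hom_diff[OF add_hom_class_sum] add_hom_frag_cmul[OF add_hom_class_sum] n z diff_self)
  ultimately obtain y2 where y2: "y2 \<in> ch 1 3" "c2 - frag_cmul n z = dv y2" by (rule class_sum_kernel)
  \<comment> \<open>A vertical cycle now, while \<open>dh c1\<close> is unchanged.\<close>
  let ?c1 = "c1 - dh y2"
  have "dh y2 \<in> ch 1 2" by (rule dh_chains) (use y2 in \<open>simp_all add: eval_nat_numeral\<close>)
  then have c1': "?c1 \<in> ch 1 2" by (intro chains_diff c1)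
  have dc1: "dv ?c1 = 0" using y2(2) by (simp add: dv_dh y2(2)[symmetric] z c2)
  have "dh ?c1 \<in> dv ` ch 2 (Suc 0)" using c0(1) by (simp add: c1(2))
  from H1_pair[OF c1' dc1 this] obtain u v where uv: "u \<in> ch 1 3" "v \<in> ch 2 2" "dv u = 0" "?c1 = dh u + dv v" .
  \<comment> \<open>The part \<open>dh u\<close> of \<open>?c1\<close> is killed by
    \<open>dh\<close>, so \<open>dv c0 = dv (dh v)\<close>; the correction makes a vertical cycle
    and keeps \<open>dh c0 = c\<close>.\<close>
  let ?c0 = "c0 - dh v"
  have c0': "?c0 \<in> ch 2 (Suc 0)"
    by (intro chains_diff c0 dh_chains) (use uv in \<open>simp_all add: numeral_2_eq_2\<close>)
  have "dv c0 = dh ?c1" by (simp add: c1)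
  then have "dv ?c0 = 0" by (simp only: uv(4)) (simp add: dv_dh)
  from H2_point_surj[OF c0' this] obtain b y where b: "b \<in> frags (lists BB 2)" "y \<in> ch 3 (Suc 0)"
    "?c0 = tens [p_inf] b + dv y" .
  have "dv (tens [p_inf] b) = dv ?c0" by (simp only: b(3)) simp
  then have "dv (tens [p_inf] b) = 0" using \<open>dv ?c0 = 0\<close> by simp
  moreover have "c = dh ?c0" by (simp add: c0)
  then have "c = tens [] b + dv (dh y)" by (simp only: b(3)) (simp add: dh_tens dv_dh)
  moreover have "dh y \<in> ch 3 0" by (rule dh_chains) (use b in simp_all)
  ultimately show ?thesis using that b(1) by blast
qed

end

section \<open>The connecting relation\<close>

definition deg0 :: "('p list \<Rightarrow>\<^sub>0 int) \<Rightarrow> (('g list \<times> 'p list) \<Rightarrow>\<^sub>0 int)" where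
  "deg0 = frag_extend (\<lambda>t. frag_of ([], t))"

lemma add_hom_deg0: "add_hom deg0"
  by (simp add: deg0_def add_hom_frag_extend)

lemma deg0_of [simp]: "deg0 (frag_of t) = frag_of ([], t)"
  by (simp add: deg0_def)

lemma deg0_cancel: "deg0 x = (deg0 y :: (('g list \<times> 'p list) \<Rightarrow>\<^sub>0 int)) \<Longrightarrow> x = y"
proof -
  have s: "frag_extend (\<lambda>(l, t). frag_of t) (deg0 x :: (('g list \<times> 'p list) \<Rightarrow>\<^sub>0 int)) = x" for x :: "'p list \<Rightarrow>\<^sub>0 int"
    by (rule add_hom_eqI[OF add_hom_comp[OF add_hom_frag_extend add_hom_deg0] add_hom_id, of _ UNIV]) simp_all
  show "deg0 x = (deg0 y :: (('g list \<times> 'p list) \<Rightarrow>\<^sub>0 int)) \<Longrightarrow> x = y" by (metis s)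
qed

lemma config_act_of [simp]: "config_act M (frag_of t) = frag_of (tuple_act M t)"
  by (simp add: config_act_def)

lemma add_hom_config_act: "add_hom (config_act M)"
  by (simp add: config_act_def add_hom_frag_extend)

lemma diag1_eq: "diag1 d = mat2 d 0 0 1"
  by (simp add: diag1_def mat2_def)

context odd_local_ring
begin

lemma deg0_in: "z \<in> frags (tuples m) \<Longrightarrow> deg0 z \<in> ch 0 m"
  by (rule add_hom_in_subgroup[OF add_hom_deg0 add_subgroup_chains]) auto

lemma deg0_surj: "x \<in> ch 0 m \<Longrightarrow> \<exists>z\<in>frags (tuples m). x = deg0 z"
proof -
  assume x: "x \<in> ch 0 m"
  let ?p = "frag_extend (\<lambda>(l, t). frag_of t) :: 'a chain \<Rightarrow> _"
  have "?p x \<in> frags (tuples m)"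
    by (rule chains_in_subgroup[OF x add_hom_frag_extend add_subgroup_frags]) simp
  moreover have "x = deg0 (?p x)"
    by (rule chains_eqI[OF x add_hom_id add_hom_comp[OF add_hom_deg0 add_hom_frag_extend]]) simp
  ultimately show ?thesis by blast
qed

text \<open>A relation rather than a map, because the fillings are chosen. It is closed under
  differences, which reduces uniqueness of \<open>c\<close> modulo boundaries to the case
  \<open>z = 0\<close>.\<close>

definition connecting :: "(('a^2) set list \<Rightarrow>\<^sub>0 int) \<Rightarrow> (('a^2^2) list \<Rightarrow>\<^sub>0 int) \<Rightarrow> bool" where
  "connecting z c \<longleftrightarrow> c \<in> frags (lists BB 2) \<and>
     (\<exists>y1\<in>ch 1 3. \<exists>y2\<in>ch 2 2. \<exists>y3\<in>ch 3 (Suc 0).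
       deg0 z = dv y1 \<and> dh y1 = dv y2 \<and> dh y2 = tens [p_inf] c + dv y3)"

lemma connectingI:
  "c \<in> frags (lists BB 2) \<Longrightarrow> y1 \<in> ch 1 3 \<Longrightarrow> y2 \<in> ch 2 2 \<Longrightarrow> y3 \<in> ch 3 (Suc 0) \<Longrightarrow>
    deg0 z = dv y1 \<Longrightarrow> dh y1 = dv y2 \<Longrightarrow> dh y2 = tens [p_inf] c + dv y3 \<Longrightarrow> connecting z c"
  unfolding connecting_def by blast

lemma connectingE:
  assumes "connecting z c"
  obtains y1 y2 y3 where "c \<in> frags (lists BB 2)" "y1 \<in> ch 1 3" "y2 \<in> ch 2 2" "y3 \<in> ch 3 (Suc 0)"
    "deg0 z = dv y1" "dh y1 = dv y2" "dh y2 = tens [p_inf] c + dv y3"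
  using assms unfolding connecting_def by blast

lemma connecting_diff:
  assumes "connecting z c" "connecting z' c'"
  shows "connecting (z - z') (c - c')"
proof -
  obtain y1 y2 y3 where y: "c \<in> frags (lists BB 2)" "y1 \<in> ch 1 3" "y2 \<in> ch 2 2" "y3 \<in> ch 3 (Suc 0)"
    "deg0 z = dv y1" "dh y1 = dv y2" "dh y2 = tens [p_inf] c + dv y3" using assms(1) by (rule connectingE)
  obtain x1 x2 x3 where x: "c' \<in> frags (lists BB 2)" "x1 \<in> ch 1 3" "x2 \<in> ch 2 2" "x3 \<in> ch 3 (Suc 0)"
    "deg0 z' = dv x1" "dh x1 = dv x2" "dh x2 = tens [p_inf] c' + dv x3" using assms(2) by (rule connectingE)
  show ?thesis
    by (rule connectingI[OF frags_diff[OF y(1) x(1)] chains_diff[OF y(2) x(2)] chains_diff[OF y(3) x(3)]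
          chains_diff[OF y(4) x(4)]])
       (simp_all add: add_hom_diff[OF add_hom_deg0] add_hom_diff[OF add_hom_tens] y x)
qed

lemma connecting_zero: "connecting 0 0"
  by (rule connectingI[of _ 0 0 0]) (simp_all add: add_hom_zero[OF add_hom_deg0] add_hom_zero[OF add_hom_tens])

lemma connecting_add: "connecting z c \<Longrightarrow> connecting z' c' \<Longrightarrow> connecting (z + z') (c + c')"
  using connecting_diff[of z c "- z'" "- c'"] connecting_diff[OF connecting_zero, of z' c'] by simp

lemma connecting_cycle:
  assumes "connecting z c"
  shows "dv (tens [p_inf] c) = 0"
proof -
  obtain y1 y2 y3 where y: "dh y1 = dv y2" "dh y2 = tens [p_inf] c + dv y3"
    using assms by (rule connectingE)
  have "dv (dh y2) = dh (dh y1)" by (simp only: dv_dh y(1))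
  then show ?thesis by (simp add: y(2))
qed

text \<open>Applying the augmentation to the last equation of the zigzag kills \<open>dh y2\<close>
  and forgets the point \<open>p_inf\<close>.\<close>

lemma connecting_kernel:
  assumes "connecting z c"
  shows "tens [] c \<in> dv ` ch 3 0"
proof -
  obtain y1 y2 y3 where y: "y3 \<in> ch 3 (Suc 0)" "dh y2 = tens [p_inf] c + dv y3"
    using assms by (rule connectingE)
  have "0 = dh (tens [p_inf] c + dv y3)" by (simp only: y(2)[symmetric] dh_dh)
  then have "tens [] c + dv (dh y3) = 0" by (simp add: dh_tens dv_dh)
  then have "tens [] c = dv (- dh y3)" by (simp add: eq_neg_iff_add_eq_0)
  moreover have "- dh y3 \<in> ch 3 0" by (intro chains_minus dh_chains y) simp
  ultimately show ?thesis by blast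
qed

lemma connecting_exists:
  assumes z: "z \<in> frags (tuples 3)" "dh (deg0 z :: 'a chain) = 0" "class_sum (deg0 z) = 0"
  shows "\<exists>c. connecting z c"
proof -
  obtain y where y: "y \<in> ch 1 3" "deg0 z = dv y" using class_sum_kernel[OF deg0_in[OF z(1)] z(3)] .
  have x: "dh y \<in> ch 1 2" by (rule dh_chains) (use y in \<open>simp_all add: eval_nat_numeral\<close>)
  have dx: "dv (dh y) = 0" using z(2) y(2) by (simp add: dv_dh)
  have "dh (dh y) \<in> dv ` ch 2 (Suc 0)" by (rule image_eqI[of _ _ 0]) simp_all
  from H1_pair[OF x dx this] obtain u v where uv: "u \<in> ch 1 3" "v \<in> ch 2 2" "dv u = 0" "dh y = dh u + dv v" .
  have "dh v \<in> ch 2 (Suc 0)" by (rule dh_chains) (use uv in \<open>simp_all add: numeral_2_eq_2\<close>)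
  moreover have dvv: "dv v = dh (y - u)" using uv(4) by simp
  then have "dv (dh v) = 0" by (simp only: dv_dh dh_dh)
  ultimately obtain b w where b: "b \<in> frags (lists BB 2)" "w \<in> ch 3 (Suc 0)" "dh v = tens [p_inf] b + dv w"
    by (rule H2_point_surj)
  \<comment> \<open>Replacing \<open>y\<close> by \<open>y - u\<close> keeps its vertical boundary,
    since \<open>u\<close> is a vertical cycle.\<close>
  have "connecting z b"
    by (rule connectingI[OF b(1) chains_diff[OF y(1) uv(1)] uv(2) b(2) _ dvv[symmetric] b(3)])
       (simp add: y(2) uv(3))
  then show ?thesis by blast
qed

lemma connecting_unique:
  assumes "connecting 0 c"
  shows "tens [p_inf] c \<in> boundaries_B"
proof -
  obtain y1 y2 y3 where y: "c \<in> frags (lists BB 2)" "y1 \<in> ch 1 3" "y2 \<in> ch 2 2" "y3 \<in> ch 3 (Suc 0)"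
    "deg0 0 = dv y1" "dh y1 = dv y2" "dh y2 = tens [p_inf] c + dv y3" using assms by (rule connectingE)
  have N: "add_subgroup (dv ` ch 3 (Suc 0))" by (rule dv_boundary_subgroup)
  have "dv y1 = 0" using y(5) by (simp add: add_hom_zero[OF add_hom_deg0])
  \<comment> \<open>For \<open>z = 0\<close> the chain \<open>y1\<close> is a vertical cycle over
    triples, and doubling makes it a boundary.\<close>
  then obtain w where w: "w \<in> ch 2 3" "frag_cmul 2 y1 = dv w" using H1_triple[OF y(2)] by blast
  let ?x = "frag_cmul 2 y2 - dh w"
  have "dh w \<in> ch 2 2" by (rule dh_chains) (use w in \<open>simp_all add: eval_nat_numeral\<close>)
  then have x: "?x \<in> ch 2 2" by (intro chains_diff chains_cmul y)
  have "dv ?x = 0" by (simp add: dv_dh w(2)[symmetric] y(6))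
  then have 1: "dh ?x \<in> dv ` ch 3 (Suc 0)" by (rule H2_pair_to_point[OF x])
  have 2: "dv (frag_cmul 2 y3) \<in> dv ` ch 3 (Suc 0)" by (intro imageI chains_cmul y)
  have "frag_cmul 2 (tens [p_inf] c) = dh ?x - dv (frag_cmul 2 y3)"
    by (simp add: y(7) frag_cmul_distrib2)
  then have "frag_cmul 2 (tens [p_inf] c) \<in> dv ` ch 3 (Suc 0)"
    using add_subgroup_diff[OF N 1 2] by (simp only:)
  moreover have "frag_cmul 2 (tens [p_inf] c) \<in> chains BB {[p_inf]} 2"
    by (intro chains_cmul tens_in[OF y(1)]) simp
  \<comment> \<open>From a boundary in the column of all points back to one in the Borel subgroup,
    where the factor 2 can be removed.\<close>
  ultimately have "frag_cmul 2 (tens [p_inf] c) \<in> boundaries_B" using H2_point_inj[of _ 2] by simp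
  then show ?thesis by (rule H2_Borel_no_2_torsion[OF y(1)])
qed

text \<open>Putting the letter \<open>g\<close> in front of \<open>z\<close> gives a filling of the
  difference. It is a horizontal cycle because \<open>z\<close> is one, so the rest of the zigzag
  can be taken to be zero.\<close>

lemma connecting_coinvariant:
  assumes z: "z \<in> frags (tuples 3)" "dh (deg0 z :: 'a chain) = 0" and g: "g \<in> SL"
  shows "connecting (config_act g z - z) 0"
proof -
  let ?l = "frag_extend (\<lambda>(l, t). frag_of ([g], t)) :: 'a chain \<Rightarrow> 'a chain"
  have 1: "?l (deg0 z) \<in> ch 1 3"
    by (rule add_hom_in_subgroup[OF add_hom_comp[OF add_hom_frag_extend add_hom_deg0] add_subgroup_chains z(1)])
       (use g in simp)
  have "dh (?l (deg0 z)) = ?l (dh (deg0 z))"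
  proof (rule add_hom_eqI[OF add_hom_comp[OF add_hom_dh add_hom_comp[OF add_hom_frag_extend add_hom_deg0]]
      add_hom_comp[OF add_hom_frag_extend add_hom_comp[OF add_hom_dh add_hom_deg0]], of _ UNIV])
    fix t :: "('a^2) set list"
    show "dh (?l (deg0 (frag_of t))) = ?l (dh (deg0 (frag_of t)))"
      by (cases "([] :: ('a^2^2) list, t)" rule: face_bd.cases) (auto simp: frag_extend_diff frag_extend_add)
  qed simp
  then have 2: "dh (?l (deg0 z)) = 0" by (simp add: z(2))
  have "dv (?l (deg0 z)) = deg0 (z - config_act g z)"
    by (rule add_hom_eqI[OF add_hom_comp[OF add_hom_dv add_hom_comp[OF add_hom_frag_extend add_hom_deg0]]
          add_hom_comp[OF add_hom_deg0 add_hom_sub[OF add_hom_id add_hom_config_act]], of _ UNIV])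
       (simp_all add: add_hom_diff[OF add_hom_deg0])
  then have 3: "deg0 (config_act g z - z) = dv (- ?l (deg0 z))"
    by (simp add: add_hom_diff[OF add_hom_deg0])
  show ?thesis
    by (rule connectingI[OF _ chains_minus[OF 1] chains_zero chains_zero 3])
       (simp_all add: 2 add_hom_zero[OF add_hom_tens])
qed

text \<open>The zigzag run backwards: the filling of \<open>c\<close> in SL2 is lifted to points,
  and the resulting horizontal cycles are filled by pairs and then by triples.\<close>

lemma connecting_onto_kernel:
  assumes c: "c \<in> frags (lists BB 2)" "dv (tens [p_inf] c) = 0" "tens [] c \<in> dv ` ch 3 0"
  obtains z where "z \<in> frags (tuples 3)" "dh (deg0 z :: 'a chain) = 0" "class_sum (deg0 z) = 0" "connecting z c"
proof -
  obtain e where e: "e \<in> ch 3 0" "tens [] c = dv e" using c(3) by blast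
  obtain e0 where e0: "e0 \<in> ch 3 (Suc 0)" "dh e0 = e" using ch_exact_0[OF e(1)] by blast
  let ?x = "tens [p_inf] c - dv e0"
  have "tens [p_inf] c \<in> chains BB {[p_inf]} 2" by (rule tens_in[OF c(1)]) simp
  then have "tens [p_inf] c \<in> ch 2 (Suc 0)"
    by (rule chains_mono[rotated 2]) (auto simp: tuples_1 p_inf_zero)
  moreover have "dv e0 \<in> ch 2 (Suc 0)" by (rule dv_ch) (use e0 in \<open>simp add: eval_nat_numeral\<close>)
  ultimately have x: "?x \<in> ch 2 (Suc 0)" by (rule chains_diff)
  have "dh ?x = 0" by (simp add: dh_tens e(2) dv_dh[symmetric] e0(2))
  then obtain y2 where y2: "y2 \<in> ch 2 2" "dh y2 = ?x" using ch_exact_1[OF x] by blast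
  have "dv y2 \<in> ch 1 2" by (rule dv_ch) (use y2 in \<open>simp add: numeral_2_eq_2\<close>)
  moreover have "dh (dv y2) = 0" by (simp add: dv_dh[symmetric] y2(2) c(2))
  ultimately obtain y1 where y1: "y1 \<in> ch 1 3" "dh y1 = dv y2" using ch_exact_2 by blast
  have "dv y1 \<in> ch 0 3" by (rule dv_ch) (use y1 in simp)
  then obtain z where z: "z \<in> frags (tuples 3)" "dv y1 = deg0 z" using deg0_surj by blast
  show ?thesis
  proof (rule that[OF z(1)])
    show "dh (deg0 z :: 'a chain) = 0" by (simp add: z(2)[symmetric] dv_dh[symmetric] y1(2))
    show "class_sum (deg0 z) = 0" using class_sum_dv[OF y1(1)] by (simp add: z(2))
    show "connecting z c"
      by (rule connectingI[OF c(1) y1(1) y2(1) chains_minus[OF e0(1)] z(2)[symmetric] y1(2)])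
         (simp add: y2(2))
  qed
qed

subsection \<open>Equivariance\<close>

lemma diag1_conj_eq:
  fixes d :: 'a
  assumes "d dvd 1"
  shows "diag1_conj d M = mat2 (M$1$1) (d * M$1$2) (uinv d * M$2$1) (M$2$2)"
proof -
  have inv: "diag1 d ** diag1 (uinv d) = mat 1" "diag1 (uinv d) ** diag1 d = mat 1"
    using uinv[OF assms] by (simp_all add: diag1_eq mat2_eq_iff mult.commute)
  have "matrix_inv (diag1 d) = diag1 (uinv d)"
    unfolding matrix_inv_def
  proof (rule some_equality)
    fix N assume "diag1 d ** N = mat 1 \<and> N ** diag1 d = mat 1"
    then show "N = diag1 (uinv d)" by (metis inv(1) matrix_mul_assoc matrix_mul_lid matrix_mul_rid)
  qed (use inv in simp)
  moreover have "d * x * uinv d = x" for x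
  proof -
    have "d * x * uinv d = (d * uinv d) * x" by (simp only: ac_simps)
    then show ?thesis by (simp add: uinv[OF assms])
  qed
  ultimately show ?thesis
    by (simp add: diag1_conj_def diag1_eq mat2_eq_iff mult.commute[of "uinv d"])
qed

lemma diag1_conj_mult:
  fixes d :: 'a
  assumes "d dvd 1"
  shows "diag1_conj d (M ** N) = diag1_conj d M ** diag1_conj d N"
proof -
  have k: "d * x * (uinv d * y) = x * y" "uinv d * x * (d * y) = x * y" for x y
  proof -
    have "d * x * (uinv d * y) = (d * uinv d) * (x * y)" "uinv d * x * (d * y) = (d * uinv d) * (x * y)"
      by (simp_all only: ac_simps)
    then show "d * x * (uinv d * y) = x * y" "uinv d * x * (d * y) = x * y" by (simp_all add: uinv[OF assms])
  qed
  show ?thesis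
    unfolding diag1_conj_eq[OF assms] by (simp add: mat2_eq_iff k) (simp add: algebra_simps)
qed

lemma det_diag1_conj: "d dvd 1 \<Longrightarrow> det (diag1_conj d M) = det M" for d :: 'a
proof -
  assume d: "d dvd 1"
  have "d * M$1$2 * (uinv d * M$2$1) = (d * uinv d) * (M$1$2 * M$2$1)" by (simp only: ac_simps)
  then show ?thesis by (simp add: diag1_conj_eq[OF d] det_2 uinv[OF d])
qed

lemma diag1_conj_SL: "d dvd 1 \<Longrightarrow> M \<in> SL \<Longrightarrow> diag1_conj d M \<in> SL"
  by (simp add: det_diag1_conj)

lemma diag1_conj_BB: "d dvd 1 \<Longrightarrow> M \<in> BB \<Longrightarrow> diag1_conj d M \<in> BB"
  by (simp add: det_diag1_conj) (simp add: diag1_conj_eq)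

lemma diag1_conj_act:
  fixes d :: 'a
  assumes "d dvd 1"
  shows "tuple_act (diag1 d) (tuple_act M t) = tuple_act (diag1_conj d M) (tuple_act (diag1 d) t)"
proof -
  have "uinv d * x * d = x" for x
  proof -
    have "uinv d * x * d = (d * uinv d) * x" by (simp only: ac_simps)
    then show ?thesis by (simp add: uinv[OF assms])
  qed
  then have "diag1 d ** M = diag1_conj d M ** diag1 d"
    unfolding diag1_conj_eq[OF assms] by (simp add: diag1_eq mat2_eq_iff mult.commute[of d "M$1$1"])
  then show ?thesis by (simp only: tuple_act_mult[symmetric])
qed

lemma diag1_tuples:
  assumes "d dvd 1" "t \<in> tuples m"
  shows "tuple_act (diag1 d) t \<in> tuples m"
proof -
  have gen_dt: "det (diag1 d) = d" by (simp add: diag1_eq det_2)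
  have pts: "(*v) (diag1 d) ` p \<in> pts" if p: "p \<in> pts" for p :: "('a^2) set"
  proof -
    obtain v w where v: "p = line v" "dt v w dvd 1" using p by (rule ptsE)
    then have "dt (diag1 d *v v) (diag1 d *v w) dvd 1" using assms(1) by (simp add: dt_mult gen_dt unit_mult)
    then show ?thesis by (simp add: v image_line line_in_pts)
  qed
  have tv: "tv ((*v) (diag1 d) ` p) ((*v) (diag1 d) ` q)" if pq: "tv p q" for p q :: "('a^2) set"
  proof -
    obtain u v where u: "p = line u" "q = line v" "dt u v dvd 1" using pq by (auto simp: tv_def)
    then show ?thesis using assms(1) by (simp add: image_line dt_mult gen_dt unit_mult)
  qed
  have "sorted_wrt tv t \<Longrightarrow> sorted_wrt tv (tuple_act (diag1 d) t)"
    unfolding tuple_act_def sorted_wrt_map by (erule sorted_wrt_mono_rel[rotated]) (rule tv)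
  then show ?thesis using assms(2) pts by (auto simp: tuples_def) (auto simp: tuple_act_def)
qed

lemma diag1_inf: "tuple_act (diag1 d) [p_inf] = [p_inf]" if "d dvd 1"
proof -
  have "diag1 d *v axis 1 1 = d *s axis 1 1" by (simp add: diag1_eq vec2_eq_iff)
  then show ?thesis using line_smult_unit[OF that] by (simp add: tuple_act_def image_line)
qed

text \<open>Because \<open>diag1 d\<close> normalises SL2, conjugating the letters while moving the
  tuple acts on the whole double complex, hence on zigzags.\<close>

definition conj_chain :: "'a \<Rightarrow> 'a chain \<Rightarrow> 'a chain" where
  "conj_chain d = frag_extend (\<lambda>(gs, t). frag_of (map (diag1_conj d) gs, tuple_act (diag1 d) t))"

definition conj_bar :: "'a \<Rightarrow> (('a^2^2) list \<Rightarrow>\<^sub>0 int) \<Rightarrow> (('a^2^2) list \<Rightarrow>\<^sub>0 int)" where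
  "conj_bar d = frag_extend (frag_of \<circ> map (diag1_conj d))"

lemma add_hom_conj_chain: "add_hom (conj_chain d)" and add_hom_conj_bar: "add_hom (conj_bar d)"
  by (simp_all add: conj_chain_def conj_bar_def add_hom_frag_extend)

lemma conj_chain_of [simp]: "conj_chain d (frag_of (gs, t)) = frag_of (map (diag1_conj d) gs, tuple_act (diag1 d) t)"
  and conj_bar_of [simp]: "conj_bar d (frag_of gs) = frag_of (map (diag1_conj d) gs)"
  by (simp_all add: conj_chain_def conj_bar_def)

lemmas conj_chain_simps = add_hom_zero[OF add_hom_conj_chain] add_hom_add[OF add_hom_conj_chain] add_hom_diff[OF add_hom_conj_chain]

lemma conj_chain_dv:
  assumes "d dvd 1"
  shows "conj_chain d (dv y) = dv (conj_chain d y)"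
proof (rule add_hom_eqI[OF add_hom_comp[OF add_hom_conj_chain add_hom_dv] add_hom_comp[OF add_hom_dv add_hom_conj_chain], of _ UNIV])
  fix x :: "('a^2^2) list \<times> ('a^2) set list"
  obtain gs t where "x = (gs, t)" by fastforce
  then show "conj_chain d (dv (frag_of x)) = dv (conj_chain d (frag_of x))"
    by (cases "(gs, t)" rule: bar_bd.cases)
       (auto simp: conj_chain_simps diag1_conj_act[OF assms] diag1_conj_mult[OF assms])
qed simp

lemma conj_chain_dh: "conj_chain d (dh y) = dh (conj_chain d y)"
proof (rule add_hom_eqI[OF add_hom_comp[OF add_hom_conj_chain add_hom_dh] add_hom_comp[OF add_hom_dh add_hom_conj_chain], of _ UNIV])
  fix x :: "('a^2^2) list \<times> ('a^2) set list"
  obtain gs t where "x = (gs, t)" by fastforce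
  then show "conj_chain d (dh (frag_of x)) = dh (conj_chain d (frag_of x))"
    by (cases "(gs, t)" rule: face_bd.cases) (auto simp: conj_chain_simps tuple_act_def)
qed simp

lemma conj_chain_in: "d dvd 1 \<Longrightarrow> y \<in> ch n m \<Longrightarrow> conj_chain d y \<in> ch n m"
  by (erule chains_in_subgroup[OF _ add_hom_conj_chain add_subgroup_chains])
     (use diag1_conj_SL diag1_tuples in \<open>auto simp: image_subset_iff subset_iff\<close>)

lemma conj_bar_in: "d dvd 1 \<Longrightarrow> c \<in> frags (lists BB n) \<Longrightarrow> conj_bar d c \<in> frags (lists BB n)"
  by (erule add_hom_in_subgroup[OF add_hom_conj_bar add_subgroup_frags])
     (use diag1_conj_BB in \<open>auto simp: lists_def subset_iff\<close>)

lemma conj_chain_deg0: "conj_chain d (deg0 z) = deg0 (config_act (diag1 d) z)"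
  by (rule add_hom_eqI[OF add_hom_comp[OF add_hom_conj_chain add_hom_deg0] add_hom_comp[OF add_hom_deg0 add_hom_config_act], of _ UNIV])
     simp_all

lemma conj_chain_tens: "d dvd 1 \<Longrightarrow> conj_chain d (tens [p_inf] c) = tens [p_inf] (conj_bar d c)"
  by (rule add_hom_eqI[OF add_hom_comp[OF add_hom_conj_chain add_hom_tens] add_hom_comp[OF add_hom_tens add_hom_conj_bar], of _ UNIV])
     (simp_all add: diag1_inf)

lemma connecting_equivariant:
  assumes d: "d dvd 1" and "connecting z c"
  shows "connecting (config_act (diag1 d) z) (conj_bar d c)"
proof -
  obtain y1 y2 y3 where y: "c \<in> frags (lists BB 2)" "y1 \<in> ch 1 3" "y2 \<in> ch 2 2" "y3 \<in> ch 3 (Suc 0)"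
    "deg0 z = dv y1" "dh y1 = dv y2" "dh y2 = tens [p_inf] c + dv y3" using assms(2) by (rule connectingE)
  show ?thesis
    by (rule connectingI[OF conj_bar_in[OF d y(1)] conj_chain_in[OF d y(2)] conj_chain_in[OF d y(3)] conj_chain_in[OF d y(4)]])
       (simp_all add: conj_chain_deg0[symmetric] conj_chain_tens[OF d, symmetric] conj_chain_dv[OF d, symmetric] conj_chain_dh[symmetric] y conj_chain_simps)
qed

end

section \<open>Quotients of additive groups\<close>

text \<open>The bridge between the monoid records of the statement and the additive type classes in
  which the chains are computed.\<close>

definition additive_monoid :: "('m::ab_group_add, 'b) monoid_scheme \<Rightarrow> 'm set \<Rightarrow> bool" where
  "additive_monoid M Z \<longleftrightarrow> add_subgroup Z \<and> carrier M = Z \<and> monoid.mult M = (+) \<and> one M = 0"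

definition add_coset :: "'m::ab_group_add set \<Rightarrow> 'm \<Rightarrow> 'm set" where
  "add_coset N x = {n + x | n. n \<in> N}"

lemma add_coset_eq_iff:
  assumes N: "add_subgroup N"
  shows "add_coset N x = add_coset N y \<longleftrightarrow> x - y \<in> N"
proof
  assume "add_coset N x = add_coset N y"
  moreover have "x \<in> add_coset N x" using add_subgroup_zero[OF N] by (force simp: add_coset_def)
  ultimately show "x - y \<in> N" by (auto simp: add_coset_def)
next
  assume xy: "x - y \<in> N"
  have "n + x \<in> add_coset N y" if "n \<in> N" for n
    using add_subgroup_add[OF N that xy] by (force simp: add_coset_def algebra_simps)
  moreover have "n + y \<in> add_coset N x" if "n \<in> N" for n
    using add_subgroup_diff[OF N that xy] by (force simp: add_coset_def algebra_simps)
  ultimately show "add_coset N x = add_coset N y" by (auto simp: add_coset_def)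
qed

lemma add_coset_self: "add_subgroup N \<Longrightarrow> x \<in> add_coset N x"
  using add_subgroup_zero[of N] by (force simp: add_coset_def)

lemma add_coset_zero: "add_coset N 0 = N"
  by (auto simp: add_coset_def)

lemma additive_monoid_mod:
  assumes "additive_monoid M Z" "N \<subseteq> Z" "add_subgroup N"
  shows "carrier (M Mod N) = add_coset N ` Z" "one (M Mod N) = add_coset N 0"
    "add_coset N x \<otimes>\<^bsub>M Mod N\<^esub> add_coset N y = add_coset N (x + y)"
proof -
  have m: "carrier M = Z" "monoid.mult M = (+)" using assms(1) by (auto simp: additive_monoid_def)
  have "r_coset M N x = add_coset N x" for x by (auto simp: r_coset_def add_coset_def m)
  then show "carrier (M Mod N) = add_coset N ` Z" by (simp add: carrier_FactGroup m)
  show "one (M Mod N) = add_coset N 0" by (simp add: add_coset_zero)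
  have "(a + x) + (b + y) \<in> add_coset N (x + y)" if "a \<in> N" "b \<in> N" for a b
    unfolding add_coset_def using add_subgroup_add[OF assms(3) that]
    by (intro CollectI exI[of _ "a + b"]) (simp add: algebra_simps)
  moreover have "\<exists>b\<in>N. \<exists>c\<in>N. a + (x + y) = (b + x) + (c + y)" if "a \<in> N" for a
    by (rule bexI[OF _ that], rule bexI[OF _ add_subgroup_zero[OF assms(3)]]) (simp add: algebra_simps)
  ultimately show "add_coset N x \<otimes>\<^bsub>M Mod N\<^esub> add_coset N y = add_coset N (x + y)"
    by (auto simp: set_mult_def m) (force simp: add_coset_def)+
qed

lemma quotient_map_coset:
  assumes "monoid.mult M' = (+)" "add_subgroup N" "add_subgroup N'" "add_hom h" "h ` N \<subseteq> N'"
  shows "quotient_map M' N' h (add_coset N x) = add_coset N' (h x)"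
proof -
  have "a + h (n + x) \<in> add_coset N' (h x)" if "a \<in> N'" "n \<in> N" for a n
  proof -
    have "a + h n \<in> N'" using add_subgroup_add[OF assms(3) that(1)] that(2) assms(5) by blast
    moreover have "a + h (n + x) = (a + h n) + h x" by (simp add: add_hom_add[OF assms(4)])
    ultimately show ?thesis by (auto simp: add_coset_def)
  qed
  moreover have "\<exists>b\<in>N'. \<exists>c\<in>add_coset N x. a + h x = b + h c" if "a \<in> N'" for a
    using that add_coset_self[OF assms(2)] by blast
  ultimately show ?thesis
    unfolding quotient_map_def set_mult_def assms(1)
    by (auto simp: add_coset_def)
qed

lemma additive_monoid_group:
  assumes "additive_monoid M Z"
  shows "comm_group M" "x \<in> Z \<Longrightarrow> inv\<^bsub>M\<^esub> x = - x"
proof -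
  have m: "carrier M = Z" "monoid.mult M = (+)" "one M = 0" and Z: "add_subgroup Z"
    using assms by (auto simp: additive_monoid_def)
  show g: "comm_group M"
  proof (rule comm_groupI)
    show "\<exists>y\<in>carrier M. y \<otimes>\<^bsub>M\<^esub> x = \<one>\<^bsub>M\<^esub>" if "x \<in> carrier M" for x
      using that add_subgroup_minus[OF Z, of x] by (intro bexI[of _ "- x"]) (simp_all add: m)
  qed (simp_all add: m add_subgroup_zero[OF Z] add_subgroup_add[OF Z] algebra_simps)
  interpret comm_group M by (rule g)
  show "x \<in> Z \<Longrightarrow> inv\<^bsub>M\<^esub> x = - x"
    by (rule inv_equality) (simp_all add: m add_subgroup_minus[OF Z])
qed

lemma additive_monoid_subgroup:
  assumes "additive_monoid M Z" "K \<subseteq> Z" "add_subgroup K"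
  shows "subgroup K M" "additive_monoid (subgroup_generated M K) K"
proof -
  interpret comm_group M by (rule additive_monoid_group[OF assms(1)])
  have m: "carrier M = Z" "monoid.mult M = (+)" "one M = 0" using assms(1) by (auto simp: additive_monoid_def)
  show s: "subgroup K M"
    by (rule subgroupI)
       (use assms additive_monoid_group(2)[OF assms(1)] add_subgroup_zero[OF assms(3)] in
         \<open>auto simp: m add_subgroup_add[OF assms(3)] add_subgroup_minus[OF assms(3)] subset_iff\<close>)
  have "carrier (subgroup_generated M K) = K" by (rule subgroup.carrier_subgroup_generated_subgroup[OF s])
  then show "additive_monoid (subgroup_generated M K) K"
    using assms(3) by (simp add: additive_monoid_def subgroup_generated_def m)
qed

lemma additive_monoid_free: "additive_monoid (free_Abelian_group S) (frags S)"
  using add_subgroup_frags[of S] by (simp add: additive_monoid_def free_Abelian_group_def frags_def)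

lemma additive_monoid_kernel:
  assumes "add_hom f"
  shows "additive_monoid (subgroup_generated (free_Abelian_group S) (kernel (free_Abelian_group S) (free_Abelian_group T) f))
    {x \<in> frags S. f x = 0}"
proof -
  have "kernel (free_Abelian_group S) (free_Abelian_group T) f = {x \<in> frags S. f x = 0}"
    by (simp add: kernel_def frags_def)
  moreover have "add_subgroup {x \<in> frags S. f x = 0}"
    using add_subgroup_Int[OF add_subgroup_frags add_subgroup_kernel[OF assms], of S] by (simp add: Int_def)
  ultimately show ?thesis
    using additive_monoid_subgroup(2)[OF additive_monoid_free] by auto
qed

lemma additive_monoid_generate:
  assumes M: "additive_monoid M Z" and K: "K \<subseteq> Z"
  shows "add_subgroup (generate M K)" "generate M K \<subseteq> Z"
    "\<And>P. add_subgroup P \<Longrightarrow> K \<subseteq> P \<Longrightarrow> generate M K \<subseteq> P"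
proof -
  interpret comm_group M by (rule additive_monoid_group[OF M])
  have m: "carrier M = Z" "monoid.mult M = (+)" "one M = 0" and Z: "add_subgroup Z"
    using M by (auto simp: additive_monoid_def)
  interpret g: subgroup "generate M K" M by (rule generate_is_subgroup) (simp add: m K)
  show sub: "generate M K \<subseteq> Z" using g.subset by (simp add: m)
  show "add_subgroup (generate M K)"
    unfolding add_subgroup_def
  proof (intro conjI ballI)
    show "0 \<in> generate M K" using g.one_closed by (simp add: m)
    fix x y assume xy: "x \<in> generate M K" "y \<in> generate M K"
    have "inv\<^bsub>M\<^esub> y = - y" by (rule additive_monoid_group(2)[OF M]) (use sub xy in blast)
    then have "- y \<in> generate M K" using g.m_inv_closed[OF xy(2)] by simp
    then show "x - y \<in> generate M K" using g.m_closed[OF xy(1)] by (fastforce simp: m)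
  qed
  show "generate M K \<subseteq> P" if P: "add_subgroup P" "K \<subseteq> P" for P
  proof
    fix x assume "x \<in> generate M K"
    then show "x \<in> P"
    proof (induction rule: generate.induct)
      case (inv h)
      then have "inv\<^bsub>M\<^esub> h = - h" using additive_monoid_group(2)[OF M] K by blast
      then show ?case using inv P add_subgroup_minus[OF P(1)] by auto
    qed (use P in \<open>auto simp: m add_subgroup_zero[OF P(1)] add_subgroup_add[OF P(1)]\<close>)
  qed
qed

section \<open>Group homology of matrix groups\<close>

lemma bar_boundary_of:
  assumes "monoid.mult G = (**)"
  shows "bar_boundary G 2 (frag_of [a, b]) = frag_of [b] - frag_of [a ** b] + frag_of [a]"
    "bar_boundary G 3 (frag_of [a, b, c]) =
       frag_of [b, c] - frag_of [a ** b, c] + frag_of [a, b ** c] - frag_of [a, b]"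
proof -
  have "{..2} = {0, 1, 2::nat}" "{..3} = {0, 1, 2, 3::nat}" by auto
  then show "bar_boundary G 2 (frag_of [a, b]) = frag_of [b] - frag_of [a ** b] + frag_of [a]"
    "bar_boundary G 3 (frag_of [a, b, c]) =
       frag_of [b, c] - frag_of [a ** b, c] + frag_of [a, b ** c] - frag_of [a, b]"
    by (simp_all add: bar_boundary_def bar_face_def assms)
qed

lemma add_hom_bar_boundary: "add_hom (bar_boundary G n)"
  by (simp add: bar_boundary_def add_hom_def frag_extend_add)

context odd_local_ring
begin

lemma bar_group_lists: "bar_group n G = free_Abelian_group (lists (carrier G) n)"
  by (simp add: bar_group_def lists_def)

text \<open>
  \<open>G\<close> is a matrix group fixing the tuple \<open>t\<close>, so that tensoring with \<open>t\<close> identifies its bar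
  complex with the chains concentrated on \<open>t\<close>.
\<close>

definition fixing :: "('a^2^2, 'b) monoid_scheme \<Rightarrow> ('a^2) set list \<Rightarrow> bool" where
  "fixing G t \<longleftrightarrow> monoid.mult G = (**) \<and> SL2_subgroup (carrier G) \<and> (\<forall>M\<in>carrier G. tuple_act M t = t)"

lemma fixing_SL: "fixing (SL2 TYPE('a)) []"
  using SL2_subgroup_SL by (simp add: fixing_def SL2_def tuple_act_def)

lemma fixing_B: "fixing (B2 TYPE('a)) [p_inf]"
  using SL2_subgroup_BB tuple_act_inf_iff by (auto simp: fixing_def SL2_def B2_def)

lemma bar_boundary_tens:
  assumes "fixing G t"
  shows "c \<in> frags (lists (carrier G) 2) \<Longrightarrow> dv (tens t c) = tens t (bar_boundary G 2 c)"
    "e \<in> frags (lists (carrier G) 3) \<Longrightarrow> dv (tens t e) = tens t (bar_boundary G 3 e)"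
proof -
  have G: "monoid.mult G = (**)" "M \<in> carrier G \<Longrightarrow> tuple_act M t = t" for M
    using assms by (auto simp: fixing_def)
  show "c \<in> frags (lists (carrier G) 2) \<Longrightarrow> dv (tens t c) = tens t (bar_boundary G 2 c)"
    by (erule add_hom_eqI[OF add_hom_comp[OF add_hom_dv add_hom_tens]
          add_hom_comp[OF add_hom_tens add_hom_bar_boundary]])
       (auto simp: lists_def length_eq_1_2_3 bar_boundary_of[OF G(1)] G(2)
         add_hom_diff[OF add_hom_tens] add_hom_add[OF add_hom_tens])
  show "e \<in> frags (lists (carrier G) 3) \<Longrightarrow> dv (tens t e) = tens t (bar_boundary G 3 e)"
    by (erule add_hom_eqI[OF add_hom_comp[OF add_hom_dv add_hom_tens]
          add_hom_comp[OF add_hom_tens add_hom_bar_boundary]])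
       (auto simp: lists_def length_eq_1_2_3 bar_boundary_of[OF G(1)] G(2)
         add_hom_diff[OF add_hom_tens] add_hom_add[OF add_hom_tens])
qed

lemma tens_cancel: "tens t x = tens t y \<Longrightarrow> x = y"
  by (metis proj_tens)

definition cyc :: "('a^2^2, 'b) monoid_scheme \<Rightarrow> (('a^2^2) list \<Rightarrow>\<^sub>0 int) set" where
  "cyc G = {c \<in> frags (lists (carrier G) 2). bar_boundary G 2 c = 0}"

lemma cyc_iff:
  assumes "fixing G t"
  shows "c \<in> cyc G \<longleftrightarrow> c \<in> frags (lists (carrier G) 2) \<and> dv (tens t c) = 0"
  using bar_boundary_tens(1)[OF assms, of c] tens_cancel[of t "bar_boundary G 2 c" 0]
  by (auto simp: cyc_def add_hom_zero[OF add_hom_tens])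

lemma additive_cyc: "additive_monoid (bar_cycles 2 G) (cyc G)"
  unfolding bar_cycles_def bar_group_lists cyc_def
  by (rule additive_monoid_kernel[OF add_hom_bar_boundary])

lemma bar_boundaries_eq: "bar_boundaries 2 G = bar_boundary G 3 ` frags (lists (carrier G) 3)"
  by (simp add: bar_boundaries_def bar_group_lists free_Abelian_group_def frags_def eval_nat_numeral)

lemma add_subgroup_bar_boundaries: "add_subgroup (bar_boundaries 2 G)"
  for G :: "('a^2^2, 'b) monoid_scheme"
  unfolding bar_boundaries_eq by (rule add_subgroup_image[OF add_hom_bar_boundary add_subgroup_frags])

lemma bar_boundaries_iff:
  assumes "fixing G t"
  shows "c \<in> bar_boundaries 2 G \<longleftrightarrow> tens t c \<in> dv ` chains (carrier G) {t} 3"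
proof
  assume "c \<in> bar_boundaries 2 G"
  then obtain e where e: "e \<in> frags (lists (carrier G) 3)" "c = bar_boundary G 3 e"
    by (auto simp: bar_boundaries_eq)
  then have "tens t c = dv (tens t e)" by (simp add: bar_boundary_tens(2)[OF assms])
  then show "tens t c \<in> dv ` chains (carrier G) {t} 3" using tens_in[OF e(1)] by blast
next
  assume "tens t c \<in> dv ` chains (carrier G) {t} 3"
  then obtain y where y: "y \<in> chains (carrier G) {t} 3" "tens t c = dv y" by blast
  have "tens t c = dv (tens t (proj y))" by (simp add: y(2) tens_proj[OF y(1)])
  also have "\<dots> = tens t (bar_boundary G 3 (proj y))" by (rule bar_boundary_tens(2)[OF assms proj_in[OF y(1)]])
  finally have "c = bar_boundary G 3 (proj y)" by (rule tens_cancel)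
  then show "c \<in> bar_boundaries 2 G" using proj_in[OF y(1)] by (auto simp: bar_boundaries_eq)
qed

lemma bar_boundaries_cyc:
  assumes "fixing G t"
  shows "bar_boundaries 2 G \<subseteq> cyc G"
proof
  fix c assume c: "c \<in> bar_boundaries 2 G"
  then obtain y where y: "y \<in> chains (carrier G) {t} 3" "tens t c = dv y"
    using bar_boundaries_iff[OF assms] by blast
  have "dv (tens t c) = 0" by (simp only: y(2) dv_dv)
  moreover have "stable_under (carrier G) {t}" "SL2_subgroup (carrier G)"
    using assms by (auto simp: fixing_def stable_under_def)
  then have "tens t c \<in> chains (carrier G) {t} 2"
    unfolding y(2) by (intro dv_chains) (use y in \<open>simp_all add: eval_nat_numeral\<close>)
  then have "c \<in> frags (lists (carrier G) 2)" using proj_in by fastforce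
  ultimately show "c \<in> cyc G" using cyc_iff[OF assms] by blast
qed

lemma bar_boundary_natural:
  assumes G: "monoid.mult G = (**)" "monoid.mult H = (**)" and \<phi>: "\<And>M N. \<phi> (M ** N) = \<phi> M ** \<phi> N"
    and img: "\<phi> ` carrier G \<subseteq> carrier H"
  shows "frag_extend (frag_of \<circ> map \<phi>) ` cyc G \<subseteq> cyc H"
    "frag_extend (frag_of \<circ> map \<phi>) ` bar_boundaries 2 G \<subseteq> bar_boundaries 2 H"
proof -
  let ?f = "frag_extend (frag_of \<circ> map \<phi>)"
  have lists: "?f c \<in> frags (lists (carrier H) n)" if "c \<in> frags (lists (carrier G) n)" for c n
    by (rule add_hom_in_subgroup[OF add_hom_frag_extend add_subgroup_frags that])
       (use img in \<open>auto simp: lists_def\<close>)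
  have 2: "bar_boundary H 2 (?f c) = ?f (bar_boundary G 2 c)" if "c \<in> frags (lists (carrier G) 2)" for c
    by (rule add_hom_eqI[OF add_hom_comp[OF add_hom_bar_boundary add_hom_frag_extend]
          add_hom_comp[OF add_hom_frag_extend add_hom_bar_boundary] that])
       (auto simp: lists_def length_eq_1_2_3 bar_boundary_of G \<phi> frag_extend_add frag_extend_diff)
  have 3: "bar_boundary H 3 (?f c) = ?f (bar_boundary G 3 c)" if "c \<in> frags (lists (carrier G) 3)" for c
    by (rule add_hom_eqI[OF add_hom_comp[OF add_hom_bar_boundary add_hom_frag_extend]
          add_hom_comp[OF add_hom_frag_extend add_hom_bar_boundary] that])
       (auto simp: lists_def length_eq_1_2_3 bar_boundary_of G \<phi> frag_extend_add frag_extend_diff)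
  show "?f ` cyc G \<subseteq> cyc H" using lists 2 by (auto simp: cyc_def)
  show "?f ` bar_boundaries 2 G \<subseteq> bar_boundaries 2 H"
  proof clarify
    fix c assume "c \<in> bar_boundaries 2 G"
    then obtain e where e: "e \<in> frags (lists (carrier G) 3)" "c = bar_boundary G 3 e"
      by (auto simp: bar_boundaries_eq)
    show "?f c \<in> bar_boundaries 2 H"
      unfolding bar_boundaries_eq e(2) 3[OF e(1), symmetric] by (rule imageI[OF lists[OF e(1)]])
  qed
qed

abbreviation "G_SL \<equiv> SL2 TYPE('a)"
abbreviation "G_B \<equiv> B2 TYPE('a)"
abbreviation "cls_B \<equiv> add_coset (bar_boundaries 2 G_B)"
abbreviation "cls_SL \<equiv> add_coset (bar_boundaries 2 G_SL)"

lemma mult_SL: "monoid.mult G_SL = (**)" and mult_B: "monoid.mult G_B = (**)"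
  and carrier_B: "carrier G_B = BB"
  by (simp_all add: SL2_def B2_def)

lemma H2_B:
  "carrier (H2_B2 TYPE('a)) = cls_B ` cyc G_B" "one (H2_B2 TYPE('a)) = cls_B 0"
  "cls_B x \<otimes>\<^bsub>H2_B2 TYPE('a)\<^esub> cls_B y = cls_B (x + y)"
  unfolding H2_B2_def group_homology_def
  by (rule additive_monoid_mod[OF additive_cyc bar_boundaries_cyc[OF fixing_B] add_subgroup_bar_boundaries])+

lemma H2_SL:
  "carrier (H2_SL2 TYPE('a)) = cls_SL ` cyc G_SL" "one (H2_SL2 TYPE('a)) = cls_SL 0"
  "cls_SL x \<otimes>\<^bsub>H2_SL2 TYPE('a)\<^esub> cls_SL y = cls_SL (x + y)"
  unfolding H2_SL2_def group_homology_def
  by (rule additive_monoid_mod[OF additive_cyc bar_boundaries_cyc[OF fixing_SL] add_subgroup_bar_boundaries])+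

lemma homology_map_coset:
  fixes G :: "('a^2^2, 'b) monoid_scheme" and H :: "('a^2^2, 'c) monoid_scheme"
  assumes "frag_extend (frag_of \<circ> map \<phi>) ` bar_boundaries 2 G \<subseteq> bar_boundaries 2 H"
  shows "homology_map 2 H \<phi> (add_coset (bar_boundaries 2 G) c) =
    add_coset (bar_boundaries 2 H) (frag_extend (frag_of \<circ> map \<phi>) c)"
  unfolding homology_map_def
  by (rule quotient_map_coset[OF _ add_subgroup_bar_boundaries add_subgroup_bar_boundaries add_hom_frag_extend assms])
     (use additive_cyc[of H] in \<open>simp add: additive_monoid_def\<close>)

lemma H2_B_act: "d dvd 1 \<Longrightarrow> H2_B2_act d (cls_B c) = cls_B (conj_bar d c)"
  unfolding H2_B2_act_def conj_bar_def
  by (intro homology_map_coset bar_boundary_natural(2) mult_B diag1_conj_mult)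
     (use diag1_conj_BB in \<open>auto simp: carrier_B\<close>)

lemma H2_SL_act: "d dvd 1 \<Longrightarrow> H2_SL2_act d (cls_SL c) = cls_SL (conj_bar d c)"
  unfolding H2_SL2_act_def conj_bar_def
  by (intro homology_map_coset bar_boundary_natural(2) mult_SL diag1_conj_mult)
     (use diag1_conj_SL in \<open>auto simp: SL_carrier\<close>)

lemma frag_extend_map_id: "frag_extend (frag_of \<circ> map (\<lambda>M. M)) c = c"
  by (rule add_hom_eqI[OF add_hom_frag_extend add_hom_id, of _ UNIV]) simp_all

lemma cyc_mono: "cyc G_B \<subseteq> cyc G_SL" and bar_boundaries_mono: "bar_boundaries 2 G_B \<subseteq> bar_boundaries 2 G_SL"
  using bar_boundary_natural[of G_B G_SL "\<lambda>M. M"]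
  by (auto simp: mult_B mult_SL carrier_B SL_carrier frag_extend_map_id[simplified] image_subset_iff)

lemma H2_inclusion_coset: "H2_inclusion (cls_B c) = cls_SL c"
  unfolding H2_inclusion_def
  by (subst homology_map_coset) (use bar_boundaries_mono in \<open>auto simp: frag_extend_map_id[simplified]\<close>)

lemma square_class_unit:
  assumes "C \<in> carrier (square_class_group TYPE('a))" "d \<in> C"
  shows "d dvd 1"
proof -
  have unit: "b \<in> Units (type_ring TYPE('a)) \<longleftrightarrow> b dvd 1" for b
    unfolding Units_type_ring_iff dvd_def by metis
  show ?thesis using assms
    by (auto simp: square_class_group_def carrier_FactGroup r_coset_def units_of_mult units_of_carrier
        type_ring_mult unit unit_mult)
qed

lemma H2_inclusion_hom:
  "H2_inclusion \<in> square_class_hom (H2_B2 TYPE('a)) H2_B2_act (H2_SL2 TYPE('a)) H2_SL2_act"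
  unfolding square_class_hom_def
proof (intro CollectI conjI ballI)
  show "H2_inclusion \<in> hom (H2_B2 TYPE('a)) (H2_SL2 TYPE('a))"
    by (rule homI) (use cyc_mono in \<open>auto simp: H2_B H2_SL H2_inclusion_coset\<close>)
  fix C d x assume C: "C \<in> carrier (square_class_group TYPE('a))" "d \<in> C" and x: "x \<in> carrier (H2_B2 TYPE('a))"
  have d: "d dvd 1" by (rule square_class_unit[OF C])
  obtain c where "x = cls_B c" using x by (auto simp: H2_B)
  then show "H2_inclusion (H2_B2_act d x) = H2_SL2_act d (H2_inclusion x)"
    by (simp add: H2_B_act[OF d] H2_SL_act[OF d] H2_inclusion_coset)
qed

lemma chains_SL_nil: "chains SL {[]} n = ch n 0"
proof -
  have "tuples 0 = {[]}" by auto
  then show ?thesis by simp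
qed

lemma H2_inclusion_surj:
  "H2_inclusion ` carrier (H2_B2 TYPE('a)) = carrier (H2_SL2 TYPE('a))"
proof
  show "H2_inclusion ` carrier (H2_B2 TYPE('a)) \<subseteq> carrier (H2_SL2 TYPE('a))"
    using cyc_mono by (auto simp: H2_B H2_SL H2_inclusion_coset)
  show "carrier (H2_SL2 TYPE('a)) \<subseteq> H2_inclusion ` carrier (H2_B2 TYPE('a))"
  proof
    fix x assume "x \<in> carrier (H2_SL2 TYPE('a))"
    then obtain c where c: "c \<in> cyc G_SL" "x = cls_SL c" by (auto simp: H2_SL)
    have "c \<in> frags (lists SL 2)" "dv (tens [] c) = 0"
      using c(1) cyc_iff[OF fixing_SL] by (auto simp: SL_carrier)
    moreover have "tens [] c \<in> ch 2 0" by (rule tens_in) (use calculation in auto)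
    ultimately obtain b e where b: "b \<in> frags (lists BB 2)" "dv (tens [p_inf] b) = 0" "e \<in> ch 3 0"
      "tens [] c = tens [] b + dv e" using H2_surj by blast
    have "b \<in> cyc G_B" using b cyc_iff[OF fixing_B] by (simp add: carrier_B)
    moreover have "tens [] (c - b) = dv e" using b(4) by (simp add: add_hom_diff[OF add_hom_tens])
    then have "c - b \<in> bar_boundaries 2 G_SL"
      using b(3) bar_boundaries_iff[OF fixing_SL] by (auto simp: SL_carrier chains_SL_nil)
    then have "x = H2_inclusion (cls_B b)"
      by (simp add: c(2) H2_inclusion_coset add_coset_eq_iff[OF add_subgroup_bar_boundaries])
    ultimately show "x \<in> H2_inclusion ` carrier (H2_B2 TYPE('a))" by (auto simp: H2_B)
  qed
qed

section \<open>The refined scissors congruence group and the connecting map\<close>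

definition tuple_cycles :: "(('a^2) set list \<Rightarrow>\<^sub>0 int) set" where
  "tuple_cycles = {z \<in> frags (tuples 3). dh (deg0 z :: 'a chain) = 0}"

lemma add_subgroup_tuple_cycles: "add_subgroup tuple_cycles"
  using add_subgroup_Int[OF add_subgroup_frags add_subgroup_kernel[OF add_hom_comp[OF add_hom_dh add_hom_deg0]]]
  by (simp add: tuple_cycles_def Int_def)

lemma config_boundary_iff:
  assumes "z \<in> frags (tuples 3)"
  shows "config_boundary 2 z = 0 \<longleftrightarrow> dh (deg0 z :: 'a chain) = 0"
proof -
  have ab: "add_hom (config_boundary 2)" by (simp add: config_boundary_def add_hom_frag_extend)
  have "{..2} = {0, 1, 2::nat}" by auto
  then have "dh (deg0 z :: 'a chain) = deg0 (config_boundary 2 z)"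
    by (intro add_hom_eqI[OF add_hom_comp[OF add_hom_dh add_hom_deg0] add_hom_comp[OF add_hom_deg0 ab] assms])
       (auto simp: tuples_3 config_boundary_def add_hom_diff[OF add_hom_deg0] add_hom_add[OF add_hom_deg0])
  then show ?thesis
    using deg0_cancel[of "config_boundary 2 z" 0, where 'g = "'a^2^2"] by (auto simp: add_hom_zero[OF add_hom_deg0])
qed

lemma additive_tuple_cycles: "additive_monoid (config_cycles TYPE('a) 2) tuple_cycles"
proof -
  have e: "tuple_cycles = {z \<in> frags (tuples 3). config_boundary 2 z = 0}"
    using config_boundary_iff by (auto simp: tuple_cycles_def)
  show ?thesis
    unfolding config_cycles_def config_group_def config_tuples_eq e
    by (rule additive_monoid_kernel) (simp add: config_boundary_def add_hom_frag_extend)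
qed

definition rel_set :: "(('a^2) set list \<Rightarrow>\<^sub>0 int) set" where
  "rel_set = {config_act g z - z | g z. g \<in> SL \<and> z \<in> tuple_cycles}"

abbreviation "coinv_rels \<equiv> coinvariant_relations G_SL config_act (config_cycles TYPE('a) 2)"

lemma config_act_frags: "g \<in> SL \<Longrightarrow> z \<in> frags (tuples m) \<Longrightarrow> config_act g z \<in> frags (tuples m)"
  by (erule add_hom_in_subgroup[OF add_hom_config_act add_subgroup_frags])
     (use stable_tuples[of m] in \<open>auto simp: stable_under_def\<close>)

lemma dh_config_act: "dh (deg0 (config_act M z) :: 'a chain) =
  frag_extend (\<lambda>(l, t). frag_of (l, tuple_act M t)) (dh (deg0 z :: 'a chain))"
proof (rule add_hom_eqI[OF add_hom_comp[OF add_hom_dh add_hom_comp[OF add_hom_deg0 add_hom_config_act]]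
      add_hom_comp[OF add_hom_frag_extend add_hom_comp[OF add_hom_dh add_hom_deg0]], of _ UNIV])
  fix t :: "('a^2) set list"
  show "dh (deg0 (config_act M (frag_of t)) :: 'a chain) =
      frag_extend (\<lambda>(l, t). frag_of (l, tuple_act M t)) (dh (deg0 (frag_of t) :: 'a chain))"
    by (cases "([] :: ('a^2^2) list, t)" rule: face_bd.cases)
       (auto simp: tuple_act_def frag_extend_add frag_extend_diff)
qed simp

lemma config_act_tuple_cycles: "g \<in> SL \<Longrightarrow> z \<in> tuple_cycles \<Longrightarrow> config_act g z \<in> tuple_cycles"
  using config_act_frags by (simp add: tuple_cycles_def dh_config_act)

lemma rel_set_tuple_cycles: "rel_set \<subseteq> tuple_cycles"
  using config_act_tuple_cycles add_subgroup_diff[OF add_subgroup_tuple_cycles] by (auto simp: rel_set_def)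

lemma coinv_rels_eq: "coinv_rels = generate (config_cycles TYPE('a) 2) rel_set"
proof -
  have "carrier (config_cycles TYPE('a) 2) = tuple_cycles" "monoid.mult (config_cycles TYPE('a) 2) = (+)"
    using additive_tuple_cycles by (auto simp: additive_monoid_def)
  then have "{config_act g x \<otimes>\<^bsub>config_cycles TYPE('a) 2\<^esub> inv\<^bsub>config_cycles TYPE('a) 2\<^esub> x |g x.
      g \<in> carrier G_SL \<and> x \<in> carrier (config_cycles TYPE('a) 2)} = rel_set"
    unfolding rel_set_def using additive_monoid_group(2)[OF additive_tuple_cycles] by (force simp: SL_carrier)
  then show ?thesis by (simp add: coinvariant_relations_def)
qed

lemma coinv_rels: "add_subgroup coinv_rels" "coinv_rels \<subseteq> tuple_cycles" "\<And>P. add_subgroup P \<Longrightarrow> rel_set \<subseteq> P \<Longrightarrow> coinv_rels \<subseteq> P"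
  unfolding coinv_rels_eq by (rule additive_monoid_generate[OF additive_tuple_cycles rel_set_tuple_cycles]; assumption)+

abbreviation "cls_R \<equiv> add_coset coinv_rels"

lemma RP_facts:
  "carrier (RP TYPE('a)) = cls_R ` tuple_cycles" "one (RP TYPE('a)) = cls_R 0"
  "cls_R x \<otimes>\<^bsub>RP TYPE('a)\<^esub> cls_R y = cls_R (x + y)"
  unfolding RP_def coinvariants_def by (rule additive_monoid_mod[OF additive_tuple_cycles coinv_rels(2,1)])+

definition lam :: "(('a^2) set list \<Rightarrow>\<^sub>0 int) \<Rightarrow> ('a set \<Rightarrow>\<^sub>0 int)" where
  "lam = frag_extend (frag_of \<circ> triple_class)"

lemma add_hom_lam: "add_hom lam"
  by (simp add: lam_def add_hom_frag_extend)

lemma class_sum_deg0: "class_sum (deg0 z) = lam z"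
  by (rule add_hom_eqI[OF add_hom_comp[OF add_hom_class_sum add_hom_deg0] add_hom_lam, of _ UNIV])
     (simp_all add: lam_def)

lemma lam_coinv_rels: "z \<in> coinv_rels \<Longrightarrow> lam z = 0"
proof -
  have "lam (config_act g z) = lam z" if "g \<in> SL" for g z
    by (rule add_hom_eqI[OF add_hom_comp[OF add_hom_lam add_hom_config_act] add_hom_lam, of _ UNIV])
       (use that triple_class_tuple_act[of g] in \<open>simp_all add: lam_def SL_carrier\<close>)
  then have "rel_set \<subseteq> {z. lam z = 0}" by (auto simp: rel_set_def add_hom_diff[OF add_hom_lam])
  then show "z \<in> coinv_rels \<Longrightarrow> lam z = 0" using coinv_rels(3)[OF add_subgroup_kernel[OF add_hom_lam]] by blast
qed

lemma RP_lambda_coset: "RP_lambda (cls_R z) = lam z"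
proof -
  have "lam ` cls_R z = {lam z}"
    using lam_coinv_rels add_coset_self[OF coinv_rels(1), of z] by (auto simp: add_coset_def add_hom_add[OF add_hom_lam])
  then show ?thesis by (simp add: RP_lambda_def lam_def)
qed

definition lambda_cycles :: "(('a^2) set list \<Rightarrow>\<^sub>0 int) set" where
  "lambda_cycles = {z \<in> tuple_cycles. lam z = 0}"

lemma add_subgroup_lambda_cycles: "add_subgroup lambda_cycles"
  using add_subgroup_Int[OF add_subgroup_tuple_cycles add_subgroup_kernel[OF add_hom_lam]] by (simp add: lambda_cycles_def Int_def)

lemma RP1_facts:
  "carrier (RP1 TYPE('a)) = cls_R ` lambda_cycles"
  "cls_R x \<otimes>\<^bsub>RP1 TYPE('a)\<^esub> cls_R y = cls_R (x + y)"
proof -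
  have "subgroup coinv_rels (config_cycles TYPE('a) 2)"
    by (rule additive_monoid_subgroup(1)[OF additive_tuple_cycles coinv_rels(2,1)])
  then interpret R: comm_group "RP TYPE('a)"
    unfolding RP_def coinvariants_def
    by (rule comm_group.abelian_FactGroup[OF additive_monoid_group(1)[OF additive_tuple_cycles]])
  have ker: "kernel (RP TYPE('a)) (square_class_ring TYPE('a)) RP_lambda = cls_R ` lambda_cycles"
    by (auto simp: kernel_def RP_facts RP_lambda_coset lambda_cycles_def square_class_ring_def)
  have "subgroup (cls_R ` lambda_cycles) (RP TYPE('a))"
  proof (rule R.subgroupI)
    show "cls_R ` lambda_cycles \<subseteq> carrier (RP TYPE('a))" by (auto simp: RP_facts lambda_cycles_def)
    show "cls_R ` lambda_cycles \<noteq> {}" using add_subgroup_zero[OF add_subgroup_lambda_cycles] by blast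
    fix x assume "x \<in> cls_R ` lambda_cycles"
    then obtain z where z: "x = cls_R z" "z \<in> lambda_cycles" by blast
    have mz: "- z \<in> lambda_cycles" by (rule add_subgroup_minus[OF add_subgroup_lambda_cycles z(2)])
    have "inv\<^bsub>RP TYPE('a)\<^esub> x = cls_R (- z)"
      by (rule R.inv_equality) (use z mz in \<open>auto simp: RP_facts lambda_cycles_def\<close>)
    then show "inv\<^bsub>RP TYPE('a)\<^esub> x \<in> cls_R ` lambda_cycles" using mz by blast
    fix y assume "y \<in> cls_R ` lambda_cycles"
    then show "x \<otimes>\<^bsub>RP TYPE('a)\<^esub> y \<in> cls_R ` lambda_cycles"
      using z add_subgroup_add[OF add_subgroup_lambda_cycles] by (auto simp: RP_facts)
  qed
  then show "carrier (RP1 TYPE('a)) = cls_R ` lambda_cycles"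
    unfolding RP1_def ker by (rule subgroup.carrier_subgroup_generated_subgroup)
  show "cls_R x \<otimes>\<^bsub>RP1 TYPE('a)\<^esub> cls_R y = cls_R (x + y)"
    using RP_facts(3) by (simp add: RP1_def subgroup_generated_def)
qed

text \<open>The relations are preserved because \<open>diag1 d\<close> normalises SL2: it carries
  the generator given by \<open>g\<close> and \<open>z\<close> to the one given by the conjugate of
  \<open>g\<close> and the translate of \<open>z\<close>.\<close>

lemma config_act_diag1:
  assumes "d dvd 1"
  shows "z \<in> tuple_cycles \<Longrightarrow> config_act (diag1 d) z \<in> tuple_cycles" "config_act (diag1 d) ` coinv_rels \<subseteq> coinv_rels"
proof -
  have fr: "config_act (diag1 d) z \<in> frags (tuples 3)" if "z \<in> frags (tuples 3)" for z
    by (rule add_hom_in_subgroup[OF add_hom_config_act add_subgroup_frags that])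
       (use diag1_tuples[OF assms] in simp)
  show tuple_cycles: "config_act (diag1 d) z \<in> tuple_cycles" if "z \<in> tuple_cycles" for z
    using that fr by (simp add: tuple_cycles_def dh_config_act)
  have "config_act (diag1 d) (config_act g z) = config_act (diag1_conj d g) (config_act (diag1 d) z)" for g z
    by (rule add_hom_eqI[OF add_hom_comp[OF add_hom_config_act add_hom_config_act]
          add_hom_comp[OF add_hom_config_act add_hom_config_act], of _ UNIV])
       (simp_all add: diag1_conj_act[OF assms])
  then have "rel_set \<subseteq> {z. config_act (diag1 d) z \<in> rel_set}"
    using tuple_cycles diag1_conj_SL[OF assms] by (fastforce simp: rel_set_def add_hom_diff[OF add_hom_config_act])
  moreover have "rel_set \<subseteq> coinv_rels" unfolding coinv_rels_eq by (auto intro: generate.incl)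
  ultimately have "rel_set \<subseteq> {z. config_act (diag1 d) z \<in> coinv_rels}" by blast
  then have "coinv_rels \<subseteq> {z. config_act (diag1 d) z \<in> coinv_rels}"
    by (rule coinv_rels(3)[OF add_subgroup_vimage[OF add_hom_config_act coinv_rels(1)]])
  then show "config_act (diag1 d) ` coinv_rels \<subseteq> coinv_rels" by blast
qed

lemma RP_act_coset: "d dvd 1 \<Longrightarrow> RP_act d (cls_R z) = cls_R (config_act (diag1 d) z)"
  unfolding RP_act_def
  by (rule quotient_map_coset[OF _ coinv_rels(1) coinv_rels(1) add_hom_config_act config_act_diag1(2)])
     (use additive_tuple_cycles in \<open>auto simp: additive_monoid_def\<close>)

text \<open>The value of any connected pair over the coset; by \<open>delta_eq\<close> the choice
  does not matter.\<close>

definition delta :: "(('a^2) set list \<Rightarrow>\<^sub>0 int) set \<Rightarrow> (('a^2^2) list \<Rightarrow>\<^sub>0 int) set" where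
  "delta E = (SOME Y. \<exists>z c. z \<in> lambda_cycles \<and> connecting z c \<and> E = cls_R z \<and> Y = cls_B c)"

lemma connecting_coinv_rels: "z \<in> coinv_rels \<Longrightarrow> connecting z 0"
proof -
  have "add_subgroup {z. connecting z 0}"
    using connecting_zero connecting_diff[of _ 0 _ 0] by (auto simp: add_subgroup_def)
  moreover have "rel_set \<subseteq> {z. connecting z 0}"
    using connecting_coinvariant by (auto simp: rel_set_def tuple_cycles_def)
  ultimately show "z \<in> coinv_rels \<Longrightarrow> connecting z 0" using coinv_rels(3) by blast
qed

text \<open>Two representatives of a coset differ by a relation, which is connected to 0; so the
  difference of the two values is connected to 0 as well, hence a boundary.\<close>

lemma delta_eq:
  assumes "z \<in> lambda_cycles" "connecting z c"
  shows "delta (cls_R z) = cls_B c"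
  unfolding delta_def
proof (rule some_equality)
  show "\<exists>z' c'. z' \<in> lambda_cycles \<and> connecting z' c' \<and> cls_R z = cls_R z' \<and> cls_B c = cls_B c'" using assms by blast
  fix Y assume "\<exists>z' c'. z' \<in> lambda_cycles \<and> connecting z' c' \<and> cls_R z = cls_R z' \<and> Y = cls_B c'"
  then obtain z' c' where z': "connecting z' c'" "cls_R z = cls_R z'" "Y = cls_B c'" by blast
  have "connecting (z - z') 0" using z'(2) add_coset_eq_iff[OF coinv_rels(1)] connecting_coinv_rels by blast
  from connecting_diff[OF this connecting_diff[OF assms(2) z'(1)]] have "connecting 0 (0 - (c - c'))" by simp
  then have "connecting 0 (c' - c)" by simp
  then have "tens [p_inf] (c' - c) \<in> boundaries_B" by (rule connecting_unique)
  then have "c' - c \<in> bar_boundaries 2 G_B" using bar_boundaries_iff[OF fixing_B] by (simp add: carrier_B)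
  then show "Y = cls_B c" by (simp add: z'(3) add_coset_eq_iff[OF add_subgroup_bar_boundaries])
qed

lemma lambda_cycles_connecting: "z \<in> lambda_cycles \<Longrightarrow> \<exists>c. connecting z c"
  using connecting_exists by (simp add: lambda_cycles_def tuple_cycles_def class_sum_deg0)

lemma connecting_cyc: "connecting z c \<Longrightarrow> c \<in> cyc G_B"
  using connecting_cycle[of z c] cyc_iff[OF fixing_B] by (auto simp: carrier_B elim: connectingE)

text \<open>The translated zigzag again begins with a vertical boundary, and the class sum of such a
  boundary vanishes. This avoids describing how \<open>diag1 d\<close> moves square classes.\<close>

lemma config_act_diag1_lambda_cycles:
  assumes "d dvd 1" "z \<in> lambda_cycles"
  shows "config_act (diag1 d) z \<in> lambda_cycles"
proof -
  obtain c where "connecting z c" using lambda_cycles_connecting[OF assms(2)] by blast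
  then have "connecting (config_act (diag1 d) z) (conj_bar d c)" by (rule connecting_equivariant[OF assms(1)])
  then obtain y where y: "y \<in> ch 1 3" "deg0 (config_act (diag1 d) z) = dv y" by (rule connectingE)
  then have "lam (config_act (diag1 d) z) = 0" using class_sum_dv[OF y(1)] class_sum_deg0 by metis
  then show ?thesis using config_act_diag1(1)[OF assms(1)] assms(2) by (simp add: lambda_cycles_def)
qed

lemma delta_hom: "delta \<in> square_class_hom (RP1 TYPE('a)) RP_act (H2_B2 TYPE('a)) H2_B2_act"
  unfolding square_class_hom_def
proof (intro CollectI conjI ballI)
  show "delta \<in> hom (RP1 TYPE('a)) (H2_B2 TYPE('a))"
  proof (rule homI)
    fix x assume "x \<in> carrier (RP1 TYPE('a))"
    then obtain z where z: "z \<in> lambda_cycles" "x = cls_R z" by (auto simp: RP1_facts)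
    obtain c where c: "connecting z c" using lambda_cycles_connecting[OF z(1)] by blast
    show "delta x \<in> carrier (H2_B2 TYPE('a))"
      using connecting_cyc[OF c] by (auto simp: z(2) delta_eq[OF z(1) c] H2_B)
    fix y assume "y \<in> carrier (RP1 TYPE('a))"
    then obtain z' where z': "z' \<in> lambda_cycles" "y = cls_R z'" by (auto simp: RP1_facts)
    obtain c' where c': "connecting z' c'" using lambda_cycles_connecting[OF z'(1)] by blast
    show "delta (x \<otimes>\<^bsub>RP1 TYPE('a)\<^esub> y) = delta x \<otimes>\<^bsub>H2_B2 TYPE('a)\<^esub> delta y"
      using delta_eq[OF add_subgroup_add[OF add_subgroup_lambda_cycles z(1) z'(1)] connecting_add[OF c c']]
      by (simp add: z(2) z'(2) RP1_facts(2) H2_B(3) delta_eq[OF z(1) c] delta_eq[OF z'(1) c'])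
  qed
  fix C d x assume C: "C \<in> carrier (square_class_group TYPE('a))" "d \<in> C" and "x \<in> carrier (RP1 TYPE('a))"
  then obtain z where z: "z \<in> lambda_cycles" "x = cls_R z" by (auto simp: RP1_facts)
  have d: "d dvd 1" by (rule square_class_unit[OF C])
  obtain c where c: "connecting z c" using lambda_cycles_connecting[OF z(1)] by blast
  show "delta (RP_act d x) = H2_B2_act d (delta x)"
    using delta_eq[OF config_act_diag1_lambda_cycles[OF d z(1)] connecting_equivariant[OF d c]]
    by (simp add: z(2) RP_act_coset[OF d] delta_eq[OF z(1) c] H2_B_act[OF d])
qed

lemma delta_image:
  "delta ` carrier (RP1 TYPE('a)) = kernel (H2_B2 TYPE('a)) (H2_SL2 TYPE('a)) H2_inclusion"
proof (intro equalityI subsetI)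
  have bd: "c \<in> bar_boundaries 2 G_SL \<longleftrightarrow> tens [] c \<in> dv ` ch 3 0" for c
    using bar_boundaries_iff[OF fixing_SL] by (simp add: SL_carrier chains_SL_nil)
  have trivial: "H2_inclusion (cls_B c) = one (H2_SL2 TYPE('a)) \<longleftrightarrow> c \<in> bar_boundaries 2 G_SL" for c
    by (simp add: H2_inclusion_coset H2_SL(2) add_coset_eq_iff[OF add_subgroup_bar_boundaries])
  fix x
  {
    assume "x \<in> delta ` carrier (RP1 TYPE('a))"
    then obtain z where z: "z \<in> lambda_cycles" "x = delta (cls_R z)" by (auto simp: RP1_facts)
    obtain c where c: "connecting z c" using lambda_cycles_connecting[OF z(1)] by blast
    then show "x \<in> kernel (H2_B2 TYPE('a)) (H2_SL2 TYPE('a)) H2_inclusion"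
      using connecting_cyc[OF c] connecting_kernel[OF c]
      by (simp add: kernel_def z(2) delta_eq[OF z(1) c] trivial bd H2_B(1))
  next
    assume x: "x \<in> kernel (H2_B2 TYPE('a)) (H2_SL2 TYPE('a)) H2_inclusion"
    then obtain c where c: "c \<in> cyc G_B" "x = cls_B c" by (auto simp: kernel_def H2_B)
    have t: "tens [] c \<in> dv ` ch 3 0" using x by (simp add: kernel_def c(2) trivial bd)
    have "c \<in> frags (lists BB 2)" "dv (tens [p_inf] c) = 0"
      using c(1) cyc_iff[OF fixing_B] by (auto simp: carrier_B)
    from connecting_onto_kernel[OF this t] obtain z where z: "z \<in> frags (tuples 3)"
      "dh (deg0 z :: 'a chain) = 0" "class_sum (deg0 z) = 0" "connecting z c" .
    then have "z \<in> lambda_cycles" by (simp add: lambda_cycles_def tuple_cycles_def class_sum_deg0)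
    then show "x \<in> delta ` carrier (RP1 TYPE('a))"
      using delta_eq[OF _ z(4)] by (auto simp: c(2) RP1_facts(1) intro!: image_eqI[of _ _ "cls_R z"])
  }
qed

end

theorem theoremB:
  fixes \<mm> :: "'a::{comm_ring_1, finite} set"
  assumes "{I. maximalideal I (type_ring TYPE('a))} = {\<mm>}"
    and "group.ord (add_monoid (type_ring TYPE('a) Quot \<mm>)) \<one>\<^bsub>type_ring TYPE('a) Quot \<mm>\<^esub> > 2"
  shows "H2_inclusion \<in> square_class_hom (H2_B2 TYPE('a)) H2_B2_act (H2_SL2 TYPE('a)) H2_SL2_act \<and>
    H2_inclusion ` carrier (H2_B2 TYPE('a)) = carrier (H2_SL2 TYPE('a)) \<and>
    (\<exists>\<delta> \<in> square_class_hom (RP1 TYPE('a)) RP_act (H2_B2 TYPE('a)) H2_B2_act.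
      \<delta> ` carrier (RP1 TYPE('a)) = kernel (H2_B2 TYPE('a)) (H2_SL2 TYPE('a)) H2_inclusion)"
proof -
  obtain \<gamma> where "odd_local_ring \<mm> \<gamma>" by (rule odd_local_ringI[OF assms])
  then interpret odd_local_ring \<mm> \<gamma> .
  show ?thesis
    using H2_inclusion_hom H2_inclusion_surj delta_hom delta_image by blast
qed

end
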